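(* Let $G$ be a $3$-edge-connected and internally $4$-edge-connected graph which is sausage reduced. If $|V(G)|\ge 6$, then $G$ has no immersion of $W_4$ if and only if $G$ is cubic.
   Context: All graphs are finite, loopless and undirected, and parallel edges are permitted. Immersion: if $xy, yz$ are two distinct edges of a graph sharing the vertex $y$, splitting them off at $y$ means deleting both edges and adding a new edge $xz$ (if $x=z$, the resulting loop is discarded). A graph $G$ has an immersion of $H$ (written $G\succ H$) if a graph isomorphic to $H$ can be obtained from a subgraph of $G$ by a sequence of splittings. Equivalently, there is a map $\phi$ sending $V(H)$ injectively into $V(G)$ and each edge $uv$ of $H$ to a path of $G$ from $\phi(u)$ to $\phi(v)$, so that the paths $\phi(e),\phi(f)$ are edge-disjoint for distinct $e,f\in E(H)$ (the paths may pass through vertices of $\phi(V(H))$). $W_4$ is the graph on five vertices obtained from a cycle of length $4$ by adding one new vertex adjacent to every vertex of the cycle. For $X\subseteq V(G)$, $d(X)$ is the number of edges with exactly one endpoint in $X$. $G$ is $k$-edge-connected if $d(X)\ge k$ whenever $|X|,|V(G)\setminus X|\ge 1$, and internally $k$-edge-connected if $d(X)\ge k$ whenever $|X|,|V(G)\setminus X|\ge 2$. A graph is cubic if every vertex has degree $3$. For $Y\subset V(G)$, $G.Y$ denotes the graph obtained from $G$ by identifying $Y$ to a single vertex and deleting any loops created (parallel edges are kept). A doubled cycle is a graph obtained from a cycle by adding a second copy of each edge. For a proper subset $X\subset V(G)$ with $|X|=k\ge 2$, $G[X]$ is a chain of sausages of order $k$ in $G$ if $G.(V(G)\setminus X)$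 is a doubled cycle (of length $k+1$). $G$ is sausage reduced if it has no chain of sausages of order at least $3$. *)

theory Defs
  imports Main
begin

text \<open>Finite loopless undirected multigraphs. An edge is a name; parallel edges are distinct names
  with the same set of two ends.\<close>

record ('v, 'e) mgraph =
  verts :: "'v set"
  edges :: "'e set"
  ends :: "'e \<Rightarrow> 'v set"

definition multigraph :: "('v, 'e) mgraph \<Rightarrow> bool" where
  "multigraph G \<longleftrightarrow> finite (verts G) \<and> finite (edges G) \<and>
     (\<forall>e \<in> edges G. ends G e \<subseteq> verts G \<and> card (ends G e) = 2)"

definition isomorphic :: "('v, 'e) mgraph \<Rightarrow> ('w, 'f) mgraph \<Rightarrow> bool" where
  "isomorphic G H \<longleftrightarrow> (\<exists>f g. bij_betw f (verts G) (verts H) \<and> bij_betw g (edges G) (edges H) \<and>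
     (\<forall>e \<in> edges G. ends H (g e) = f ` ends G e))"

definition degree :: "('v, 'e) mgraph \<Rightarrow> 'v \<Rightarrow> nat" where
  "degree G v = card {e \<in> edges G. v \<in> ends G e}"

definition cubic :: "('v, 'e) mgraph \<Rightarrow> bool" where
  "cubic G \<longleftrightarrow> (\<forall>v \<in> verts G. degree G v = 3)"

definition cut_size :: "('v, 'e) mgraph \<Rightarrow> 'v set \<Rightarrow> nat" where
  "cut_size G X = card {e \<in> edges G. card (ends G e \<inter> X) = 1}"

definition edge_connected :: "nat \<Rightarrow> ('v, 'e) mgraph \<Rightarrow> bool" where
  "edge_connected k G \<longleftrightarrow>
     (\<forall>X \<subseteq> verts G. card X \<ge> 1 \<and> card (verts G - X) \<ge> 1 \<longrightarrow> cut_size G X \<ge> k)"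

definition internally_edge_connected :: "nat \<Rightarrow> ('v, 'e) mgraph \<Rightarrow> bool" where
  "internally_edge_connected k G \<longleftrightarrow>
     (\<forall>X \<subseteq> verts G. card X \<ge> 2 \<and> card (verts G - X) \<ge> 2 \<longrightarrow> cut_size G X \<ge> k)"

text \<open>A path is given by its vertex sequence together with its edge sequence, since with parallel
  edges the vertices do not determine the edges.\<close>

definition is_path :: "('v, 'e) mgraph \<Rightarrow> 'v list \<Rightarrow> 'e list \<Rightarrow> bool" where
  "is_path G vs es \<longleftrightarrow> length vs = Suc (length es) \<and> distinct vs \<and>
     set vs \<subseteq> verts G \<and> set es \<subseteq> edges G \<and>
     (\<forall>i < length es. ends G (es ! i) = {vs ! i, vs ! Suc i})"

text \<open>\<open>immerses G H\<close> says that \<open>G\<close> has an immersion of \<open>H\<close>. The map sends the edge \<open>e\<close> of \<open>H\<close> to the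
  path with vertices \<open>P e\<close> and edges \<open>Q e\<close>. Edges are undirected, so only the unordered pair of the
  ends of the path is prescribed. Equivalently, a copy of \<open>H\<close> arises from a subgraph of \<open>G\<close> by
  splitting off pairs of adjacent edges, where vertices that become isolated on the way may be
  dropped.\<close>

definition immerses :: "('v, 'e) mgraph \<Rightarrow> ('w, 'f) mgraph \<Rightarrow> bool" where
  "immerses G H \<longleftrightarrow> (\<exists>\<phi> P Q. inj_on \<phi> (verts H) \<and> \<phi> ` verts H \<subseteq> verts G \<and>
     (\<forall>e \<in> edges H. is_path G (P e) (Q e) \<and> {hd (P e), last (P e)} = \<phi> ` ends H e) \<and>
     (\<forall>e \<in> edges H. \<forall>f \<in> edges H. e \<noteq> f \<longrightarrow> set (Q e) \<inter> set (Q f) = {}))"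

text \<open>The rim of the wheel is the cycle \<open>0, 1, 2, 3\<close> and the hub is \<open>4\<close>.\<close>

definition W4 :: "(nat, nat set) mgraph" where
  "W4 = \<lparr>verts = {..4},
         edges = {{0, 1}, {1, 2}, {2, 3}, {3, 0}, {4, 0}, {4, 1}, {4, 2}, {4, 3}},
         ends = (\<lambda>e. e)\<rparr>"

text \<open>\<open>identify G Y\<close> is \<open>G.Y\<close>: the nonempty set \<open>Y\<close> becomes the vertex \<open>None\<close>. The loops
  created are exactly the edges with both ends in \<open>Y\<close>.\<close>

definition identify :: "('v, 'e) mgraph \<Rightarrow> 'v set \<Rightarrow> ('v option, 'e) mgraph" where
  "identify G Y = \<lparr>verts = insert None (Some ` (verts G - Y)),
                   edges = {e \<in> edges G. \<not> ends G e \<subseteq> Y},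
                   ends = (\<lambda>e. (\<lambda>v. if v \<in> Y then None else Some v) ` ends G e)\<rparr>"

text \<open>The doubled cycle of length \<open>n\<close>, loopless and obtained from a genuine cycle when \<open>n \<ge> 3\<close>.\<close>

definition doubled_cycle :: "nat \<Rightarrow> (nat, nat \<times> bool) mgraph" where
  "doubled_cycle n = \<lparr>verts = {..<n}, edges = {..<n} \<times> UNIV,
                      ends = (\<lambda>(i, b). {i, Suc i mod n})\<rparr>"

definition chain_of_sausages :: "('v, 'e) mgraph \<Rightarrow> 'v set \<Rightarrow> nat \<Rightarrow> bool" where
  "chain_of_sausages G X k \<longleftrightarrow> X \<subset> verts G \<and> card X = k \<and> k \<ge> 2 \<and>
     isomorphic (identify G (verts G - X)) (doubled_cycle (k + 1))"

definition sausage_reduced :: "('v, 'e) mgraph \<Rightarrow> bool" where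
  "sausage_reduced G \<longleftrightarrow> \<not> (\<exists>X k. k \<ge> 3 \<and> chain_of_sausages G X k)"

end

theory Submission
  imports Defs
begin

text \<open>
  An immersion only depends on the multiplicities \<open>m x y\<close> of the edges between two vertices, and
  containing \<open>W4\<close> becomes the closure of ``lies above a wheel'' under splitting off. Suppose that \<open>m\<close>
  has at least six vertices, one of them of degree at least 4, satisfies the cut conditions, has
  neither \<open>W4\<close> nor a chain of three sausages, and is minimal. Let \<open>Z\<close> be a side of a cut of size at
  least 4, and suppose that no set between \<open>{v}\<close> and \<open>Z\<close> has a smaller boundary. By a Menger argument
  contracting \<open>Z\<close> onto \<open>v\<close> creates no \<open>W4\<close>, so that the contraction contains a chain or is an
  exceptional graph on five vertices. This excludes cyclic arrangements of four cuts
  of size 2, double edges at a vertex of degree at most 4, and all nontrivial 4-cuts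
  except those around two cubic vertices or between three and three vertices. On the other hand,
  deleting an edge at a vertex of degree at least 4, and suppressing the other end if it is cubic,
  also yields a smaller graph, hence must be blocked by such a cut. What remains are graphs with a
  single noncubic vertex, where an edge between cubic vertices can be deleted, and graphs on six
  vertices, where two crossing cuts contradict each other.
\<close>

section \<open>Multiplicities and cuts\<close>

text \<open>Contractions can bring a graph down to five vertices, so the induction is anchored at
  five instead of six, and \<open>star5\<close> is the price: a reduction that ends in it is refuted
  by its degrees or cuts, or it is undone, and the expanded graph is shown to contain a wheel, a
  chain or a configuration excluded before. Multiplicities are unbounded, so the case of five
  vertices is no finite enumeration; it works with lower bounds on the multiplicities that are
  refined step by step. The induction carries along more than connectivity: cubic graphs have no
  \<open>W4\<close>, hence every reduction must leave a vertex of degree at least 4. Contracting one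
  side of a cut of size at least 4 does so by itself, the size being the degree of the new vertex.
  Deleting an edge may destroy the last such vertex, which is why a single noncubic vertex of degree
  4 is treated separately. The second danger is a cut of size 3 with two vertices on both sides;
  deleting an edge makes one only out of a cut of size 4, and so these are classified before any
  edge is deleted.\<close>

definition mg :: "'a set \<Rightarrow> ('a \<Rightarrow> 'a \<Rightarrow> nat) \<Rightarrow> bool" where
  "mg V m \<longleftrightarrow> finite V \<and> (\<forall>x y. m x y = m y x) \<and> (\<forall>x. m x x = 0) \<and> (\<forall>x y. m x y \<noteq> 0 \<longrightarrow> x \<in> V)"

text \<open>Ordered pairs are counted, so an edge with both ends in \<open>A \<inter> B\<close>
  counts twice; in particular \<open>ew m V V\<close> is twice the number of edges.\<close>

definition ew :: "('a \<Rightarrow> 'a \<Rightarrow> nat) \<Rightarrow> 'a set \<Rightarrow> 'a set \<Rightarrow> nat" where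
  "ew m A B = (\<Sum>a\<in>A. \<Sum>b\<in>B. m a b)"

definition cut :: "'a set \<Rightarrow> ('a \<Rightarrow> 'a \<Rightarrow> nat) \<Rightarrow> 'a set \<Rightarrow> nat" where
  "cut V m A = ew m A (V - A)"

definition deg :: "'a set \<Rightarrow> ('a \<Rightarrow> 'a \<Rightarrow> nat) \<Rightarrow> 'a \<Rightarrow> nat" where
  "deg V m x = (\<Sum>y\<in>V. m x y)"

text \<open>Comparing unordered pairs changes both orientations at once. On a missing edge the
  truncated subtraction leaves 0.\<close>

definition sub1 :: "('a \<Rightarrow> 'a \<Rightarrow> nat) \<Rightarrow> 'a \<Rightarrow> 'a \<Rightarrow> 'a \<Rightarrow> 'a \<Rightarrow> nat" where
  "sub1 m p q = (\<lambda>x y. if {x, y} = {p, q} then m x y - 1 else m x y)"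

definition add1 :: "('a \<Rightarrow> 'a \<Rightarrow> nat) \<Rightarrow> 'a \<Rightarrow> 'a \<Rightarrow> 'a \<Rightarrow> 'a \<Rightarrow> nat" where
  "add1 m p q = (\<lambda>x y. if {x, y} = {p, q} then m x y + 1 else m x y)"

definition off :: "('a \<Rightarrow> 'a \<Rightarrow> nat) \<Rightarrow> 'a \<Rightarrow> 'a \<Rightarrow> 'a \<Rightarrow> nat" where
  "off m w = (\<lambda>x y. if x = w \<or> y = w then 0 else m x y)"

definition split :: "('a \<Rightarrow> 'a \<Rightarrow> nat) \<Rightarrow> 'a \<Rightarrow> 'a \<Rightarrow> 'a \<Rightarrow> 'a \<Rightarrow> 'a \<Rightarrow> nat" where
  "split m x y z = add1 (sub1 (sub1 m x y) y z) x z"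

text \<open>The wheel rule asks only for lower bounds, and in this way subgraphs are covered.
  Splitting off with equal outer ends would merely delete edges, which is covered as well; hence
  \<open>x\<close>, \<open>y\<close>, \<open>z\<close> are distinct.\<close>

inductive wheeled :: "('a \<Rightarrow> 'a \<Rightarrow> nat) \<Rightarrow> bool" where
  wheel: "distinct [h, a, b, c, d] \<Longrightarrow> 1 \<le> m h a \<Longrightarrow> 1 \<le> m h b \<Longrightarrow> 1 \<le> m h c \<Longrightarrow> 1 \<le> m h d \<Longrightarrow>
    1 \<le> m a b \<Longrightarrow> 1 \<le> m b c \<Longrightarrow> 1 \<le> m c d \<Longrightarrow> 1 \<le> m d a \<Longrightarrow> wheeled m"
| split: "distinct [x, y, z] \<Longrightarrow> 1 \<le> m x y \<Longrightarrow> 1 \<le> m y z \<Longrightarrow> wheeled (split m x y z) \<Longrightarrow> wheeled m"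

text \<open>The same sequence of splittings works above \<open>m\<close>, since addition and
  truncated subtraction are monotone.\<close>

lemma wheeled_mono:
  assumes "wheeled m" "\<And>x y. m x y \<le> m' x y"
  shows "wheeled m'"
  using assms
proof (induction arbitrary: m')
  case (wheel h a b c d m)
  have le: "1 \<le> m x y \<Longrightarrow> 1 \<le> m' x y" for x y using wheel.prems[of x y] by linarith
  show ?case by (rule wheeled.wheel[OF wheel(1)]) (use wheel(2-9) le in simp_all)
next
  case (split x y z m)
  have "split m x y z u v \<le> split m' x y z u v" for u v
    using split.prems[of u v] unfolding split_def add1_def sub1_def by (simp add: diff_le_mono)
  then have w: "wheeled (split m' x y z)" by (rule split.IH)
  show ?case
    by (rule wheeled.split[OF split.hyps(1) _ _ w])
      (use split.hyps(2,3) split.prems[of x y] split.prems[of y z] in linarith)+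
qed

text \<open>Erasing the other edges at \<open>z\<close> only lowers multiplicities, so the graph
  with \<open>z\<close> removed and \<open>pq\<close> added lies below the one obtained by splitting
  off \<open>p z q\<close>.\<close>

lemma wheeled_suppress:
  assumes "wheeled (add1 (off m z) p q)" "distinct [p, z, q]" "1 \<le> m p z" "1 \<le> m z q"
  shows "wheeled m"
proof (rule wheeled.split[of p z q])
  show "wheeled (split m p z q)"
    by (rule wheeled_mono[OF assms(1)])
      (use assms(2) in \<open>auto simp: split_def add1_def sub1_def off_def doubleton_eq_iff\<close>)
qed (use assms in auto)

section \<open>Cuts and degrees\<close>

lemma mgD:
  assumes "mg V m"
  shows "finite V" "m x y = m y x" "m x x = 0" "x \<notin> V \<Longrightarrow> m x y = 0" "y \<notin> V \<Longrightarrow> m x y = 0"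
  using assms unfolding mg_def by metis+

lemma ew_commute: "mg V m \<Longrightarrow> ew m A B = ew m B A"
  unfolding ew_def by (subst sum.swap) (simp add: mgD(2)[of V m])

lemma ew_empty [simp]: "ew m {} B = 0" "ew m A {} = 0"
  by (simp_all add: ew_def)

lemma ew_singleton [simp]: "ew m {a} {b} = m a b"
  by (simp add: ew_def)

lemma ew_Un_left:
  "finite A \<Longrightarrow> finite B \<Longrightarrow> A \<inter> B = {} \<Longrightarrow> ew m (A \<union> B) C = ew m A C + ew m B C"
  by (simp add: ew_def sum.union_disjoint)

lemma ew_Un_right:
  "finite A \<Longrightarrow> finite B \<Longrightarrow> A \<inter> B = {} \<Longrightarrow> ew m C (A \<union> B) = ew m C A + ew m C B"
  by (simp add: ew_def sum.union_disjoint sum.distrib)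

lemma ew_insert_left: "finite A \<Longrightarrow> a \<notin> A \<Longrightarrow> ew m (insert a A) C = ew m {a} C + ew m A C"
  by (simp add: ew_def)

lemma ew_insert_right: "finite A \<Longrightarrow> a \<notin> A \<Longrightarrow> ew m C (insert a A) = ew m C {a} + ew m C A"
  by (simp add: ew_def sum.distrib)

lemma ew_mono: "finite A' \<Longrightarrow> finite B' \<Longrightarrow> A \<subseteq> A' \<Longrightarrow> B \<subseteq> B' \<Longrightarrow> ew m A B \<le> ew m A' B'"
  unfolding ew_def
  by (rule order_trans[OF sum_mono sum_mono2]) (auto intro: sum_mono2)

lemma ew_cong: "(\<And>x y. x \<in> A \<Longrightarrow> y \<in> B \<Longrightarrow> m x y = m' x y) \<Longrightarrow> ew m A B = ew m' A B"
  unfolding ew_def by (intro sum.cong) auto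

lemma ew_eq_0: "finite A \<Longrightarrow> finite B \<Longrightarrow> ew m A B = 0 \<longleftrightarrow> (\<forall>a\<in>A. \<forall>b\<in>B. m a b = 0)"
  by (simp add: ew_def)

lemma ew_ge: "finite A \<Longrightarrow> finite B \<Longrightarrow> a \<in> A \<Longrightarrow> b \<in> B \<Longrightarrow> m a b \<le> ew m A B"
  using ew_mono[of A B "{a}" "{b}" m] by simp

lemma cut_part: "A \<inter> B = {} \<Longrightarrow> V = A \<union> B \<Longrightarrow> cut V m A = ew m A B"
  by (simp add: cut_def Un_Diff Diff_triv Int_commute)

lemma cut_compl: "mg V m \<Longrightarrow> A \<subseteq> V \<Longrightarrow> cut V m (V - A) = cut V m A"
  by (simp add: cut_def double_diff ew_commute[of V m])

lemma deg_ew: "deg V m x = ew m {x} V"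
  by (simp add: deg_def ew_def)

lemma deg_cut: "mg V m \<Longrightarrow> x \<in> V \<Longrightarrow> deg V m x = cut V m {x}"
  by (simp add: deg_def cut_def ew_def mgD(1,3) sum.remove[of V x])

lemma deg_split: "mg V m \<Longrightarrow> A \<subseteq> V \<Longrightarrow> deg V m x = ew m {x} A + ew m {x} (V - A)"
proof -
  assume a: "mg V m" "A \<subseteq> V"
  then have f: "finite A" "finite (V - A)" using mgD(1) finite_subset by blast+
  have "ew m {x} (A \<union> (V - A)) = ew m {x} A + ew m {x} (V - A)" by (rule ew_Un_right[OF f]) blast
  moreover have "A \<union> (V - A) = V" using a by blast
  ultimately show ?thesis unfolding deg_ew by simp
qed

text \<open>The edges from \<open>x\<close> to \<open>A\<close> leave the boundary and the remaining
  edges at \<open>x\<close> enter it; sums on both sides avoid truncated subtraction.\<close>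

lemma cut_insert:
  assumes "mg V m" "A \<subseteq> V" "x \<in> V" "x \<notin> A"
  shows "cut V m (insert x A) + 2 * ew m {x} A = cut V m A + deg V m x"
proof -
  have f: "finite V" "finite A" using assms mgD(1) finite_subset by metis+
  define B where "B = V - A - {x}"
  have B: "finite B" "x \<notin> B" "V - A = insert x B" "V - insert x A = B" using assms f unfolding B_def by auto
  have "cut V m (insert x A) = ew m {x} B + ew m A B"
    unfolding cut_def B(4) by (rule ew_insert_left[OF f(2) assms(4)])
  moreover have "cut V m A = ew m {x} A + ew m A B"
    unfolding cut_def B(3) ew_insert_right[OF B(1,2)] ew_commute[OF assms(1), of A "{x}"] ..
  moreover have "deg V m x = ew m {x} A + ew m {x} B"
    unfolding deg_split[OF assms(1,2)] B(3) ew_insert_right[OF B(1,2)] by (simp add: mgD(3)[OF assms(1)])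
  ultimately show ?thesis by linarith
qed

lemma cut_pair:
  assumes "mg V m" "x \<in> V" "y \<in> V" "x \<noteq> y"
  shows "cut V m {x, y} + 2 * m x y = deg V m x + deg V m y"
proof -
  have "cut V m {x, y} + 2 * ew m {x} {y} = cut V m {y} + deg V m x"
    by (rule cut_insert[OF assms(1) _ assms(2)]) (use assms in auto)
  then show ?thesis unfolding deg_cut[OF assms(1,3)] ew_singleton by linarith
qed

text \<open>Submodularity in exact form: the error term counts the edges between the two other
  corners. Replacing \<open>Y\<close> by its complement gives the equation for the other
  diagonal.\<close>

lemma cut_corners:
  assumes "mg V m" "X \<subseteq> V" "Y \<subseteq> V"
  shows "cut V m X + cut V m Y = cut V m (X \<inter> Y) + cut V m (V - (X \<union> Y)) + 2 * ew m (X - Y) (Y - X)"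
proof -
  define P Q S T where "P = X \<inter> Y" "Q = X - Y" "S = Y - X" "T = V - (X \<union> Y)"
  note d = P_Q_S_T_def
  have f: "finite P" "finite Q" "finite S" "finite T"
    using assms mgD(1)[of V m] unfolding d by (auto intro: finite_subset)
  have eqs: "X = P \<union> Q" "Y = P \<union> S" "V = P \<union> Q \<union> S \<union> T" using assms unfolding d by auto
  have dj: "P \<inter> Q = {}" "P \<inter> S = {}" "P \<inter> T = {}" "Q \<inter> S = {}" "Q \<inter> T = {}" "S \<inter> T = {}"
    unfolding d by auto
  have V1: "V = (P \<union> Q) \<union> (S \<union> T)" "V = (P \<union> S) \<union> (Q \<union> T)" "V = P \<union> (Q \<union> (S \<union> T))"
    "V = T \<union> (P \<union> (Q \<union> S))"
    using eqs(3) by auto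
  have c1: "cut V m X = ew m (P \<union> Q) (S \<union> T)"
    unfolding eqs(1) by (rule cut_part[OF _ V1(1)]) (use dj in auto)
  have c2: "cut V m Y = ew m (P \<union> S) (Q \<union> T)"
    unfolding eqs(2) by (rule cut_part[OF _ V1(2)]) (use dj in auto)
  have c3: "cut V m P = ew m P (Q \<union> (S \<union> T))"
    by (rule cut_part[OF _ V1(3)]) (use dj in auto)
  have c4: "cut V m T = ew m T (P \<union> (Q \<union> S))"
    by (rule cut_part[OF _ V1(4)]) (use dj in auto)
  have "cut V m X + cut V m Y = cut V m P + cut V m T + 2 * ew m Q S"
  proof -
    have sw: "ew m T P = ew m P T" "ew m T Q = ew m Q T" "ew m T S = ew m S T" "ew m S Q = ew m Q S"
      by (rule ew_commute[OF assms(1)])+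
    show ?thesis
      unfolding c1 c2 c3 c4 using f dj sw by (simp add: ew_Un_left ew_Un_right Int_Un_distrib)
  qed
  then show ?thesis unfolding d .
qed

lemma sum_eq_2E:
  fixes f :: "'a \<Rightarrow> nat"
  assumes "finite A" "sum f A = 2"
  obtains a where "a \<in> A" "f a = 2" "\<And>x. x \<in> A \<Longrightarrow> x \<noteq> a \<Longrightarrow> f x = 0"
  | a b where "a \<in> A" "b \<in> A" "a \<noteq> b" "f a = 1" "f b = 1" "\<And>x. x \<in> A \<Longrightarrow> x \<noteq> a \<Longrightarrow> x \<noteq> b \<Longrightarrow> f x = 0"
proof -
  have "\<exists>a\<in>A. f a \<noteq> 0"
  proof (rule ccontr)
    assume "\<not> ?thesis"
    then have "sum f A = 0" by simp
    then show False using assms(2) by simp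
  qed
  then obtain a where a: "a \<in> A" "f a \<noteq> 0" by blast
  have s: "f a + sum f (A - {a}) = 2" using sum.remove[OF assms(1) a(1), of f] assms(2) by simp
  show thesis
  proof (cases "f a = 1")
    case True
    then have s1: "sum f (A - {a}) = 1" using s by simp
    have "\<exists>b\<in>A - {a}. f b \<noteq> 0"
    proof (rule ccontr)
      assume "\<not> ?thesis"
      then have "sum f (A - {a}) = 0" by (intro sum.neutral) blast
      then show False using s1 by simp
    qed
    then obtain b where b: "b \<in> A - {a}" "f b \<noteq> 0" by blast
    have "f b + sum f (A - {a} - {b}) = 1" using sum.remove[OF _ b(1), of f] assms(1) s1 by simp
    then have fb: "f b = 1" "sum f (A - {a} - {b}) = 0" using b(2) by linarith+
    have "f x = 0" if "x \<in> A" "x \<noteq> a" "x \<noteq> b" for x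
      using fb(2) that assms(1) by simp
    then show thesis using that(2) a(1) b(1) True fb(1) by (metis DiffE insertI1)
  next
    case False
    then have fa: "f a = 2" "sum f (A - {a}) = 0" using s a(2) by linarith+
    have "f x = 0" if "x \<in> A" "x \<noteq> a" for x
      using fa(2) that assms(1) by simp
    then show thesis using that(1) a(1) fa(1) by blast
  qed
qed

text \<open>\<open>conn\<close> collects the connectivity hypotheses and the negation of cubic; \<open>chain3\<close> is a chain of
  sausages of order 3 (the two further edges at \<open>p\<close>, and those at \<open>r\<close>, go to the contracted rest); \<open>star5\<close>
  lists two exceptional graphs on five vertices that have to be allowed for in the induction.\<close>

definition conn :: "'a set \<Rightarrow> ('a \<Rightarrow> 'a \<Rightarrow> nat) \<Rightarrow> bool" where
  "conn V m \<longleftrightarrow> mg V m \<and>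
     (\<forall>A\<subseteq>V. A \<noteq> {} \<and> A \<noteq> V \<longrightarrow> 4 \<le> cut V m A \<or> cut V m A = 3 \<and> (card A = 1 \<or> card (V - A) = 1)) \<and>
     (\<exists>v\<in>V. 4 \<le> deg V m v)"

definition chain3 :: "'a set \<Rightarrow> ('a \<Rightarrow> 'a \<Rightarrow> nat) \<Rightarrow> bool" where
  "chain3 V m \<longleftrightarrow> (\<exists>p q r. {p, q, r} \<subseteq> V \<and> p \<noteq> r \<and> m p q = 2 \<and> m q r = 2 \<and> m p r = 0 \<and>
     deg V m p = 4 \<and> deg V m q = 4 \<and> deg V m r = 4)"

definition star5 :: "'a set \<Rightarrow> ('a \<Rightarrow> 'a \<Rightarrow> nat) \<Rightarrow> bool" where
  "star5 V m \<longleftrightarrow> (\<exists>v b x y z. distinct [v, b, x, y, z] \<and> V = {v, b, x, y, z} \<and>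
     m v x = 2 \<and> m v y = 2 \<and> m v z = 2 \<and> (m b x = 1 \<or> m b x = 2) \<and> m b y = 1 \<and> m b z = 1 \<and>
     m v b = 0 \<and> m x y = 0 \<and> m x z = 0 \<and> m y z = 0)"

section \<open>Adding, deleting and splitting off edges\<close>

lemma ew_add1:
  assumes "finite A" "finite B" "p \<noteq> q"
  shows "ew (add1 m p q) A B = ew m A B + (if p \<in> A \<and> q \<in> B then 1 else 0) + (if q \<in> A \<and> p \<in> B then 1 else 0)"
proof -
  have one: "(\<Sum>a\<in>A. \<Sum>b\<in>B. if a = c \<and> b = d then 1 else 0) = (if c \<in> A \<and> d \<in> B then 1 else (0::nat))" for c d
  proof -
    have "(\<Sum>b\<in>B. if a = c \<and> b = d then 1 else 0) = (if a = c then (if d \<in> B then 1 else 0) else (0::nat))" for a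
      using assms(2) by (cases "a = c") simp_all
    then show ?thesis using assms(1) by simp
  qed
  have "add1 m p q a b = m a b + (if a = p \<and> b = q then 1 else 0) + (if a = q \<and> b = p then 1 else 0)" for a b
    using assms(3) unfolding add1_def doubleton_eq_iff by auto
  then show ?thesis unfolding ew_def by (simp add: sum.distrib one)
qed

lemma mg_add1: "mg V m \<Longrightarrow> p \<in> V \<Longrightarrow> q \<in> V \<Longrightarrow> p \<noteq> q \<Longrightarrow> mg V (add1 m p q)"
  unfolding mg_def add1_def doubleton_eq_iff by auto

lemma cut_add1:
  assumes "mg V m" "A \<subseteq> V" "p \<in> V" "q \<in> V" "p \<noteq> q"
  shows "cut V (add1 m p q) A = cut V m A + (if (p \<in> A) = (q \<in> A) then 0 else 1)"
proof -
  have "finite A" "finite (V - A)" using assms(1,2) mgD(1) finite_subset by blast+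
  then show ?thesis unfolding cut_def using assms(3-5) by (simp add: ew_add1)
qed

text \<open>Lets facts about deleting an edge be read off from those about adding it to the smaller
  graph.\<close>

lemma add1_sub1: "mg V m \<Longrightarrow> 1 \<le> m p q \<Longrightarrow> add1 (sub1 m p q) p q = m"
proof -
  assume a: "mg V m" "1 \<le> m p q"
  have "1 \<le> m q p" using a mgD(2) by metis
  then show ?thesis using a unfolding add1_def sub1_def doubleton_eq_iff by (intro ext) auto
qed

lemma sub1_le: "sub1 m p q x y \<le> m x y"
  by (simp add: sub1_def)

lemma mg_sub1:
  assumes "mg V m"
  shows "mg V (sub1 m p q)"
  unfolding mg_def
proof (intro conjI allI impI)
  show "sub1 m p q x y = sub1 m p q y x" for x y
    using mgD(2)[OF assms, of x y] by (simp add: sub1_def insert_commute)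
  show "x \<in> V" if "sub1 m p q x y \<noteq> 0" for x y
    using that sub1_le[of m p q x y] mgD(4)[OF assms, of x y] by auto
qed (use mgD(1,3)[OF assms] in \<open>auto simp: sub1_def\<close>)

lemma cut_sub1:
  assumes "mg V m" "A \<subseteq> V" "1 \<le> m p q"
  shows "cut V m A = cut V (sub1 m p q) A + (if (p \<in> A) = (q \<in> A) then 0 else 1)"
proof -
  have "p \<in> V" "q \<in> V" "p \<noteq> q" using assms mgD(3-5)[OF assms(1)] by (metis not_one_le_zero)+
  then show ?thesis
    using cut_add1[OF mg_sub1[OF assms(1)] assms(2), of p q p q] add1_sub1[of V m p q] assms by simp
qed

lemma mg_edge: "mg V m \<Longrightarrow> 1 \<le> m p q \<Longrightarrow> p \<in> V \<and> q \<in> V \<and> p \<noteq> q"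
  using mgD(3-5)[of V m] by (metis not_one_le_zero)

lemma total_add1: "mg V m \<Longrightarrow> p \<in> V \<Longrightarrow> q \<in> V \<Longrightarrow> p \<noteq> q \<Longrightarrow> ew (add1 m p q) V V = ew m V V + 2"
  by (simp add: ew_add1 mgD(1))

lemma total_sub1: "mg V m \<Longrightarrow> 1 \<le> m p q \<Longrightarrow> ew m V V = ew (sub1 m p q) V V + 2"
  using total_add1[OF mg_sub1, of V m p q p q] mg_edge[of V m p q] add1_sub1[of V m p q] by simp

text \<open>A cut loses two edges exactly if it separates \<open>y\<close> from both
  \<open>x\<close> and \<open>z\<close>, and is unchanged otherwise; the subtractions are never
  truncated, since both edges are present.\<close>

lemma mg_split:
  assumes "mg V m" "distinct [x, y, z]" "1 \<le> m x y" "1 \<le> m y z"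
  shows "mg V (split m x y z)" "A \<subseteq> V \<Longrightarrow> cut V (split m x y z) A =
      cut V m A + (if (x \<in> A) = (z \<in> A) then 0 else 1) - (if (x \<in> A) = (y \<in> A) then 0 else 1) - (if (y \<in> A) = (z \<in> A) then 0 else 1)"
    "ew (split m x y z) V V + 2 = ew m V V"
proof -
  let ?m = "sub1 m x y"
  have e: "x \<in> V" "y \<in> V" "z \<in> V" "x \<noteq> z" using assms mg_edge[OF assms(1)] by auto
  have yz: "1 \<le> ?m y z" using assms(2,4) unfolding sub1_def by (auto simp: doubleton_eq_iff)
  note m1 = mg_sub1[OF assms(1), of x y] and m2 = mg_sub1[OF mg_sub1[OF assms(1)], of x y y z]
  show "mg V (split m x y z)" unfolding split_def by (rule mg_add1[OF m2 e(1,3,4)])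
  show "ew (split m x y z) V V + 2 = ew m V V"
    unfolding split_def using total_add1[OF m2 e(1,3,4)] total_sub1[OF m1 yz] total_sub1[OF assms(1,3)] by simp
  show "cut V (split m x y z) A =
      cut V m A + (if (x \<in> A) = (z \<in> A) then 0 else 1) - (if (x \<in> A) = (y \<in> A) then 0 else 1) - (if (y \<in> A) = (z \<in> A) then 0 else 1)"
    if A: "A \<subseteq> V"
    unfolding split_def cut_add1[OF m2 A e(1,3,4)] cut_sub1[OF assms(1) A assms(3)] cut_sub1[OF m1 A yz]
    by simp
qed

lemma mg_off: "mg V m \<Longrightarrow> mg (V - {w}) (off m w)"
  unfolding mg_def off_def by auto

lemma ew_off: "w \<notin> A \<Longrightarrow> w \<notin> B \<Longrightarrow> ew (off m w) A B = ew m A B"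
  by (rule ew_cong) (auto simp: off_def)

lemma cut_off:
  assumes "mg V m" "A \<subseteq> V - {w}"
  shows "cut (V - {w}) (off m w) A = ew m A (V - A - {w})"
proof -
  have e: "V - {w} - A = V - A - {w}" by blast
  show ?thesis unfolding cut_def e by (rule ew_off) (use assms(2) in auto)
qed

text \<open>A cut of the graph without \<open>w\<close> extends to two cuts of \<open>V\<close>,
  according to the side of \<open>w\<close>. Both consist of the smaller cut and the edges from
  \<open>w\<close> to the opposite side; this is how cuts before and after the removal of a vertex
  are compared.\<close>

lemma cut_remove:
  assumes "mg V m" "A \<subseteq> V" "w \<in> V" "w \<notin> A"
  shows "cut V m A = ew m A (V - A - {w}) + ew m {w} A"
    "cut V m (insert w A) = ew m A (V - A - {w}) + ew m {w} (V - A)"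
proof -
  have f: "finite A" "finite (V - A - {w})" using assms mgD(1) finite_subset by blast+
  have e: "V - A = insert w (V - A - {w})" using assms by blast
  have "ew m A (insert w (V - A - {w})) = ew m A {w} + ew m A (V - A - {w})"
    by (rule ew_insert_right[OF f(2)]) blast
  then show c: "cut V m A = ew m A (V - A - {w}) + ew m {w} A"
    unfolding cut_def using e ew_commute[OF assms(1), of A "{w}"] by simp
  show "cut V m (insert w A) = ew m A (V - A - {w}) + ew m {w} (V - A)"
    using cut_insert[OF assms] c deg_split[OF assms(1,2), of w] by linarith
qed

section \<open>Immersed contractions\<close>

text \<open>\<open>Z\<close> is contracted onto a member \<open>v\<close> and not onto a new vertex,
  so that the result has the same vertex type and an induction hypothesis applies to it. The other
  members of \<open>Z\<close> keep no edges; the vertex set of the contraction is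
  \<open>V - (Z - {v})\<close>.\<close>

definition con :: "('a \<Rightarrow> 'a \<Rightarrow> nat) \<Rightarrow> 'a set \<Rightarrow> 'a \<Rightarrow> 'a \<Rightarrow> 'a \<Rightarrow> nat" where
  "con m Z v = (\<lambda>x y. if x \<in> Z - {v} \<or> y \<in> Z - {v} \<or> x = y then 0
     else if x = v then ew m Z {y} else if y = v then ew m {x} Z else m x y)"

lemma ew_con:
  assumes "v \<in> Z" "A \<inter> Z = {}" "B \<inter> Z = {}" "A \<inter> B = {}"
  shows "ew (con m Z v) A B = ew m A B" "ew (con m Z v) {v} A = ew m Z A" "ew (con m Z v) A {v} = ew m A Z"
proof -
  show "ew (con m Z v) A B = ew m A B"
    by (rule ew_cong) (use assms in \<open>auto simp: con_def\<close>)
  have "ew (con m Z v) {v} A = (\<Sum>a\<in>A. ew m Z {a})"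
    unfolding ew_def by (simp, rule sum.cong) (use assms in \<open>auto simp: con_def ew_def\<close>)
  also have "\<dots> = ew m Z A" unfolding ew_def by (subst sum.swap) simp
  finally show "ew (con m Z v) {v} A = ew m Z A" .
  show "ew (con m Z v) A {v} = ew m A Z"
    unfolding ew_def by (rule sum.cong) (use assms in \<open>auto simp: con_def ew_def\<close>)
qed

lemma mg_con:
  assumes "mg V m" "Z \<subseteq> V" "v \<in> Z"
  shows "mg (V - (Z - {v})) (con m Z v)"
  unfolding mg_def
proof (intro conjI allI impI)
  show "finite (V - (Z - {v}))" using mgD(1)[OF assms(1)] by simp
  show "con m Z v x y = con m Z v y x" for x y
    using mgD(2)[OF assms(1), of x y] ew_commute[OF assms(1), of Z "{x}"] ew_commute[OF assms(1), of Z "{y}"]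
    unfolding con_def by auto
  show "con m Z v x x = 0" for x by (simp add: con_def)
  show "x \<in> V - (Z - {v})" if "con m Z v x y \<noteq> 0" for x y
  proof (rule ccontr)
    assume x: "x \<notin> V - (Z - {v})"
    then have "con m Z v x y = 0"
    proof (cases "x \<in> Z - {v}")
      case False
      then have "x \<notin> V" "x \<noteq> v" using x assms(2,3) by auto
      then show ?thesis using mgD(4)[OF assms(1) \<open>x \<notin> V\<close>] by (simp add: con_def ew_def)
    qed (simp add: con_def)
    then show False using that by simp
  qed
qed

text \<open>The cuts of the contraction are the cuts of \<open>m\<close> that do not divide
  \<open>Z\<close>, so lower bounds on cuts pass to contractions.\<close>

lemma cut_con:
  assumes "mg V m" "Z \<subseteq> V" "v \<in> Z" "A \<subseteq> V - (Z - {v})"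
  shows "v \<notin> A \<Longrightarrow> cut (V - (Z - {v})) (con m Z v) A = cut V m A"
    "v \<in> A \<Longrightarrow> cut (V - (Z - {v})) (con m Z v) A = cut V m (A \<union> Z)"
proof -
  let ?V = "V - (Z - {v})"
  have out: "cut ?V (con m Z v) A = cut V m A" if A: "A \<subseteq> ?V" "v \<notin> A" for A
  proof -
    define B where "B = V - A - Z"
    have AZ: "A \<inter> Z = {}" "B \<inter> Z = {}" "A \<inter> B = {}" using A unfolding B_def by auto
    have e: "?V - A = insert v B" "V - A = Z \<union> B" using A assms unfolding B_def by auto
    have f: "finite B" "finite Z" using mgD(1)[OF assms(1)] assms(2) finite_subset unfolding B_def by auto
    have "v \<notin> B" using assms unfolding B_def by auto
    then show ?thesis
      unfolding cut_def e using f AZ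
      by (simp add: ew_insert_right[OF f(1)] ew_con[OF assms(3) AZ] ew_Un_right[OF f(2,1)] Int_commute)
  qed
  show "v \<notin> A \<Longrightarrow> cut ?V (con m Z v) A = cut V m A" using out assms(4) by blast
  assume v: "v \<in> A"
  have "cut ?V (con m Z v) A = cut ?V (con m Z v) (?V - A)"
    using cut_compl[OF mg_con[OF assms(1-3)] assms(4)] by simp
  also have "\<dots> = cut V m (?V - A)" by (rule out) (use v in auto)
  also have "?V - A = V - (A \<union> Z)" using v by blast
  also have "cut V m (V - (A \<union> Z)) = cut V m (A \<union> Z)"
    by (rule cut_compl[OF assms(1)]) (use assms in auto)
  finally show "cut ?V (con m Z v) A = cut V m (A \<union> Z)" .
qed

text \<open>Serves contractions in two stages. At a vertex outside \<open>Z\<close>, the edges to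
  \<open>Z\<close> are those to \<open>Z'\<close> and those to \<open>Z - Z'\<close>.\<close>

lemma con_con:
  assumes "mg V m" "Z' \<subseteq> Z" "Z \<subseteq> V" "v \<in> Z'"
  shows "con (con m Z' v) (insert v (Z - Z')) v = con m Z v"
proof (intro ext)
  fix x y
  have f: "finite Z'" "finite (Z - Z')" using assms mgD(1) finite_subset by (metis finite_Diff)+
  have Z: "Z = Z' \<union> (Z - Z')" "Z' \<inter> (Z - Z') = {}" using assms by auto
  have l: "ew (con m Z' v) (insert v (Z - Z')) {y} = ew m Z {y}" if "y \<notin> Z" for y
  proof -
    have "ew (con m Z' v) (insert v (Z - Z')) {y} = ew m Z' {y} + ew m (Z - Z') {y}"
    proof -
      have y: "{y} \<inter> Z' = {}" "(Z - Z') \<inter> Z' = {}" "(Z - Z') \<inter> {y} = {}" "v \<notin> Z - Z'"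
        using assms that by auto
      have "con m Z' v v y = ew m Z' {y}" using that assms unfolding con_def by auto
      then show ?thesis
        unfolding ew_insert_left[OF f(2) y(4)] ew_con(1)[OF assms(4) y(2,1,3)] by simp
    qed
    then show ?thesis using ew_Un_left[OF f Z(2), of m "{y}"] Z(1) by simp
  qed
  have r: "ew (con m Z' v) {y} (insert v (Z - Z')) = ew m {y} Z" if "y \<notin> Z" for y
    using l[OF that] ew_commute[OF mg_con[OF assms(1) _ assms(4)]] ew_commute[OF assms(1)] assms
    by (metis subset_trans)
  let ?n = "con m Z' v" and ?W = "insert v (Z - Z')"
  have z: "?n a b = 0" "?n b a = 0" if "a \<in> Z' - {v}" for a b using that unfolding con_def by auto
  show "con ?n ?W v x y = con m Z v x y"
  proof (cases "x \<in> Z - {v} \<or> y \<in> Z - {v} \<or> x = y")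
    case True
    then consider "x \<in> ?W - {v} \<or> y \<in> ?W - {v} \<or> x = y" | "x \<in> Z' - {v}" | "y \<in> Z' - {v}" by blast
    then have "con ?n ?W v x y = 0"
    proof cases
      case 1
      then show ?thesis unfolding con_def[of ?n] by (rule if_P)
    next
      case 2
      then have "ew ?n {x} ?W = 0" "x \<noteq> v" by (simp_all add: ew_def z(1))
      then show ?thesis using z(1)[OF 2] unfolding con_def[of ?n] by simp
    next
      case 3
      then have "ew ?n ?W {y} = 0" "y \<noteq> v" by (simp_all add: ew_def z(2))
      then show ?thesis using z(2)[OF 3] unfolding con_def[of ?n] by simp
    qed
    moreover have "con m Z v x y = 0" unfolding con_def by (rule if_P) (rule True)
    ultimately show ?thesis by simp
  next
    case False
    then have W: "\<not> (x \<in> ?W - {v} \<or> y \<in> ?W - {v} \<or> x = y)" by auto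
    note u = con_def[of ?n ?W v, THEN fun_cong, THEN fun_cong, of x y, unfolded if_not_P[OF W]]
    note u' = con_def[of m Z v, THEN fun_cong, THEN fun_cong, of x y, unfolded if_not_P[OF False]]
    consider "x = v" "y \<notin> Z" | "x \<noteq> v" "y = v" "x \<notin> Z" | "x \<noteq> v" "y \<noteq> v" "x \<notin> Z" "y \<notin> Z"
      using False by blast
    then show ?thesis
    proof cases
      case 1
      then show ?thesis using l[OF 1(2)] unfolding u u' by (simp only: refl if_True)
    next
      case 2
      then show ?thesis using r[OF 2(3)] unfolding u u' by (simp only: refl if_True if_False)
    next
      case 3
      have "?n x y = m x y" using 3 False assms(2) unfolding con_def by auto
      then show ?thesis using 3(1,2) unfolding u u' by (simp only: if_False)
    qed
  qed
qed

lemma total_deg: "ew m V V = (\<Sum>x\<in>V. deg V m x)"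
  by (simp add: ew_def deg_def)

lemma cut_le_deg_sum:
  assumes "mg V m" "Z \<subseteq> V"
  shows "cut V m Z \<le> (\<Sum>x\<in>Z. deg V m x)"
  unfolding cut_def ew_def deg_def using mgD(1)[OF assms(1)] by (intro sum_mono sum_mono2) auto

lemma deg_con:
  assumes "mg V m" "Z \<subseteq> V" "v \<in> Z" "x \<in> V - (Z - {v})"
  shows "deg (V - (Z - {v})) (con m Z v) x = (if x = v then cut V m Z else deg V m x)"
proof (cases "x = v")
  case True
  have "{v} \<union> Z = Z" using assms(3) by blast
  then show ?thesis
    using deg_cut[OF mg_con[OF assms(1-3)] assms(4)] cut_con(2)[OF assms(1-3), of "{x}"] assms(4) True by simp
next
  case False
  then show ?thesis
    using deg_cut[OF mg_con[OF assms(1-3)] assms(4)] cut_con(1)[OF assms(1-3), of "{x}"] assms(4)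
      deg_cut[OF assms(1), of x] by simp
qed

text \<open>The new vertex has degree \<open>cut V m Z\<close>, at most the sum of the degrees of
  the vertices it replaces, and all other degrees stay.\<close>

lemma total_con:
  assumes "mg V m" "Z \<subseteq> V" "v \<in> Z"
  shows "ew (con m Z v) (V - (Z - {v})) (V - (Z - {v})) \<le> ew m V V"
proof -
  have f: "finite V" "finite Z" using assms mgD(1) finite_subset by metis+
  have e: "V - (Z - {v}) = insert v (V - Z)" "V = Z \<union> (V - Z)" using assms by auto
  have "ew (con m Z v) (V - (Z - {v})) (V - (Z - {v})) = (\<Sum>x\<in>insert v (V - Z). if x = v then cut V m Z else deg V m x)"
    unfolding total_deg using deg_con[OF assms] by (auto simp: e(1)[symmetric] intro: sum.cong)
  also have "\<dots> = cut V m Z + (\<Sum>x\<in>V - Z. if x = v then cut V m Z else deg V m x)"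
    using f assms by (subst sum.insert) auto
  also have "(\<Sum>x\<in>V - Z. if x = v then cut V m Z else deg V m x) = (\<Sum>x\<in>V - Z. deg V m x)"
    by (rule sum.cong) (use assms in auto)
  also have "cut V m Z + \<dots> \<le> (\<Sum>x\<in>Z. deg V m x) + (\<Sum>x\<in>V - Z. deg V m x)"
    using cut_le_deg_sum[OF assms(1,2)] by simp
  also have "\<dots> = ew m V V"
    unfolding total_deg using sum.subset_diff[OF assms(2) f(1), of "deg V m"] by simp
  finally show ?thesis .
qed

lemma total_split_le: "mg V m \<Longrightarrow> distinct [x, y, z] \<Longrightarrow> 1 \<le> m x y \<Longrightarrow> 1 \<le> m y z \<Longrightarrow>
    ew (split m x y z) V V < ew m V V"
  using mg_split(3)[of V m x y z] by linarith

lemma con_cong: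
  assumes "\<And>y. y \<notin> Z \<Longrightarrow> ew m Z {y} = ew m' Z {y}" "\<And>y. y \<notin> Z \<Longrightarrow> ew m {y} Z = ew m' {y} Z"
    "\<And>x y. x \<notin> Z \<Longrightarrow> y \<notin> Z \<Longrightarrow> m x y = m' x y" "v \<in> Z"
  shows "con m Z v = con m' Z v"
  unfolding con_def by (intro ext) (use assms in auto)

text \<open>Menger's theorem in disguise: under the boundary condition all the edges leaving \<open>Z\<close> can be
  routed to \<open>v\<close> inside \<open>Z\<close>.\<close>

theorem wheeled_con:
  assumes "mg V m" "Z \<subseteq> V" "v \<in> Z" "\<And>Y. v \<in> Y \<Longrightarrow> Y \<subseteq> Z \<Longrightarrow> cut V m Z \<le> cut V m Y" "wheeled (con m Z v)"
  shows "wheeled m"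
  using assms
proof (induction "card Z + ew m V V" arbitrary: V m Z rule: less_induct)
  case less
  note mg = less.prems(1) and ZV = less.prems(2) and vZ = less.prems(3) and min = less.prems(4)
  have fin: "finite Z" using mgD(1)[OF mg] ZV finite_subset by blast
  show ?case
  proof (cases "\<exists>Y. v \<in> Y \<and> Y \<subset> Z \<and> Y \<noteq> {v} \<and> cut V m Y = cut V m Z")
    case True
    \<comment> \<open>A tight set \<open>Y\<close> strictly between \<open>{v}\<close> and
      \<open>Z\<close> divides the task: contracting \<open>Z\<close> amounts to contracting
      \<open>Y\<close> and then the rest, and the boundary condition holds at both stages.\<close>
    then obtain Y where Y: "v \<in> Y" "Y \<subset> Z" "Y \<noteq> {v}" "cut V m Y = cut V m Z" by blast
    define V1 m1 Z1 where "V1 = V - (Y - {v})" and "m1 = con m Y v" and "Z1 = insert v (Z - Y)"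
    have YV: "Y \<subseteq> V" using Y ZV by blast
    have mg1: "mg V1 m1" unfolding V1_def m1_def by (rule mg_con[OF mg YV Y(1)])
    have Z1: "Z1 \<subseteq> V1" "v \<in> Z1" "Z1 \<union> Y = Z" using ZV Y unfolding Z1_def V1_def by auto
    have cY: "cut V1 m1 A = cut V m (A \<union> Y)" if "v \<in> A" "A \<subseteq> V1" for A
      using cut_con(2)[OF mg YV Y(1), of A] that unfolding V1_def m1_def by simp
    have "card Z1 < card Z"
    proof (rule psubset_card_mono[OF fin])
      show "Z1 \<subset> Z" unfolding Z1_def using Y by auto
    qed
    moreover have "ew m1 V1 V1 \<le> ew m V V" unfolding m1_def V1_def by (rule total_con[OF mg YV Y(1)])
    ultimately have "card Z1 + ew m1 V1 V1 < card Z + ew m V V" by linarith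
    then have "wheeled m1"
    proof (rule less.hyps[OF _ mg1 Z1(1,2)])
      show "wheeled (con m1 Z1 v)" unfolding m1_def Z1_def
        using con_con[OF mg _ ZV Y(1)] Y(2) less.prems(5) by auto
      fix A assume A: "v \<in> A" "A \<subseteq> Z1"
      have "cut V m Z \<le> cut V m (A \<union> Y)" by (rule min) (use A Z1 Y in auto)
      then show "cut V1 m1 Z1 \<le> cut V1 m1 A" using cY[OF A(1)] cY[OF Z1(2,1)] A(2) Z1 by simp
    qed
    moreover have "card Y + ew m V V < card Z + ew m V V" using psubset_card_mono[OF fin Y(2)] by simp
    ultimately show ?thesis
      using less.hyps[of Y m V, OF _ mg YV Y(1)] min Y unfolding m1_def by auto
  next
    case tight: False
    have strict: "cut V m Z < cut V m Y" if "v \<in> Y" "Y \<subset> Z" "Y \<noteq> {v}" for Y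
      using min[of Y] tight that by (metis le_neq_implies_less psubsetE)
    show ?thesis
    proof (cases "\<exists>x\<in>Z - {v}. \<exists>y\<in>Z - {v}. 1 \<le> m x y")
      case True
      \<comment> \<open>No tight set separates \<open>x\<close> from \<open>y\<close>:
        \<open>{v}\<close> and \<open>Z\<close> do not, and all other sets have a larger boundary
        than \<open>Z\<close>. So deleting the edge keeps the boundary condition, and the
        contraction does not see it.\<close>
      then obtain x y where xy: "x \<in> Z" "y \<in> Z" "x \<noteq> v" "y \<noteq> v" "1 \<le> m x y" by blast
      define m1 where "m1 = sub1 m x y"
      have mg1: "mg V m1" unfolding m1_def by (rule mg_sub1[OF mg])
      have c: "cut V m A = cut V m1 A + (if (x \<in> A) = (y \<in> A) then 0 else 1)" if "A \<subseteq> V" for A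
        unfolding m1_def by (rule cut_sub1[OF mg that xy(5)])
      have "card Z + ew m1 V V < card Z + ew m V V"
        using total_sub1[OF mg xy(5)] unfolding m1_def by linarith
      then have "wheeled m1"
      proof (rule less.hyps[OF _ mg1 ZV vZ])
        fix A assume A: "v \<in> A" "A \<subseteq> Z"
        have AV: "A \<subseteq> V" using A ZV by blast
        have cZ: "cut V m Z = cut V m1 Z" using c[OF ZV] xy by simp
        show "cut V m1 Z \<le> cut V m1 A"
        proof (cases "(x \<in> A) = (y \<in> A)")
          case True
          then show ?thesis using c[OF AV] cZ min[OF A] by simp
        next
          case False
          then have "A \<subset> Z" "A \<noteq> {v}" using A xy by auto
          then show ?thesis using strict[OF A(1)] c[OF AV] cZ False by simp
        qed
      next
        have o: "m1 a b = m a b" if "a \<notin> Z \<or> b \<notin> Z" for a b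
          using that xy unfolding m1_def sub1_def doubleton_eq_iff by auto
        have "con m1 Z v = con m Z v"
          by (rule con_cong[OF ew_cong ew_cong]) (use o vZ in auto)
        then show "wheeled (con m1 Z v)" using less.prems(5) by simp
      qed
      then show ?thesis by (rule wheeled_mono) (simp add: m1_def sub1_le)
    next
      case False
      then have no: "m x y = 0" if "x \<in> Z - {v}" "y \<in> Z - {v}" for x y
        using that by (metis less_one not_le)
      show ?thesis
      proof (cases "\<exists>w\<in>Z - {v}. \<exists>u\<in>V - Z. 1 \<le> m w u")
        case True
        \<comment> \<open>All edges of \<open>w\<close> now lead to \<open>v\<close> or out of
          \<open>Z\<close>. Since \<open>Z - {w}\<close> has no smaller boundary than
          \<open>Z\<close>, at least as many lead to \<open>v\<close> as lead out, so the path
          \<open>v w u\<close> can be split off. This moves an edge leaving \<open>Z\<close> from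
          \<open>w\<close> to \<open>v\<close> and changes no boundary of a set between
          \<open>{v}\<close> and \<open>Z\<close>.\<close>
        then obtain w u where w: "w \<in> Z" "w \<noteq> v" "u \<in> V" "u \<notin> Z" "1 \<le> m w u" by blast
        have "Z - {w} \<subseteq> V" "w \<in> V" "insert w (Z - {w}) = Z" using ZV w by auto
        then have "cut V m Z + 2 * ew m {w} (Z - {w}) = cut V m (Z - {w}) + deg V m w"
          using cut_insert[OF mg, of "Z - {w}" w] by simp
        moreover have "deg V m w = ew m {w} Z + ew m {w} (V - Z)" by (rule deg_split[OF mg ZV])
        moreover have "ew m {w} Z = ew m {w} (Z - {w})"
          using fin w mgD(3)[OF mg] by (simp add: ew_def sum.remove[of Z w])
        moreover have "ew m {w} (Z - {w}) = m w v"
        proof -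
          have e: "Z - {w} = insert v (Z - {v, w})" using vZ w by auto
          have "ew m {w} (Z - {v, w}) = 0" using no w by (simp add: ew_def)
          moreover have "ew m {w} (insert v (Z - {v, w})) = ew m {w} {v} + ew m {w} (Z - {v, w})"
            by (rule ew_insert_right) (use fin in auto)
          ultimately show ?thesis unfolding e by simp
        qed
        moreover have "cut V m Z \<le> cut V m (Z - {w})" by (rule min) (use vZ w in auto)
        moreover have "1 \<le> ew m {w} (V - Z)"
          using ew_ge[of "{w}" "V - Z" w u m] w mgD(1)[OF mg] by simp
        ultimately have vw: "1 \<le> m v w" using mgD(2)[OF mg, of v w] by linarith
        have d: "distinct [v, w, u]" using w vZ by auto
        define m1 where "m1 = split m v w u"
        have mg1: "mg V m1" unfolding m1_def by (rule mg_split(1)[OF mg d vw w(5)])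
        have c: "cut V m1 A = cut V m A" if "v \<in> A" "A \<subseteq> Z" for A
        proof -
          have "A \<subseteq> V" "u \<notin> A" using that ZV w by auto
          then show ?thesis unfolding m1_def using mg_split(2)[OF mg d vw w(5), of A] that(1) by auto
        qed
        have "card Z + ew m1 V V < card Z + ew m V V"
          using total_split_le[OF mg d vw w(5)] unfolding m1_def by linarith
        then have "wheeled m1"
        proof (rule less.hyps[OF _ mg1 ZV vZ])
          show "cut V m1 Z \<le> cut V m1 A" if "v \<in> A" "A \<subseteq> Z" for A
            using c[OF that] c[OF vZ] min[OF that] by simp
          have l: "ew m1 Z {y} = ew m Z {y}" if y: "y \<notin> Z" for y
          proof (cases "y = u")
            case True
            have Z: "Z = insert v (insert w (Z - {v, w}))" using vZ w by auto
            have f: "finite (Z - {v, w})" using fin by simp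
            have r: "ew m1 (Z - {v, w}) {u} = ew m (Z - {v, w}) {u}"
              by (rule ew_cong) (use w d in \<open>auto simp: m1_def split_def add1_def sub1_def doubleton_eq_iff\<close>)
            have "m1 v u = m v u + 1" "m1 w u = m w u - 1"
              using d by (auto simp: m1_def split_def add1_def sub1_def doubleton_eq_iff)
            moreover have "ew n Z {u} = n v u + n w u + ew n (Z - {v, w}) {u}" for n :: "'a \<Rightarrow> 'a \<Rightarrow> nat"
              by (subst Z) (use f w in \<open>simp add: ew_def\<close>)
            ultimately show ?thesis using r w(5) unfolding True by simp
          next
            case False
            show ?thesis by (rule ew_cong)
              (use False y w vZ in \<open>auto simp: m1_def split_def add1_def sub1_def doubleton_eq_iff\<close>)
          qed
          have "con m1 Z v = con m Z v"
          proof (rule con_cong)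
            show "ew m1 {y} Z = ew m {y} Z" if "y \<notin> Z" for y
              using l[OF that] ew_commute[OF mg1] ew_commute[OF mg] by metis
            show "m1 x y = m x y" if "x \<notin> Z" "y \<notin> Z" for x y
              using that w vZ by (auto simp: m1_def split_def add1_def sub1_def doubleton_eq_iff)
          qed (use l vZ in auto)
          then show "wheeled (con m1 Z v)" using less.prems(5) by simp
        qed
        then show ?thesis unfolding m1_def by (rule wheeled.split[OF d vw w(5)])
      next
        case out: False
        \<comment> \<open>Every edge leaving \<open>Z\<close> starts at \<open>v\<close>, so the
          contraction lies below \<open>m\<close>.\<close>
        have z: "m w u = 0" if "w \<in> Z - {v}" "u \<notin> Z" for w u
          using out that mgD(5)[OF mg, of u w] by (cases "u \<in> V") (auto simp: not_le)
        have "ew m Z {y} \<le> m v y" if "y \<notin> Z" for y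
        proof -
          have "ew m Z {y} = m v y + ew m (Z - {v}) {y}"
            using fin vZ by (simp add: ew_def sum.remove[of Z v])
          then show ?thesis using z that by (simp add: ew_def)
        qed
        then have "con m Z v x y \<le> m x y" for x y
          using ew_commute[OF mg, of "{x}" Z] mgD(2)[OF mg, of x v] unfolding con_def by auto
        then show ?thesis using less.prems(5) wheeled_mono by blast
      qed
    qed
  qed
qed

section \<open>Checked certificates on five and six vertices\<close>

text \<open>An edge list on the vertices \<open>0, ..., n - 1\<close> serves as a lower bound for the multiplicities.
  A certificate is a sequence of edge lists, each with a reason why the graphs above it that satisfy
  the cut conditions are wheeled or exceptional: explicit splittings leading to a wheel; or a cut
  (\<open>Cut\<close>) that is too small in the list itself, so that some pair across it has a further edge; or
  a list that is itself exceptional (\<open>Chain\<close>, \<open>Star\<close>), so that again some pair has a further edge. Every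
  list extended by a further edge contains a permuted copy of an earlier list of the sequence.\<close>

type_synonym elist = "(nat \<times> nat) list"

definition cnt :: "elist \<Rightarrow> nat \<Rightarrow> nat \<Rightarrow> nat" where
  "cnt es i j = length (filter (\<lambda>e. e = (i, j) \<or> e = (j, i)) es)"

definition norm :: "nat \<times> nat \<Rightarrow> nat \<times> nat" where
  "norm e = (case e of (a, b) \<Rightarrow> if a \<le> b then (a, b) else (b, a))"

definition emb :: "nat \<Rightarrow> (nat \<Rightarrow> 'a) \<Rightarrow> ('a \<Rightarrow> 'a \<Rightarrow> nat) \<Rightarrow> elist \<Rightarrow> bool" where
  "emb n f m es \<longleftrightarrow> inj_on f {..<n} \<and> (\<forall>i<n. \<forall>j<n. cnt es i j \<le> m (f i) (f j))"

primrec sublist :: "elist \<Rightarrow> elist \<Rightarrow> bool" where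
  "sublist [] ys = True"
| "sublist (x # xs) ys = (x \<in> set ys \<and> sublist xs (remove1 x ys))"

primrec splits :: "(nat \<times> nat \<times> nat) list \<Rightarrow> elist \<Rightarrow> elist option" where
  "splits [] es = Some es"
| "splits (t # ts) es = (case t of (x, y, z) \<Rightarrow>
     (if x \<noteq> z \<and> sublist [norm (x, y), norm (y, z)] es
      then splits ts (norm (x, z) # remove1 (norm (y, z)) (remove1 (norm (x, y)) es)) else None))"

definition wheel_edges :: "nat list \<Rightarrow> elist" where
  "wheel_edges w = map norm [(w!0, w!1), (w!0, w!2), (w!0, w!3), (w!0, w!4),
     (w!1, w!2), (w!2, w!3), (w!3, w!4), (w!4, w!1)]"

definition check_wheel :: "nat \<Rightarrow> (nat \<times> nat \<times> nat) list \<Rightarrow> nat list \<Rightarrow> elist \<Rightarrow> bool" where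
  "check_wheel n ts w es \<longleftrightarrow> distinct w \<and> length w = 5 \<and> list_all (\<lambda>i. i < n) w \<and>
     list_all (\<lambda>(x, y, z). x < n \<and> y < n \<and> z < n \<and> x \<noteq> y \<and> y \<noteq> z) ts \<and>
     (case splits ts es of None \<Rightarrow> False | Some es' \<Rightarrow> sublist (wheel_edges w) es')"

datatype rule =
    Wheel "(nat \<times> nat \<times> nat) list" "nat list"
  | Cut "nat list" "(nat \<times> nat list) list"
  | Chain nat nat nat "(nat \<times> nat list) list"
  | Star nat nat nat nat nat "(nat \<times> nat list) list"

text \<open>The pair \<open>(i, p)\<close> is the witness for the further edge \<open>e\<close>: the
  position \<open>i\<close> of an earlier list, and the permutation \<open>p\<close> of the vertices
  that takes this list into the extended one.\<close>

definition kid_ok :: "elist list \<Rightarrow> elist \<Rightarrow> nat \<times> nat list \<Rightarrow> nat \<times> nat \<Rightarrow> bool" where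
  "kid_ok prev es k e = (case k of (i, p) \<Rightarrow> i < length prev \<and> distinct p \<and> length p = 5 \<and>
     list_all (\<lambda>i. i < 5) p \<and> sublist (map (\<lambda>(a, b). norm (p ! a, p ! b)) (prev ! i)) (norm e # es))"

definition pairs5 :: "elist" where
  "pairs5 = [(0,1),(0,2),(0,3),(0,4),(1,2),(1,3),(1,4),(2,3),(2,4),(3,4)]"

text \<open>The bounds 3 and 4 are those of \<open>conn\<close>. The witnesses come in the order of
  the pairs that may receive a further edge: for \<open>Cut\<close> those across the cut; for
  \<open>Chain\<close> those meeting \<open>x\<close>, \<open>y\<close> or \<open>z\<close>, since
  other edges do not disturb the chain; for \<open>Star\<close> all of them, since
  \<open>star5\<close> fixes the whole graph.\<close>

primrec check_rule :: "elist list \<Rightarrow> elist \<Rightarrow> rule \<Rightarrow> bool" where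
  "check_rule prev es (Wheel ts w) = check_wheel 5 ts w es"
| "check_rule prev es (Cut X ks) = (let Y = filter (\<lambda>i. i \<notin> set X) [0,1,2,3,4] in
     distinct X \<and> X \<noteq> [] \<and> Y \<noteq> [] \<and> list_all (\<lambda>i. i < 5) X \<and>
     sum_list (map (\<lambda>(i, j). cnt es i j) (List.product X Y)) < (if length X = 1 \<or> length Y = 1 then 3 else 4) \<and>
     list_all2 (kid_ok prev es) ks (List.product X Y))"
| "check_rule prev es (Chain x y z ks) = (x < 5 \<and> y < 5 \<and> z < 5 \<and> x \<noteq> z \<and>
     cnt es x y = 2 \<and> cnt es y z = 2 \<and> cnt es x z = 0 \<and>
     list_all (\<lambda>i. sum_list (map (cnt es i) [0,1,2,3,4]) = 4) [x, y, z] \<and>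
     list_all2 (kid_ok prev es) ks
       (filter (\<lambda>(i, j). i = x \<or> i = y \<or> i = z \<or> j = x \<or> j = y \<or> j = z) pairs5))"
| "check_rule prev es (Star v b x y z ks) = (distinct [v, b, x, y, z] \<and> list_all (\<lambda>i. i < 5) [v, b, x, y, z] \<and>
     cnt es v x = 2 \<and> cnt es v y = 2 \<and> cnt es v z = 2 \<and> (cnt es b x = 1 \<or> cnt es b x = 2) \<and>
     cnt es b y = 1 \<and> cnt es b z = 1 \<and> cnt es v b = 0 \<and> cnt es x y = 0 \<and> cnt es x z = 0 \<and> cnt es y z = 0 \<and>
     list_all2 (kid_ok prev es) ks pairs5)"

primrec check :: "elist list \<Rightarrow> (elist \<times> rule) list \<Rightarrow> bool" where
  "check prev [] = True"
| "check prev (c # cs) = (check_rule prev (fst c) (snd c) \<and> check (prev @ [fst c]) cs)"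

text \<open>Found by computer search; the last list is empty, hence lies below every graph.\<close>

definition cert5 :: "(elist \<times> rule) list" where
  "cert5 = [([(0,1),(0,2),(0,4),(0,4),(1,2),(1,4),(2,3),(3,4),(3,4)], Wheel [(0,4,3)] [0,1,2,3,4]),
   ([(0,1),(0,2),(0,4),(1,2),(1,4),(2,3),(2,3),(2,3),(3,4),(3,4)], Wheel [(0,2,3),(2,3,4)] [4,0,1,2,3]),
   ([(0,1),(0,2),(0,4),(1,2),(1,4),(2,3),(2,3),(2,4),(3,4)], Wheel [(0,2,3)] [4,0,1,2,3]),
   ([(0,1),(0,2),(0,4),(1,2),(1,4),(2,3),(2,3),(3,4),(3,4)], Chain 2 3 4 [(0,[0,1,4,3,2]), (0,[2,0,1,4,3]), (0,[0,1,2,3,4]), (0,[1,0,4,3,2]), (0,[2,1,0,4,3]), (0,[1,0,2,3,4]), (1,[0,1,2,3,4]), (2,[0,1,2,3,4]), (1,[0,1,4,3,2])]),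
   ([(0,1),(0,2),(0,3),(0,4),(1,2),(1,4),(2,3),(3,4)], Wheel [] [0,1,2,3,4]),
   ([(0,1),(0,2),(0,4),(1,2),(1,4),(2,3),(2,3),(3,4)], Cut [2,3] [(0,[0,1,4,3,2]), (0,[1,0,4,3,2]), (2,[0,1,2,3,4]), (4,[0,1,2,3,4]), (4,[1,0,2,3,4]), (3,[0,1,2,3,4])]),
   ([(0,1),(0,2),(0,4),(1,2),(1,4),(2,3),(3,4)], Cut [3] [(4,[0,1,2,3,4]), (4,[1,0,2,3,4]), (5,[0,1,2,3,4]), (5,[0,1,4,3,2])]),
   ([(0,1),(0,1),(0,4),(1,2),(1,3),(1,3),(1,4),(2,3),(2,3),(3,4)], Wheel [(0,1,2),(1,3,2)] [1,0,2,3,4]),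
   ([(0,1),(0,1),(0,4),(1,2),(1,2),(1,3),(1,4),(2,3),(3,4)], Wheel [(0,1,2)] [1,0,2,3,4]),
   ([(0,1),(0,1),(0,4),(1,2),(1,3),(1,4),(2,3),(2,3),(3,4),(3,4)], Wheel [(0,1,2),(2,3,4)] [4,0,1,3,2]),
   ([(0,1),(0,1),(0,4),(1,2),(1,3),(1,4),(2,3),(2,3),(3,4)], Cut [2,3] [(4,[1,0,2,3,4]), (8,[0,1,2,3,4]), (2,[2,3,1,0,4]), (2,[0,4,3,2,1]), (7,[0,1,2,3,4]), (9,[0,1,2,3,4])]),
   ([(0,1),(0,1),(0,4),(1,2),(1,3),(1,4),(2,3),(3,4)], Cut [2] [(4,[1,0,2,3,4]), (8,[0,1,2,3,4]), (10,[0,1,2,3,4]), (2,[2,3,1,0,4])]),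
   ([(0,1),(0,1),(0,4),(1,2),(1,2),(1,4),(1,4),(2,3),(3,4),(3,4)], Wheel [(0,1,2),(1,4,3)] [1,0,2,3,4]),
   ([(0,1),(0,1),(0,4),(1,2),(1,2),(1,4),(2,3),(2,3),(2,4),(3,4)], Wheel [(0,1,2),(0,2,3)] [4,0,1,2,3]),
   ([(0,1),(0,1),(0,4),(1,2),(1,2),(1,2),(1,4),(2,3),(2,3),(3,4)], Wheel [(0,1,2),(1,2,3)] [1,0,2,3,4]),
   ([(0,1),(0,1),(0,4),(1,2),(1,2),(1,4),(1,4),(2,3),(2,3),(3,4)], Cut [2,3] [(0,[1,0,4,3,2]), (14,[0,1,2,3,4]), (13,[0,1,2,3,4]), (0,[0,4,3,2,1]), (8,[0,1,2,3,4]), (12,[0,1,2,3,4])]),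
   ([(0,1),(0,1),(0,4),(1,2),(1,4),(1,4),(2,3),(2,3),(3,4),(3,4),(3,4)], Wheel [(0,1,2),(1,4,3),(2,3,4)] [4,0,1,3,2]),
   ([(0,1),(0,1),(0,4),(1,2),(1,4),(1,4),(2,3),(2,3),(3,4),(3,4)], Cut [2,3] [(0,[1,0,2,3,4]), (12,[0,1,2,3,4]), (7,[3,4,0,1,2]), (0,[4,0,1,2,3]), (9,[0,1,2,3,4]), (16,[0,1,2,3,4])]),
   ([(0,1),(0,1),(0,4),(1,2),(1,4),(1,4),(2,3),(2,3),(2,4),(2,4),(3,4)], Wheel [(0,1,2),(0,2,3),(1,4,2)] [4,0,1,2,3]),
   ([(0,1),(0,1),(0,4),(1,2),(1,4),(1,4),(2,3),(2,3),(2,4),(3,4)], Cut [2,3] [(2,[0,1,2,3,4]), (13,[0,1,2,3,4]), (18,[0,1,2,3,4]), (0,[4,2,3,0,1]), (2,[2,3,1,0,4]), (7,[3,4,0,1,2])]),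
   ([(0,1),(0,1),(0,4),(1,2),(1,4),(1,4),(2,3),(2,3),(3,4)], Cut [2,3] [(5,[0,1,2,3,4]), (15,[0,1,2,3,4]), (19,[0,1,2,3,4]), (5,[0,4,3,2,1]), (10,[0,1,2,3,4]), (17,[0,1,2,3,4])]),
   ([(0,1),(0,1),(0,4),(0,4),(1,2),(1,2),(1,4),(2,3),(3,4),(3,4)], Wheel [(0,1,2),(0,4,3)] [0,1,2,3,4]),
   ([(0,1),(0,1),(0,4),(0,4),(1,2),(1,4),(2,3),(2,3),(3,4),(3,4)], Cut [2,3] [(0,[0,1,2,3,4]), (21,[0,1,2,3,4]), (8,[0,4,3,2,1]), (0,[4,0,1,2,3]), (9,[0,1,2,3,4]), (14,[0,4,3,2,1])]),
   ([(0,1),(0,1),(0,4),(0,4),(1,2),(1,4),(2,3),(2,3),(3,4)], Cut [2,3] [(5,[0,1,2,3,4]), (22,[0,4,3,2,1]), (10,[0,4,3,2,1]), (5,[0,4,3,2,1]), (10,[0,1,2,3,4]), (22,[0,1,2,3,4])]),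
   ([(0,1),(0,1),(0,4),(1,2),(1,2),(1,4),(2,3),(2,3),(3,4),(3,4),(3,4)], Wheel [(0,1,2),(0,4,3),(2,3,4)] [2,0,1,4,3]),
   ([(0,1),(0,1),(0,4),(1,2),(1,2),(1,4),(2,3),(2,3),(2,3),(3,4),(3,4)], Wheel [(0,1,2),(0,2,3),(2,3,4)] [4,0,1,2,3]),
   ([(0,1),(0,1),(0,4),(1,2),(1,2),(1,4),(2,3),(2,3),(3,4),(3,4)], Chain 2 3 4 [(0,[1,0,4,3,2]), (0,[0,4,3,2,1]), (21,[0,1,2,3,4]), (14,[0,1,2,3,4]), (8,[0,1,2,3,4]), (12,[0,1,2,3,4]), (25,[0,1,2,3,4]), (9,[3,4,0,1,2]), (24,[0,1,2,3,4])]),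
   ([(0,1),(0,1),(0,4),(1,2),(1,2),(1,4),(2,3),(2,3),(3,4)], Cut [2,3] [(0,[1,0,4,3,2]), (14,[0,1,2,3,4]), (13,[0,1,2,3,4]), (0,[0,4,3,2,1]), (8,[0,1,2,3,4]), (26,[0,1,2,3,4])]),
   ([(0,1),(0,1),(0,4),(1,2),(1,4),(2,3),(2,3),(3,4)], Cut [0,1] [(5,[0,1,2,3,4]), (5,[0,4,3,2,1]), (23,[0,1,2,3,4]), (27,[0,1,2,3,4]), (10,[0,1,2,3,4]), (20,[0,1,2,3,4])]),
   ([(0,1),(0,1),(0,4),(1,2),(1,2),(1,4),(2,3),(3,4),(3,4)], Cut [0,1,2] [(0,[0,4,3,2,1]), (21,[0,1,2,3,4]), (8,[0,1,2,3,4]), (12,[0,1,2,3,4]), (26,[0,1,2,3,4]), (9,[3,4,0,1,2])]),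
   ([(0,1),(0,1),(0,4),(1,2),(1,4),(2,3),(3,4),(3,4)], Cut [2] [(5,[0,1,4,3,2]), (29,[0,1,2,3,4]), (28,[0,1,2,3,4]), (10,[3,4,0,1,2])]),
   ([(0,1),(0,1),(0,4),(1,2),(1,4),(2,3),(3,4)], Cut [3] [(6,[0,4,1,2,3]), (11,[0,1,2,3,4]), (28,[0,1,2,3,4]), (30,[0,1,2,3,4])]),
   ([(0,1),(0,4),(1,2),(1,4),(2,3),(3,4)], Cut [0] [(31,[0,1,2,3,4]), (6,[0,1,2,3,4]), (6,[0,4,1,2,3]), (31,[0,4,3,2,1])]),
   ([(0,2),(0,2),(0,4),(1,2),(1,2),(1,4),(1,4),(2,3),(3,4),(3,4)], Wheel [(0,2,1),(1,4,3)] [1,0,2,3,4]),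
   ([(0,2),(0,4),(0,4),(1,2),(1,4),(1,4),(1,4),(2,3),(3,4),(3,4)], Wheel [(0,4,1),(1,4,3)] [1,0,2,3,4]),
   ([(0,2),(0,2),(0,2),(0,4),(0,4),(1,2),(1,4),(1,4),(2,3),(3,4),(3,4)], Wheel [(0,2,1),(1,4,3),(2,0,4)] [4,0,1,3,2]),
   ([(0,2),(0,2),(0,4),(1,2),(1,4),(1,4),(2,3),(2,4),(3,4),(3,4)], Wheel [(0,2,1),(1,4,3)] [4,0,1,3,2]),
   ([(0,2),(0,2),(0,4),(0,4),(1,2),(1,4),(1,4),(2,3),(3,4),(3,4)], Star 4 2 0 1 3 [(0,[0,1,2,3,4]), (35,[0,1,2,3,4]), (0,[0,3,2,1,4]), (34,[1,0,2,3,4]), (33,[0,1,2,3,4]), (0,[1,3,2,0,4]), (34,[0,1,2,3,4]), (33,[0,3,2,1,4]), (36,[0,1,2,3,4]), (34,[0,3,2,1,4])]),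
   ([(0,2),(0,2),(0,4),(1,2),(1,4),(1,4),(2,3),(3,4),(3,4)], Cut [0,2] [(0,[1,0,2,3,4]), (0,[3,0,2,1,4]), (37,[0,1,2,3,4]), (33,[0,1,2,3,4]), (33,[0,3,2,1,4]), (36,[0,1,2,3,4])]),
   ([(0,2),(0,2),(0,4),(1,2),(1,4),(1,4),(2,3),(3,4)], Cut [3] [(5,[0,3,4,1,2]), (5,[1,3,2,0,4]), (38,[1,0,4,3,2]), (38,[0,1,2,3,4])]),
   ([(0,2),(0,4),(0,4),(1,2),(1,4),(1,4),(2,3),(2,4),(3,4),(3,4)], Wheel [(0,4,1),(0,4,3)] [2,0,1,4,3]),
   ([(0,2),(0,4),(0,4),(1,2),(1,4),(1,4),(2,3),(3,4),(3,4)], Star 4 2 0 1 3 [(0,[0,1,2,3,4]), (37,[0,1,2,3,4]), (0,[0,3,2,1,4]), (34,[1,0,2,3,4]), (37,[1,0,2,3,4]), (0,[1,3,2,0,4]), (34,[0,1,2,3,4]), (37,[3,0,2,1,4]), (40,[0,1,2,3,4]), (34,[0,3,2,1,4])]),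
   ([(0,2),(0,4),(0,4),(1,2),(1,4),(1,4),(2,3),(3,4)], Cut [3] [(0,[0,3,2,1,4]), (0,[1,3,2,0,4]), (38,[3,0,2,1,4]), (41,[0,1,2,3,4])]),
   ([(0,2),(0,4),(1,2),(1,4),(1,4),(2,3),(3,4)], Cut [0] [(6,[0,1,2,3,4]), (39,[0,1,2,3,4]), (5,[0,3,4,1,2]), (42,[0,1,2,3,4])]),
   ([(0,2),(0,4),(1,2),(1,4),(2,3),(3,4)], Cut [1] [(6,[0,1,2,3,4]), (43,[0,1,4,3,2]), (6,[1,3,2,0,4]), (43,[0,1,2,3,4])]),
   ([(0,4),(0,4),(0,4),(1,2),(1,4),(1,4),(2,3),(2,4),(3,4),(3,4)], Wheel [(0,4,1),(0,4,3)] [4,0,1,2,3]),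
   ([(0,4),(0,4),(0,4),(1,2),(1,3),(1,4),(1,4),(2,3),(2,3),(3,4),(3,4)], Wheel [(0,4,1),(0,4,3),(0,3,2)] [1,0,2,3,4]),
   ([(0,4),(0,4),(0,4),(1,2),(1,4),(1,4),(2,3),(2,3),(3,4),(3,4),(3,4)], Wheel [(0,4,1),(0,4,3),(2,3,4)] [4,0,1,2,3]),
   ([(0,4),(0,4),(0,4),(1,2),(1,2),(1,2),(1,4),(1,4),(2,3),(2,3),(3,4),(3,4)], Wheel [(0,4,1),(0,1,2),(0,4,3),(1,2,3)] [3,0,2,1,4]),
   ([(0,4),(0,4),(0,4),(1,2),(1,2),(1,4),(1,4),(2,3),(2,3),(3,4),(3,4)], Chain 1 2 3 [(12,[0,4,3,2,1]), (33,[0,1,4,3,2]), (12,[0,4,1,2,3]), (48,[0,1,2,3,4]), (46,[0,1,2,3,4]), (47,[0,3,2,1,4]), (48,[0,3,2,1,4]), (45,[0,1,2,3,4]), (47,[0,1,2,3,4])]),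
   ([(0,4),(0,4),(0,4),(1,2),(1,4),(1,4),(2,3),(2,3),(3,4),(3,4)], Cut [2,3] [(34,[1,0,2,3,4]), (49,[0,1,2,3,4]), (45,[0,1,2,3,4]), (12,[0,4,1,2,3]), (46,[0,1,2,3,4]), (47,[0,1,2,3,4])]),
   ([(0,4),(0,4),(0,4),(1,2),(1,3),(1,4),(1,4),(2,3),(2,4),(3,4)], Wheel [(0,4,1),(0,4,2)] [1,0,2,3,4]),
   ([(0,4),(0,4),(0,4),(1,2),(1,2),(1,3),(1,4),(1,4),(1,4),(2,3),(3,4)], Wheel [(0,4,1),(0,1,2),(0,4,1)] [1,0,2,3,4]),
   ([(0,4),(0,4),(0,4),(1,2),(1,3),(1,3),(1,4),(1,4),(1,4),(2,3),(2,3),(3,4)], Wheel [(0,4,1),(0,1,2),(0,4,1),(1,3,2)] [1,0,2,3,4]),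
   ([(0,4),(0,4),(0,4),(1,2),(1,3),(1,4),(1,4),(1,4),(2,3),(2,3),(3,4)], Cut [2,3] [(0,[1,3,2,0,4]), (52,[0,1,2,3,4]), (51,[0,1,2,3,4]), (9,[2,3,0,4,1]), (53,[0,1,2,3,4]), (46,[0,1,2,3,4])]),
   ([(0,4),(0,4),(0,4),(1,2),(1,2),(1,4),(1,4),(2,3),(2,3),(2,4),(3,4)], Wheel [(0,4,1),(0,4,2),(1,2,3)] [1,0,2,3,4]),
   ([(0,4),(0,4),(0,4),(1,2),(1,2),(1,2),(1,4),(1,4),(1,4),(2,3),(2,3),(3,4)], Wheel [(0,4,1),(0,1,2),(0,4,1),(1,2,3)] [1,0,2,3,4]),
   ([(0,4),(0,4),(0,4),(1,2),(1,2),(1,4),(1,4),(1,4),(2,3),(2,3),(3,4)], Cut [2,3] [(33,[0,1,4,3,2]), (56,[0,1,2,3,4]), (55,[0,1,2,3,4]), (14,[0,4,1,2,3]), (52,[0,1,2,3,4]), (47,[0,3,2,1,4])]),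
   ([(0,4),(0,4),(0,4),(1,2),(1,4),(1,4),(2,3),(2,3),(2,4),(2,4),(3,4)], Wheel [(0,4,1),(0,4,2),(0,2,3)] [4,0,1,2,3]),
   ([(0,4),(0,4),(0,4),(1,2),(1,4),(1,4),(1,4),(2,3),(2,3),(2,4),(3,4)], Cut [2,3] [(36,[3,0,2,1,4]), (55,[0,1,2,3,4]), (58,[0,1,2,3,4]), (8,[0,4,1,2,3]), (51,[0,1,2,3,4]), (45,[0,1,2,3,4])]),
   ([(0,4),(0,4),(0,4),(1,2),(1,4),(1,4),(1,4),(2,3),(2,3),(3,4)], Cut [2,3] [(38,[3,0,2,1,4]), (57,[0,1,2,3,4]), (59,[0,1,2,3,4]), (29,[0,4,1,2,3]), (54,[0,1,2,3,4]), (50,[0,1,2,3,4])]),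
   ([(0,4),(0,4),(0,4),(1,2),(1,4),(1,4),(2,3),(2,3),(2,4),(3,4)], Cut [2,3] [(36,[3,0,2,1,4]), (55,[0,1,2,3,4]), (58,[0,1,2,3,4]), (8,[0,4,1,2,3]), (51,[0,1,2,3,4]), (45,[0,1,2,3,4])]),
   ([(0,4),(0,4),(0,4),(1,2),(1,4),(1,4),(2,3),(2,3),(3,4)], Cut [1,2,3] [(20,[0,4,3,2,1]), (60,[0,1,2,3,4]), (38,[3,0,2,1,4]), (61,[0,1,2,3,4]), (29,[0,4,1,2,3]), (50,[0,1,2,3,4])]),
   ([(0,4),(0,4),(0,4),(1,2),(1,3),(1,4),(2,3),(2,3),(3,4),(3,4)], Cut [1,2,3] [(13,[0,4,3,2,1]), (46,[0,1,2,3,4]), (0,[3,1,2,0,4]), (51,[0,3,1,2,4]), (7,[2,3,0,4,1]), (52,[0,3,2,1,4])]),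
   ([(0,4),(0,4),(0,4),(1,2),(1,4),(2,3),(2,3),(3,4),(3,4)], Cut [1] [(27,[0,4,3,2,1]), (62,[0,3,2,1,4]), (63,[0,1,2,3,4]), (50,[0,1,2,3,4])]),
   ([(0,4),(0,4),(0,4),(1,2),(1,2),(1,4),(2,3),(2,3),(2,4),(2,4),(3,4)], Wheel [(0,4,1),(0,4,2),(1,2,3)] [2,0,1,3,4]),
   ([(0,4),(0,4),(0,4),(1,2),(1,4),(2,3),(2,3),(2,4),(2,4),(3,4)], Cut [1] [(7,[0,4,3,2,1]), (65,[0,1,2,3,4]), (51,[0,2,1,3,4]), (58,[0,1,2,3,4])]),
   ([(0,4),(0,4),(0,4),(1,2),(1,4),(2,3),(2,3),(2,4),(3,4)], Cut [1,2,3] [(10,[0,4,3,2,1]), (61,[0,1,2,3,4]), (39,[0,3,4,1,2]), (66,[0,1,2,3,4]), (11,[0,4,1,2,3]), (64,[0,1,2,3,4])]),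
   ([(0,4),(0,4),(0,4),(1,2),(1,4),(2,3),(2,3),(3,4)], Cut [1,2,3] [(28,[0,4,3,2,1]), (62,[0,1,2,3,4]), (39,[0,3,4,1,2]), (67,[0,1,2,3,4]), (30,[0,4,1,2,3]), (64,[0,1,2,3,4])]),
   ([(0,4),(0,4),(0,4),(1,2),(1,4),(2,3),(2,4),(3,4),(3,4)], Cut [1] [(8,[0,4,3,2,1]), (61,[0,3,2,1,4]), (51,[0,3,1,2,4]), (45,[0,1,2,3,4])]),
   ([(0,4),(0,4),(0,4),(1,2),(1,4),(2,3),(2,4),(2,4),(3,4)], Cut [3] [(11,[0,4,1,2,3]), (51,[0,2,1,3,4]), (66,[0,1,2,3,4]), (69,[0,1,2,3,4])]),
   ([(0,4),(0,4),(0,4),(1,2),(1,4),(2,3),(2,4),(3,4)], Cut [1,2,3] [(11,[0,4,3,2,1]), (69,[0,3,2,1,4]), (43,[1,0,2,3,4]), (70,[0,1,2,3,4]), (11,[0,4,1,2,3]), (69,[0,1,2,3,4])]),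
   ([(0,4),(0,4),(0,4),(1,2),(1,4),(2,3),(3,4)], Cut [2] [(43,[1,0,2,3,4]), (68,[0,3,2,1,4]), (68,[0,1,2,3,4]), (71,[0,1,2,3,4])]),
   ([(0,4),(0,4),(1,2),(1,4),(2,3),(3,4)], Cut [0] [(31,[0,4,3,2,1]), (43,[1,0,2,3,4]), (31,[0,4,1,2,3]), (72,[0,1,2,3,4])]),
   ([(0,4),(1,2),(1,4),(2,3),(3,4)], Cut [0] [(32,[0,1,2,3,4]), (44,[0,1,2,3,4]), (32,[0,3,2,1,4]), (73,[0,1,2,3,4])]),
   ([(0,1),(0,4),(0,4),(1,4),(1,4),(2,3),(2,4),(2,4),(3,4),(3,4)], Wheel [(0,4,2),(1,4,3)] [4,0,1,3,2]),
   ([(0,1),(0,4),(0,4),(1,4),(1,4),(2,3),(2,3),(2,4),(3,4),(3,4),(3,4)], Wheel [(0,4,2),(1,4,3),(2,3,4)] [4,0,1,3,2]),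
   ([(0,1),(0,4),(0,4),(1,4),(1,4),(1,4),(2,3),(2,3),(2,4),(3,4),(3,4)], Cut [2,3] [(8,[1,4,3,2,0]), (8,[0,4,3,2,1]), (75,[0,1,2,3,4]), (7,[1,4,2,3,0]), (7,[0,4,2,3,1]), (76,[0,1,2,3,4])]),
   ([(0,1),(0,4),(0,4),(1,4),(1,4),(1,4),(2,3),(2,4),(3,4),(3,4)], Cut [2] [(8,[1,4,3,2,0]), (8,[0,4,3,2,1]), (77,[0,1,2,3,4]), (75,[0,1,2,3,4])]),
   ([(0,4),(0,4),(0,4),(1,4),(1,4),(1,4),(2,3),(2,4),(2,4),(3,4),(3,4)], Wheel [(0,4,1),(0,4,2),(1,4,3)] [4,0,1,3,2]),
   ([(0,4),(0,4),(0,4),(1,4),(1,4),(1,4),(2,3),(2,3),(2,4),(3,4),(3,4),(3,4)], Wheel [(0,4,1),(0,4,2),(1,4,3),(2,3,4)] [4,0,1,3,2]),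
   ([(0,4),(0,4),(0,4),(1,4),(1,4),(1,4),(2,3),(2,3),(2,4),(3,4),(3,4)], Cut [2,3] [(45,[1,0,2,3,4]), (45,[0,1,2,3,4]), (79,[0,1,2,3,4]), (58,[1,0,3,2,4]), (58,[0,1,3,2,4]), (80,[0,1,2,3,4])]),
   ([(0,4),(0,4),(0,4),(1,4),(1,4),(1,4),(2,3),(2,4),(3,4),(3,4)], Cut [2] [(45,[1,0,2,3,4]), (45,[0,1,2,3,4]), (81,[0,1,2,3,4]), (79,[0,1,2,3,4])]),
   ([(0,4),(0,4),(1,4),(1,4),(1,4),(2,3),(2,4),(3,4),(3,4)], Cut [0] [(78,[0,1,2,3,4]), (45,[1,0,2,3,4]), (69,[1,2,3,0,4]), (82,[0,1,2,3,4])]),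
   ([(0,1),(0,4),(0,4),(1,4),(1,4),(2,3),(2,3),(2,4),(3,4),(3,4)], Cut [2,3] [(8,[1,4,3,2,0]), (8,[0,4,3,2,1]), (75,[0,1,2,3,4]), (7,[1,4,2,3,0]), (7,[0,4,2,3,1]), (76,[0,1,2,3,4])]),
   ([(0,1),(0,4),(0,4),(1,4),(1,4),(2,3),(2,4),(3,4),(3,4)], Cut [2] [(8,[1,4,3,2,0]), (8,[0,4,3,2,1]), (84,[0,1,2,3,4]), (75,[0,1,2,3,4])]),
   ([(0,4),(0,4),(1,4),(1,4),(2,3),(2,4),(3,4),(3,4)], Cut [1] [(85,[0,1,2,3,4]), (73,[0,1,2,3,4]), (73,[0,1,3,2,4]), (83,[0,1,2,3,4])]),
   ([(0,1),(0,1),(0,4),(0,4),(0,4),(1,4),(2,3),(2,3),(2,4),(3,4),(3,4),(3,4)], Wheel [(0,4,2),(0,4,3),(1,0,2),(2,3,4)] [4,0,1,2,3]),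
   ([(0,1),(0,4),(0,4),(0,4),(1,4),(2,3),(2,3),(2,4),(3,4),(3,4),(3,4)], Cut [1] [(87,[0,1,2,3,4]), (8,[0,4,3,2,1]), (7,[0,4,2,3,1]), (76,[0,1,2,3,4])]),
   ([(0,1),(0,4),(0,4),(0,4),(1,4),(2,3),(2,4),(3,4),(3,4),(3,4)], Cut [2] [(11,[3,4,1,0,2]), (8,[0,4,3,2,1]), (88,[0,1,2,3,4]), (78,[2,3,1,0,4])]),
   ([(0,1),(0,4),(0,4),(0,4),(1,4),(2,3),(2,4),(3,4),(3,4)], Cut [2,3] [(11,[3,4,1,0,2]), (8,[0,4,3,2,1]), (85,[2,3,1,0,4]), (32,[1,0,3,2,4]), (11,[0,4,2,3,1]), (89,[0,1,2,3,4])]),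
   ([(0,4),(0,4),(0,4),(1,4),(2,3),(2,4),(3,4),(3,4)], Cut [1] [(90,[0,1,2,3,4]), (69,[0,1,2,3,4]), (70,[0,1,3,2,4]), (83,[1,0,2,3,4])]),
   ([(0,4),(0,4),(1,4),(2,3),(2,4),(3,4),(3,4)], Cut [0,1] [(74,[1,0,2,3,4]), (74,[1,0,3,2,4]), (91,[0,1,2,3,4]), (73,[0,1,2,3,4]), (73,[0,1,3,2,4]), (86,[0,1,2,3,4])]),
   ([(0,4),(0,4),(1,4),(2,3),(2,4),(3,4)], Cut [2,3] [(74,[1,0,2,3,4]), (73,[0,1,2,3,4]), (92,[0,1,3,2,4]), (74,[1,0,3,2,4]), (73,[0,1,3,2,4]), (92,[0,1,2,3,4])]),
   ([(0,1),(0,4),(0,4),(1,4),(1,4),(2,3),(2,3),(2,3),(3,4),(3,4),(3,4),(3,4)], Wheel [(0,4,3),(0,3,2),(1,4,3),(2,3,4)] [4,0,1,3,2]),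
   ([(0,1),(0,1),(0,4),(0,4),(0,4),(1,4),(2,3),(2,3),(2,3),(3,4),(3,4),(3,4),(3,4)], Wheel [(0,4,3),(0,3,2),(0,4,3),(1,0,2),(2,3,4)] [4,0,1,2,3]),
   ([(0,1),(0,4),(0,4),(0,4),(1,4),(2,3),(2,3),(2,3),(3,4),(3,4),(3,4),(3,4)], Cut [1] [(95,[0,1,2,3,4]), (14,[0,4,3,2,1]), (52,[2,4,0,1,3]), (94,[0,1,2,3,4])]),
   ([(0,1),(0,4),(0,4),(1,4),(2,3),(2,3),(2,3),(3,4),(3,4),(3,4),(3,4)], Cut [0,1] [(32,[1,0,2,3,4]), (72,[2,0,1,4,3]), (96,[0,1,2,3,4]), (14,[0,4,3,2,1]), (52,[2,4,0,1,3]), (94,[0,1,2,3,4])]),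
   ([(0,1),(0,4),(0,4),(1,4),(2,3),(2,3),(2,3),(3,4),(3,4),(3,4)], Cut [2,3] [(32,[1,0,2,3,4]), (14,[0,4,3,2,1]), (90,[3,2,1,0,4]), (72,[2,0,1,4,3]), (52,[2,4,0,1,3]), (97,[0,1,2,3,4])]),
   ([(0,1),(0,4),(0,4),(1,4),(2,3),(2,3),(2,3),(3,4),(3,4)], Cut [2,3] [(32,[1,0,2,3,4]), (27,[0,4,3,2,1]), (92,[0,1,2,3,4]), (72,[2,0,1,4,3]), (63,[2,1,0,4,3]), (98,[0,1,2,3,4])]),
   ([(0,1),(0,4),(0,4),(1,4),(2,3),(2,3),(2,3),(3,4)], Cut [2,3] [(32,[1,0,2,3,4]), (28,[0,4,3,2,1]), (93,[0,1,2,3,4]), (72,[2,0,1,4,3]), (68,[2,1,0,4,3]), (99,[0,1,2,3,4])]),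
   ([(0,4),(0,4),(0,4),(1,3),(1,3),(1,3),(1,4),(1,4),(1,4),(2,3),(2,3),(2,3),(3,4)], Wheel [(0,4,1),(0,1,3),(0,3,2),(0,4,1),(1,3,2)] [1,0,2,3,4]),
   ([(0,4),(0,4),(0,4),(1,3),(1,3),(1,4),(1,4),(2,3),(2,3),(2,3),(3,4),(3,4)], Wheel [(0,4,1),(0,4,3),(0,3,2),(1,3,2)] [1,0,2,3,4]),
   ([(0,4),(0,4),(0,4),(1,3),(1,3),(1,4),(1,4),(1,4),(2,3),(2,3),(2,3),(3,4)], Cut [2,3] [(21,[1,3,2,0,4]), (53,[0,1,2,3,4]), (55,[0,1,3,2,4]), (55,[2,1,4,0,3]), (101,[0,1,2,3,4]), (102,[0,1,2,3,4])]),
   ([(0,4),(0,4),(0,4),(1,3),(1,3),(1,4),(1,4),(2,3),(2,3),(2,3),(3,4)], Cut [1,2,3] [(62,[2,1,0,4,3]), (103,[0,1,2,3,4]), (21,[1,3,2,0,4]), (55,[0,1,3,2,4]), (55,[2,1,4,0,3]), (102,[0,1,2,3,4])]),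
   ([(0,4),(0,4),(0,4),(1,3),(1,3),(1,4),(2,3),(2,3),(2,3),(3,4),(3,4),(3,4)], Wheel [(0,4,1),(0,4,3),(1,3,2),(2,3,4)] [3,0,1,2,4]),
   ([(0,4),(0,4),(0,4),(1,3),(1,3),(1,4),(2,3),(2,3),(2,3),(3,4),(3,4)], Cut [1,2,3] [(46,[2,1,0,4,3]), (102,[0,1,2,3,4]), (12,[1,3,2,0,4]), (65,[0,1,3,2,4]), (58,[2,1,4,0,3]), (105,[0,1,2,3,4])]),
   ([(0,4),(0,4),(0,4),(1,3),(1,3),(1,4),(2,3),(2,3),(2,3),(3,4)], Cut [1,2,3] [(62,[2,1,0,4,3]), (104,[0,1,2,3,4]), (29,[1,3,2,0,4]), (67,[0,1,3,2,4]), (61,[2,1,4,0,3]), (106,[0,1,2,3,4])]),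
   ([(0,4),(0,4),(0,4),(1,3),(1,4),(2,3),(2,3),(2,3),(3,4)], Cut [1] [(68,[2,1,0,4,3]), (68,[0,1,2,3,4]), (107,[0,1,2,3,4]), (107,[2,1,0,4,3])]),
   ([(0,4),(0,4),(0,4),(1,4),(1,4),(1,4),(2,3),(2,3),(2,3),(3,4),(3,4),(3,4),(3,4)], Wheel [(0,4,1),(0,4,3),(0,3,2),(1,4,3),(2,3,4)] [4,0,1,3,2]),
   ([(0,4),(0,4),(0,4),(1,4),(1,4),(1,4),(2,3),(2,3),(2,3),(3,4),(3,4),(3,4)], Cut [2,3] [(47,[1,0,2,3,4]), (47,[0,1,2,3,4]), (80,[0,1,2,3,4]), (105,[2,0,1,4,3]), (105,[2,1,0,4,3]), (109,[0,1,2,3,4])]),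
   ([(0,4),(0,4),(0,4),(1,4),(1,4),(1,4),(2,3),(2,3),(2,3),(3,4),(3,4)], Cut [2,3] [(50,[1,0,2,3,4]), (50,[0,1,2,3,4]), (81,[0,1,2,3,4]), (106,[2,0,1,4,3]), (106,[2,1,0,4,3]), (110,[0,1,2,3,4])]),
   ([(0,4),(0,4),(0,4),(1,4),(1,4),(1,4),(2,3),(2,3),(2,3),(3,4)], Cut [2,3] [(60,[1,0,2,3,4]), (60,[0,1,2,3,4]), (93,[0,1,2,3,4]), (107,[2,0,1,4,3]), (107,[2,1,0,4,3]), (111,[0,1,2,3,4])]),
   ([(0,4),(0,4),(0,4),(1,4),(1,4),(2,3),(2,3),(2,3),(3,4)], Cut [1] [(100,[0,1,2,3,4]), (62,[0,1,2,3,4]), (107,[2,1,0,4,3]), (112,[0,1,2,3,4])]),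
   ([(0,4),(0,4),(0,4),(1,4),(2,3),(2,3),(2,3),(3,4)], Cut [1] [(100,[0,1,2,3,4]), (68,[0,1,2,3,4]), (108,[0,1,2,3,4]), (113,[0,1,2,3,4])]),
   ([(0,3),(0,4),(0,4),(1,4),(1,4),(2,3),(2,3),(2,3),(3,4)], Cut [1] [(68,[2,0,1,4,3]), (29,[0,4,1,2,3]), (67,[2,0,4,1,3]), (107,[2,0,1,4,3])]),
   ([(0,3),(0,4),(0,4),(1,4),(2,3),(2,3),(2,3),(3,4)], Cut [1] [(72,[2,0,1,4,3]), (30,[0,4,1,2,3]), (67,[2,1,4,0,3]), (115,[0,1,2,3,4])]),
   ([(0,4),(0,4),(1,4),(2,3),(2,3),(2,3),(3,4)], Cut [0] [(100,[0,1,2,3,4]), (74,[1,0,2,3,4]), (116,[0,1,2,3,4]), (114,[0,1,2,3,4])]),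
   ([(0,4),(0,4),(1,4),(2,3),(2,3),(3,4)], Cut [2] [(74,[1,0,2,3,4]), (73,[0,1,2,3,4]), (117,[0,1,2,3,4]), (93,[0,1,2,3,4])]),
   ([(0,4),(0,4),(1,4),(2,3),(3,4)], Cut [2] [(74,[1,0,2,3,4]), (73,[0,1,2,3,4]), (118,[0,1,2,3,4]), (93,[0,1,2,3,4])]),
   ([(0,3),(0,4),(1,4),(2,3),(3,4)], Cut [0] [(74,[2,0,1,4,3]), (74,[1,0,2,3,4]), (119,[0,2,1,4,3]), (119,[0,1,2,3,4])]),
   ([(0,4),(1,4),(2,3),(3,4)], Cut [0,1] [(74,[1,0,2,3,4]), (120,[0,1,2,3,4]), (119,[0,1,2,3,4]), (74,[0,1,2,3,4]), (120,[1,0,2,3,4]), (119,[1,0,2,3,4])]),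
   ([(0,1),(0,1),(0,1),(0,4),(0,4),(0,4),(1,2),(1,2),(2,3),(3,4),(3,4)], Wheel [(0,1,2),(0,4,3),(1,0,4)] [0,1,2,3,4]),
   ([(0,1),(0,1),(0,1),(0,4),(0,4),(1,2),(1,2),(2,3),(2,3),(2,3),(3,4),(3,4)], Wheel [(0,1,2),(0,2,3),(1,0,4),(2,3,4)] [4,0,1,2,3]),
   ([(0,1),(0,1),(0,1),(0,4),(0,4),(1,2),(1,2),(2,3),(2,3),(3,4),(3,4)], Chain 2 3 4 [(21,[1,0,4,3,2]), (14,[4,0,1,2,3]), (122,[0,1,2,3,4]), (122,[1,0,4,3,2]), (14,[2,1,0,4,3]), (21,[0,1,2,3,4]), (123,[0,1,2,3,4]), (21,[3,2,1,0,4]), (123,[1,0,4,3,2])]),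
   ([(0,1),(0,1),(0,4),(0,4),(1,2),(1,2),(2,3),(2,3),(3,4),(3,4)], Chain 1 0 4 [(124,[0,1,2,3,4]), (21,[1,0,4,3,2]), (21,[4,0,1,2,3]), (124,[0,4,3,2,1]), (124,[1,2,3,4,0]), (21,[2,1,0,4,3]), (21,[0,1,2,3,4]), (21,[3,2,1,0,4]), (124,[3,4,0,1,2])]),
   ([(0,1),(0,4),(0,4),(1,2),(1,2),(2,3),(2,3),(3,4),(3,4),(3,4)], Cut [1,2] [(124,[3,4,0,1,2]), (14,[2,3,4,0,1]), (14,[0,4,3,2,1]), (25,[1,2,3,4,0]), (122,[3,2,1,0,4]), (21,[3,2,1,0,4])]),
   ([(0,1),(0,4),(0,4),(1,2),(1,2),(2,3),(2,3),(3,4),(3,4)], Cut [1,2,3] [(125,[0,1,2,3,4]), (26,[0,4,3,2,1]), (26,[1,2,3,4,0]), (21,[3,2,1,0,4]), (22,[4,0,1,2,3]), (126,[0,1,2,3,4])]),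
   ([(0,1),(0,4),(0,4),(1,2),(1,2),(2,3),(3,4),(3,4)], Cut [1,2] [(127,[2,3,4,0,1]), (28,[2,1,0,4,3]), (29,[0,4,3,2,1]), (28,[1,2,3,4,0]), (127,[0,1,2,3,4]), (29,[3,4,0,1,2])]),
   ([(0,4),(0,4),(0,4),(1,2),(1,2),(1,2),(2,3),(2,3),(2,3),(2,3),(3,4),(3,4),(3,4),(3,4)], Wheel [(0,4,3),(0,3,2),(0,2,1),(0,4,3),(1,2,3),(2,3,4)] [3,0,1,2,4]),
   ([(0,4),(0,4),(0,4),(1,2),(1,2),(1,2),(2,3),(2,3),(2,3),(2,3),(3,4),(3,4),(3,4)], Cut [1,2,3] [(122,[3,2,1,0,4]), (56,[0,3,2,1,4]), (56,[1,3,4,0,2]), (101,[0,3,1,2,4]), (95,[4,0,1,2,3]), (129,[0,1,2,3,4])]),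
   ([(0,4),(0,4),(0,4),(1,2),(1,2),(1,2),(2,3),(2,3),(2,3),(2,3),(3,4),(3,4)], Cut [1,2,3] [(126,[1,0,4,3,2]), (62,[0,3,2,1,4]), (57,[1,3,4,0,2]), (103,[1,3,0,4,2]), (97,[4,0,1,2,3]), (130,[0,1,2,3,4])]),
   ([(0,4),(0,4),(0,4),(1,2),(1,2),(1,2),(2,3),(2,3),(2,3),(3,4),(3,4)], Cut [1,2] [(126,[1,0,4,3,2]), (99,[2,1,0,4,3]), (62,[0,3,2,1,4]), (57,[1,3,4,0,2]), (131,[0,1,2,3,4]), (103,[1,3,0,4,2])]),
   ([(0,4),(0,4),(0,4),(1,2),(1,2),(1,2),(2,3),(2,3),(3,4),(3,4)], Cut [1,2] [(127,[0,1,2,3,4]), (99,[2,1,0,4,3]), (62,[0,3,2,1,4]), (62,[1,3,4,0,2]), (132,[0,1,2,3,4]), (104,[0,3,1,2,4])]),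
   ([(0,4),(0,4),(0,4),(1,2),(1,2),(1,2),(2,3),(3,4),(3,4)], Cut [1,2] [(128,[0,1,2,3,4]), (121,[1,2,0,4,3]), (62,[0,3,2,1,4]), (68,[1,0,4,3,2]), (133,[0,1,2,3,4]), (107,[1,3,0,4,2])]),
   ([(0,4),(0,4),(1,2),(1,2),(1,2),(2,3),(3,4),(3,4)], Cut [0] [(128,[0,1,2,3,4]), (68,[1,0,4,3,2]), (100,[4,0,1,2,3]), (134,[0,1,2,3,4])]),
   ([(0,4),(0,4),(1,2),(1,2),(2,3),(3,4),(3,4)], Cut [1] [(128,[0,1,2,3,4]), (135,[0,1,2,3,4]), (121,[1,2,0,4,3]), (73,[0,1,2,3,4])]),
   ([(0,1),(0,4),(1,2),(1,2),(2,3),(3,4),(3,4)], Cut [0] [(128,[0,4,3,2,1]), (28,[1,2,3,4,0]), (28,[4,3,2,1,0]), (128,[0,1,2,3,4])]),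
   ([(0,4),(1,2),(1,2),(2,3),(3,4),(3,4)], Cut [0] [(137,[0,1,2,3,4]), (73,[1,0,4,3,2]), (118,[4,0,1,2,3]), (136,[0,1,2,3,4])]),
   ([(0,4),(0,4),(1,2),(2,3),(3,4),(3,4)], Cut [2] [(74,[1,0,4,3,2]), (136,[0,1,2,3,4]), (138,[1,0,4,3,2]), (119,[0,3,1,2,4])]),
   ([(0,4),(1,2),(2,3),(3,4),(3,4)], Cut [0,1] [(74,[1,0,4,3,2]), (119,[4,0,1,2,3]), (139,[0,1,2,3,4]), (138,[0,1,2,3,4]), (121,[1,2,0,4,3]), (74,[0,1,2,3,4])]),
   ([(0,4),(1,2),(2,3),(3,4)], Cut [3] [(121,[0,4,1,2,3]), (121,[1,2,0,4,3]), (140,[1,0,4,3,2]), (140,[0,1,2,3,4])]),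
   ([(0,4),(2,3),(3,4)], Cut [1] [(141,[1,2,3,4,0]), (141,[0,1,2,3,4]), (121,[1,2,0,4,3]), (121,[0,1,2,3,4])]),
   ([(0,4),(0,4),(0,4),(1,4),(1,4),(1,4),(2,4),(2,4),(2,4),(3,4),(3,4),(3,4)], Wheel [(0,4,1),(0,4,2),(1,4,3),(2,4,3)] [4,0,1,3,2]),
   ([(0,4),(0,4),(0,4),(1,4),(1,4),(1,4),(2,4),(2,4),(2,4),(3,4),(3,4)], Cut [3] [(79,[1,2,0,3,4]), (79,[0,2,1,3,4]), (79,[0,1,2,3,4]), (143,[0,1,2,3,4])]),
   ([(0,4),(0,4),(0,4),(1,4),(1,4),(1,4),(2,4),(2,4),(3,4),(3,4)], Cut [2] [(83,[3,1,0,2,4]), (83,[3,0,1,2,4]), (79,[0,1,2,3,4]), (144,[0,1,2,3,4])]),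
   ([(0,4),(0,4),(0,4),(1,4),(1,4),(2,4),(2,4),(3,4),(3,4)], Cut [1] [(86,[2,3,0,1,4]), (83,[3,0,1,2,4]), (83,[2,0,1,3,4]), (145,[0,1,2,3,4])]),
   ([(0,4),(0,4),(1,4),(1,4),(2,4),(2,4),(3,4),(3,4)], Cut [0] [(86,[2,3,0,1,4]), (86,[1,3,0,2,4]), (86,[1,2,0,3,4]), (146,[0,1,2,3,4])]),
   ([(0,4),(1,4),(1,4),(2,4),(2,4),(3,4),(3,4)], Cut [0] [(86,[2,3,0,1,4]), (86,[1,3,0,2,4]), (86,[1,2,0,3,4]), (147,[0,1,2,3,4])]),
   ([(0,4),(1,4),(2,4),(2,4),(3,4),(3,4)], Cut [1] [(93,[2,3,0,1,4]), (92,[3,0,1,2,4]), (92,[2,0,1,3,4]), (148,[0,1,2,3,4])]),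
   ([(0,4),(1,4),(2,4),(3,4),(3,4)], Cut [2] [(93,[3,1,0,2,4]), (93,[3,0,1,2,4]), (121,[0,1,2,3,4]), (149,[0,1,2,3,4])]),
   ([(0,4),(1,4),(3,4),(3,4)], Cut [2] [(119,[3,1,2,0,4]), (119,[3,0,2,1,4]), (121,[0,1,2,3,4]), (150,[0,1,2,3,4])]),
   ([(0,4),(1,4),(3,4)], Cut [3] [(142,[0,2,1,4,3]), (142,[0,2,1,3,4]), (121,[0,1,2,3,4]), (151,[0,1,2,3,4])]),
   ([(0,4),(3,4)], Cut [1,2] [(142,[1,2,3,4,0]), (142,[0,2,1,3,4]), (152,[0,1,2,3,4]), (142,[2,1,3,4,0]), (142,[0,1,2,3,4]), (152,[0,2,1,3,4])]),
   ([(0,4)], Cut [1,2,3] [(153,[1,2,3,4,0]), (153,[0,2,3,1,4]), (153,[2,1,3,4,0]), (153,[0,1,3,2,4]), (153,[3,1,2,4,0]), (153,[0,1,2,3,4])]),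
   ([], Cut [0] [(154,[0,2,3,4,1]), (154,[0,1,3,4,2]), (154,[0,1,2,4,3]), (154,[0,1,2,3,4])])]"

lemma cert5_check: "check [] cert5 \<and> cert5 \<noteq> [] \<and> fst (last cert5) = []"
  by code_simp

section \<open>Soundness of the certificates\<close>

lemma cnt_commute: "cnt es i j = cnt es j i"
  unfolding cnt_def by (rule arg_cong[of _ _ "\<lambda>P. length (filter P es)"]) auto

lemma norm_eq: "norm e = (i, j) \<or> norm e = (j, i) \<longleftrightarrow> e = (i, j) \<or> e = (j, i)"
  by (cases e) (auto simp: norm_def)

lemma cnt_Cons: "cnt (norm (a, b) # es) i j = cnt es i j + (if {i, j} = {a, b} then 1 else 0)"
  using norm_eq[of "(a, b)" i j] by (auto simp: cnt_def doubleton_eq_iff)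

lemma cnt_map_norm: "cnt (map (\<lambda>e. norm (h e)) es) = cnt (map h es)"
  by (intro ext) (simp add: cnt_def filter_map comp_def norm_eq)

lemma cnt_remove1: "x \<in> set ys \<Longrightarrow> cnt ys i j = cnt (x # remove1 x ys) i j"
proof (induction ys)
  case (Cons y ys)
  then show ?case by (cases "x = y") (simp_all add: cnt_def)
qed simp

lemma sublist_cnt: "sublist xs ys \<Longrightarrow> cnt xs i j \<le> cnt ys i j"
proof (induction xs arbitrary: ys)
  case (Cons x xs)
  have "x \<in> set ys" "sublist xs (remove1 x ys)" using Cons.prems by simp_all
  then have "cnt xs i j \<le> cnt (remove1 x ys) i j" using Cons.IH by blast
  then have "cnt (x # xs) i j \<le> cnt (x # remove1 x ys) i j" unfolding cnt_def by simp
  then show ?case unfolding cnt_remove1[OF \<open>x \<in> set ys\<close>] .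
qed (simp add: cnt_def)

lemma emb_sublist: "emb n f m ys \<Longrightarrow> sublist xs ys \<Longrightarrow> emb n f m xs"
  unfolding emb_def by (meson le_trans sublist_cnt)

lemma emb_pair: "emb n f m es \<Longrightarrow> norm (a, b) \<in> set es \<Longrightarrow> a < n \<Longrightarrow> b < n \<Longrightarrow> 1 \<le> m (f a) (f b)"
proof -
  assume a: "emb n f m es" "norm (a, b) \<in> set es" "a < n" "b < n"
  then have "1 \<le> cnt es a b" unfolding cnt_remove1[OF a(2)] cnt_Cons by simp
  moreover have "cnt es a b \<le> m (f a) (f b)" using a unfolding emb_def by blast
  ultimately show ?thesis by (rule le_trans)
qed

lemma emb_image_pair:
  assumes "emb n f m es" "i < n" "j < n" "a < n" "b < n"
  shows "{f i, f j} = {f a, f b} \<longleftrightarrow> {i, j} = {a, b}"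
  using assms unfolding emb_def inj_on_def doubleton_eq_iff by (metis lessThan_iff)

lemma emb_add1:
  assumes "emb n f m es" "a < n" "b < n"
  shows "emb n f (add1 m (f a) (f b)) (norm (a, b) # es)"
  using assms emb_image_pair[OF assms(1) _ _ assms(2,3)] by (simp add: emb_def add1_def cnt_Cons)

lemma emb_sub1:
  assumes "emb n f m es" "a < n" "b < n" "norm (a, b) \<in> set es"
  shows "emb n f (sub1 m (f a) (f b)) (remove1 (norm (a, b)) es)"
proof -
  have le: "cnt (remove1 (norm (a, b)) es) i j + (if {i, j} = {a, b} then 1 else 0) \<le> m (f i) (f j)"
    if "i < n" "j < n" for i j
  proof -
    have "cnt es i j \<le> m (f i) (f j)" using assms(1) that unfolding emb_def by blast
    then show ?thesis using cnt_remove1[OF assms(4), of i j] unfolding cnt_Cons by linarith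
  qed
  have "cnt (remove1 (norm (a, b)) es) i j \<le> sub1 m (f a) (f b) (f i) (f j)" if "i < n" "j < n" for i j
    using le[OF that] unfolding sub1_def emb_image_pair[OF assms(1) that assms(2,3)]
    by (simp split: if_splits)
  then show ?thesis using assms(1) unfolding emb_def by blast
qed

text \<open>Every splitting of the list is mirrored in \<open>m\<close>, and the list stays below
  the multiplicities throughout, until it contains a wheel.\<close>

lemma splits_wheeled:
  assumes "emb n f m es" "splits ts es = Some es'" "sublist (wheel_edges w) es'"
    "list_all (\<lambda>(x, y, z). x < n \<and> y < n \<and> z < n \<and> x \<noteq> y \<and> y \<noteq> z) ts"
    "distinct w" "length w = 5" "list_all (\<lambda>i. i < n) w"
  shows "wheeled m"
  using assms
proof (induction ts arbitrary: m es)
  case Nil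
  then have e: "emb n f m (wheel_edges w)" using emb_sublist by simp
  obtain h a b c d where w: "w = [h, a, b, c, d]"
    using Nil.prems(6) by (auto simp: length_Suc_conv eval_nat_numeral)
  have lt: "h < n" "a < n" "b < n" "c < n" "d < n" using Nil.prems(7) unfolding w by simp_all
  have dist: "distinct [f h, f a, f b, f c, f d]"
    using e Nil.prems(5) lt unfolding emb_def w inj_on_def by fastforce
  have p: "1 \<le> m (f i) (f j)" if "norm (i, j) \<in> set (wheel_edges w)" "i < n" "j < n" for i j
    using emb_pair[OF e] that by blast
  show ?case
    by (rule wheeled.wheel[OF dist]; rule p) (simp_all add: lt wheel_edges_def w)
next
  case (Cons t ts)
  obtain x y z where t: "t = (x, y, z)" by (cases t)
  have lt: "x < n" "y < n" "z < n" "x \<noteq> y" "y \<noteq> z" using Cons.prems(4) unfolding t by simp_all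
  have s: "x \<noteq> z" "norm (x, y) \<in> set es" "norm (y, z) \<in> set (remove1 (norm (x, y)) es)"
    and r: "splits ts (norm (x, z) # remove1 (norm (y, z)) (remove1 (norm (x, y)) es)) = Some es'"
    using Cons.prems(2) unfolding t by (auto split: if_splits)
  have "emb n f (split m (f x) (f y) (f z)) (norm (x, z) # remove1 (norm (y, z)) (remove1 (norm (x, y)) es))"
    unfolding split_def
    by (rule emb_add1[OF emb_sub1[OF emb_sub1[OF Cons.prems(1) lt(1,2) s(2)] lt(2,3) s(3)] lt(1,3)])
  then have "wheeled (split m (f x) (f y) (f z))"
    using Cons.IH r Cons.prems(3-7) by simp
  moreover have "distinct [f x, f y, f z]"
    using Cons.prems(1) lt s(1) unfolding emb_def inj_on_def by fastforce
  moreover have "1 \<le> m (f x) (f y)" using emb_pair[OF Cons.prems(1) s(2) lt(1,2)] .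
  moreover have "1 \<le> m (f y) (f z)"
    using emb_pair[OF Cons.prems(1) _ lt(2,3)] s(3) notin_set_remove1 by metis
  ultimately show ?case using wheeled.split by metis
qed

lemma check_wheel_sound: "check_wheel n ts w es \<Longrightarrow> emb n f m es \<Longrightarrow> wheeled m"
  unfolding check_wheel_def by (auto split: option.splits intro: splits_wheeled)

text \<open>The type argument fixes the type of the vertices, which the list does not
  determine.\<close>

definition good :: "'a itself \<Rightarrow> elist \<Rightarrow> bool" where
  "good _ es \<longleftrightarrow> (\<forall>(f :: nat \<Rightarrow> 'a) m. emb 5 f m es \<longrightarrow> conn (f ` {..<5}) m \<longrightarrow>
     wheeled m \<or> chain3 (f ` {..<5}) m \<or> star5 (f ` {..<5}) m)"

lemma cnt_map:
  assumes "i < n" "j < n"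
  shows "cnt es i j \<le> cnt (map (\<lambda>(a, b). (p a, p b)) es) (p i) (p j)"
  unfolding cnt_def by (induction es) auto

text \<open>A surplus of \<open>m\<close> at the pair means that the list extended by this edge is
  still below \<open>m\<close>; composing \<open>f\<close> with the permutation then places an
  earlier good list below \<open>m\<close>, on the same vertex set.\<close>

lemma kid_ok_sound:
  fixes f :: "nat \<Rightarrow> 'a"
  assumes "kid_ok prev es k (a, b)" "\<And>g. g \<in> set prev \<Longrightarrow> good TYPE('a) g"
    "emb 5 f m es" "a < 5" "b < 5" "a \<noteq> b" "\<And>x y. m x y = m y x" "cnt es a b < m (f a) (f b)"
    "conn (f ` {..<5}) m"
  shows "wheeled m \<or> chain3 (f ` {..<5}) m \<or> star5 (f ` {..<5}) m"
proof -
  obtain i p where k: "k = (i, p)" by (cases k)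
  have c: "i < length prev" "distinct p" "length p = 5" "list_all (\<lambda>i. i < 5) p"
    "sublist (map (\<lambda>(a, b). norm (p ! a, p ! b)) (prev ! i)) (norm (a, b) # es)"
    using assms(1) unfolding kid_ok_def k by simp_all
  have "cnt es j l + (if {j, l} = {a, b} then 1 else 0) \<le> m (f j) (f l)" if "j < 5" "l < 5" for j l
    using assms(3,8) that assms(7)[of "f a" "f b"] cnt_commute[of es a b]
    unfolding emb_def by (auto simp: doubleton_eq_iff Suc_le_eq)
  then have "emb 5 f m (norm (a, b) # es)" using assms(3) unfolding emb_def by (simp add: cnt_Cons)
  then have e1: "emb 5 f m (map (\<lambda>(a, b). norm (p ! a, p ! b)) (prev ! i))"
    using c(5) emb_sublist by blast
  have pi: "p ! j < 5" if "j < 5" for j using c(3,4) that by (auto simp: list_all_length)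
  have inj: "inj_on ((!) p) {..<5}" using c(2,3) by (auto simp: inj_on_def nth_eq_iff_index_eq)
  then have im: "(!) p ` {..<5} = {..<5}" using pi by (intro endo_inj_surj) auto
  have "emb 5 (\<lambda>i. f (p ! i)) m (prev ! i)"
    unfolding emb_def
  proof (intro conjI allI impI)
    have "inj_on (f \<circ> (!) p) {..<5}"
      using inj im assms(3) unfolding emb_def by (intro comp_inj_on) auto
    then show "inj_on (\<lambda>i. f (p ! i)) {..<5}" by (simp add: comp_def)
    fix j l :: nat assume jl: "j < 5" "l < 5"
    have "cnt (prev ! i) j l \<le> cnt (map (\<lambda>(a, b). (p ! a, p ! b)) (prev ! i)) (p ! j) (p ! l)"
      by (rule cnt_map[OF jl])
    also have "\<dots> = cnt (map (\<lambda>(a, b). norm (p ! a, p ! b)) (prev ! i)) (p ! j) (p ! l)"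
      using cnt_map_norm[of "\<lambda>(a, b). (p ! a, p ! b)" "prev ! i"] by (simp add: case_prod_unfold)
    also have "\<dots> \<le> m (f (p ! j)) (f (p ! l))"
      using e1 pi[OF jl(1)] pi[OF jl(2)] unfolding emb_def by blast
    finally show "cnt (prev ! i) j l \<le> m (f (p ! j)) (f (p ! l))" .
  qed
  moreover have img: "(\<lambda>i. f (p ! i)) ` {..<5} = f ` {..<5}"
    using image_image[of f "(!) p" "{..<5}"] unfolding im by simp
  moreover have "good TYPE('a) (prev ! i)" using assms(2) c(1) by simp
  ultimately show ?thesis using assms(9) unfolding good_def by (metis (no_types, lifting))
qed

lemma list_all2_exists: "list_all2 P ks es \<Longrightarrow> e \<in> set es \<Longrightarrow> \<exists>k. P k e"
  by (auto simp: list_all2_conv_all_nth in_set_conv_nth)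

lemma set_pairs5: "set pairs5 = {(i, j). i < j \<and> j < 5}"
  unfolding pairs5_def by (auto simp: less_Suc_eq numeral_nat)

lemma lessThan_5: "{..<5} = {0, 1, 2, 3, 4 :: nat}"
proof -
  have "{..<5::nat} = set [0..<5]" by (simp add: atLeast_upt)
  also have "[0..<5] = [0, 1, 2, 3, 4]" by (simp add: upt_rec)
  finally show ?thesis by (simp only: list.set)
qed

lemma check_rule_sound:
  assumes "check_rule prev es r" "\<And>g. g \<in> set prev \<Longrightarrow> good TYPE('a) g"
  shows "good TYPE('a) es"
  unfolding good_def
proof (intro allI impI)
  fix f :: "nat \<Rightarrow> 'a" and m
  let ?V = "f ` {..<5}"
  assume e: "emb 5 f m es" and R: "conn ?V m"
  have mg: "mg ?V m" using R unfolding conn_def by simp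
  note sym = mgD(2)[OF mg]
  have inj: "inj_on f {..<5}" using e unfolding emb_def by simp
  have low: "cnt es i j \<le> m (f i) (f j)" if "i < 5" "j < 5" for i j
    using e that unfolding emb_def by blast
  have kid: "wheeled m \<or> chain3 ?V m \<or> star5 ?V m"
    if "kid_ok prev es k (a, b)" "a < 5" "b < 5" "a \<noteq> b" "cnt es a b < m (f a) (f b)" for k a b
    using kid_ok_sound[OF that(1) _ e that(2-4) sym that(5) R] assms(2) by blast
  have degf: "deg ?V m (f i) = (\<Sum>j<5. m (f i) (f j))" for i
    unfolding deg_def by (simp add: sum.reindex[OF inj])
  have tot: "sum_list (map (cnt es i) [0,1,2,3,4]) = (\<Sum>j<5. cnt es i j)" for i
    by (simp add: lessThan_5)
  show "wheeled m \<or> chain3 ?V m \<or> star5 ?V m"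
  proof (cases r)
    case (Wheel ts w)
    then show ?thesis using assms(1) check_wheel_sound[OF _ e] by simp
  next
    case (Cut X ks)
    define Y where "Y = filter (\<lambda>i. i \<notin> set X) [0,1,2,3,4]"
    have c: "distinct X" "X \<noteq> []" "Y \<noteq> []" "list_all (\<lambda>i. i < 5) X"
      "sum_list (map (\<lambda>(i, j). cnt es i j) (List.product X Y)) < (if length X = 1 \<or> length Y = 1 then 3 else 4)"
      "list_all2 (kid_ok prev es) ks (List.product X Y)"
      using assms(1) unfolding Cut check_rule.simps Let_def Y_def[symmetric] by blast+
    have "set Y = {..<5} - set X" unfolding Y_def set_filter lessThan_5 list.set by blast
    moreover have "distinct Y" unfolding Y_def by (rule distinct_filter) simp
    ultimately have Y: "distinct Y" "set Y = {..<5} - set X" by blast+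
    have X: "set X \<subseteq> {..<5}" using c(4) by (auto simp: list_all_iff)
    show ?thesis
    proof (cases "\<exists>i\<in>set X. \<exists>j\<in>set Y. cnt es i j < m (f i) (f j)")
      case True
      then obtain i j where ij: "i \<in> set X" "j \<in> set Y" "cnt es i j < m (f i) (f j)" by blast
      then have "(i, j) \<in> set (List.product X Y)" by simp
      then obtain k where k: "kid_ok prev es k (i, j)" using list_all2_exists[OF c(6)] by blast
      show ?thesis by (rule kid[OF k _ _ _ ij(3)]) (use ij X Y in auto)
    next
      case False
      \<comment> \<open>No pair across the cut has a surplus, so the cut of \<open>m\<close> is at
        most that of the list, against \<open>conn\<close>.\<close>
      have inX: "inj_on f (set X)" and inY: "inj_on f (set Y)"
        using inj X Y by (auto intro: inj_on_subset)
      have part: "?V - f ` set X = f ` set Y"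
        using inj X Y(2) by (auto simp: inj_on_def)
      have "cut ?V m (f ` set X) = (\<Sum>i\<in>set X. \<Sum>j\<in>set Y. m (f i) (f j))"
        unfolding cut_def part ew_def by (simp add: sum.reindex[OF inX] sum.reindex[OF inY])
      also have "\<dots> \<le> (\<Sum>i\<in>set X. \<Sum>j\<in>set Y. cnt es i j)"
        using False by (intro sum_mono) (simp add: not_less)
      also have "\<dots> = (\<Sum>(i, j)\<in>set X \<times> set Y. cnt es i j)" by (simp add: sum.cartesian_product)
      also have "\<dots> = sum_list (map (\<lambda>(i, j). cnt es i j) (List.product X Y))"
        unfolding sum_list_distinct_conv_sum_set[OF distinct_product[OF c(1) Y(1)]] by simp
      finally have le: "cut ?V m (f ` set X) < (if length X = 1 \<or> length Y = 1 then 3 else 4)"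
        using c(5) by (rule le_less_trans)
      have card: "card (f ` set X) = length X" "card (f ` set Y) = length Y"
        using c(1) Y(1) by (simp_all add: card_image inX inY distinct_card)
      have "f ` set X \<subseteq> ?V" "f ` set X \<noteq> {}" "f ` set X \<noteq> ?V"
        using X c(2,3) part by auto
      then have "4 \<le> cut ?V m (f ` set X) \<or>
          cut ?V m (f ` set X) = 3 \<and> (length X = 1 \<or> length Y = 1)"
        using R unfolding conn_def part[symmetric] card[symmetric] by blast
      then show ?thesis using le by (auto split: if_splits)
    qed
  next
    case (Chain x y z ks)
    note A = assms(1)[unfolded Chain check_rule.simps]
    have c: "x < 5" "y < 5" "z < 5" "x \<noteq> z" "cnt es x y = 2" "cnt es y z = 2" "cnt es x z = 0"
      and d': "list_all (\<lambda>i. sum_list (map (cnt es i) [0,1,2,3,4]) = 4) [x, y, z]"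
      and ks: "list_all2 (kid_ok prev es) ks
        (filter (\<lambda>(i, j). i = x \<or> i = y \<or> i = z \<or> j = x \<or> j = y \<or> j = z) pairs5)"
      using A by blast+
    have d: "(\<Sum>j<5. cnt es i j) = 4" if "i \<in> {x, y, z}" for i
      using d' that unfolding tot list_all_iff list.set by blast
    show ?thesis
    proof (cases "\<exists>i\<in>{x, y, z}. \<exists>j<5. cnt es i j < m (f i) (f j)")
      case True
      then obtain i j where ij: "i \<in> {x, y, z}" "j < 5" "cnt es i j < m (f i) (f j)" by blast
      have "i \<noteq> j" using ij(3) mgD(3)[OF mg] by auto
      define a b where "a = min i j" and "b = max i j"
      have ab: "a < b" "b < 5" "cnt es a b < m (f a) (f b)" "i \<in> {a, b}"
        using \<open>i \<noteq> j\<close> ij c(1-3) sym[of "f i" "f j"] cnt_commute[of es i j] unfolding a_def b_def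
        by (auto simp: min_def max_def)
      have "(a, b) \<in> set (filter (\<lambda>(i, j). i = x \<or> i = y \<or> i = z \<or> j = x \<or> j = y \<or> j = z) pairs5)"
        using ab ij(1) by (auto simp: set_pairs5)
      then obtain k where k: "kid_ok prev es k (a, b)" using list_all2_exists[OF ks] by blast
      show ?thesis by (rule kid[OF k _ _ _ ab(3)]) (use ab in auto)
    next
      case False
      \<comment> \<open>Without a surplus at \<open>x\<close>, \<open>y\<close>, \<open>z\<close>
        the multiplicities there are the counts in the list, so its chain is one of
        \<open>m\<close>.\<close>
      have eq: "m (f i) (f j) = cnt es i j" if "i \<in> {x, y, z}" "j < 5" for i j
      proof (rule le_antisym)
        show "m (f i) (f j) \<le> cnt es i j" using False that by (meson not_less)
        show "cnt es i j \<le> m (f i) (f j)" using low that c(1-3) by blast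
      qed
      have "deg ?V m (f i) = 4" if "i \<in> {x, y, z}" for i
        using d[OF that] eq[OF that] by (simp add: degf)
      moreover have "f x \<noteq> f z" using inj c unfolding inj_on_def by auto
      moreover have "m (f x) (f y) = 2" "m (f y) (f z) = 2" "m (f x) (f z) = 0" using eq c by auto
      moreover have "{f x, f y, f z} \<subseteq> ?V" using c(1-3) by blast
      ultimately have "chain3 ?V m" unfolding chain3_def by blast
      then show ?thesis by blast
    qed
  next
    case (Star v b x y z ks)
    have c: "distinct [v, b, x, y, z]" "v < 5" "b < 5" "x < 5" "y < 5" "z < 5"
      and d: "cnt es v x = 2" "cnt es v y = 2" "cnt es v z = 2" "cnt es b x = 1 \<or> cnt es b x = 2"
        "cnt es b y = 1" "cnt es b z = 1" "cnt es v b = 0" "cnt es x y = 0" "cnt es x z = 0" "cnt es y z = 0"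
      and ks: "list_all2 (kid_ok prev es) ks pairs5"
      using assms(1)[unfolded Star check_rule.simps list.pred_inject] by blast+
    show ?thesis
    proof (cases "\<exists>i<5. \<exists>j<5. cnt es i j < m (f i) (f j)")
      case True
      then obtain i j where ij: "i < 5" "j < 5" "cnt es i j < m (f i) (f j)" by blast
      have "i \<noteq> j" using ij(3) mgD(3)[OF mg] by auto
      define a b where "a = min i j" and "b = max i j"
      have ab: "a < b" "b < 5" "cnt es a b < m (f a) (f b)"
        using \<open>i \<noteq> j\<close> ij sym[of "f i" "f j"] cnt_commute[of es i j] unfolding a_def b_def
        by (auto simp: min_def max_def)
      then have "(a, b) \<in> set pairs5" by (auto simp: set_pairs5)
      then obtain k where k: "kid_ok prev es k (a, b)" using list_all2_exists[OF ks] by blast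
      show ?thesis by (rule kid[OF k _ _ _ ab(3)]) (use ab in auto)
    next
      case False
      then have eq: "m (f i) (f j) = cnt es i j" if "i < 5" "j < 5" for i j
        using that low[of i j] by (meson le_antisym not_less)
      have "inj_on f (set [v, b, x, y, z])" by (rule inj_on_subset[OF inj]) (use c in auto)
      then have "distinct [f v, f b, f x, f y, f z]"
        using c(1) distinct_map[of f "[v, b, x, y, z]"] by simp
      moreover have "set [v, b, x, y, z] = {..<5}"
        by (rule card_subset_eq) (use c(2-6) distinct_card[OF c(1)] in simp_all)
      then have "?V = f ` {v, b, x, y, z}" by simp
      then have "?V = {f v, f b, f x, f y, f z}" unfolding image_insert image_empty .
      moreover have "m (f v) (f x) = 2" "m (f v) (f y) = 2" "m (f v) (f z) = 2"
        "m (f b) (f x) = 1 \<or> m (f b) (f x) = 2" "m (f b) (f y) = 1" "m (f b) (f z) = 1"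
        "m (f v) (f b) = 0" "m (f x) (f y) = 0" "m (f x) (f z) = 0" "m (f y) (f z) = 0"
        unfolding eq[OF c(2) c(4)] eq[OF c(2) c(5)] eq[OF c(2) c(6)] eq[OF c(3) c(4)] eq[OF c(3) c(5)]
          eq[OF c(3) c(6)] eq[OF c(2) c(3)] eq[OF c(4) c(5)] eq[OF c(4) c(6)] eq[OF c(5) c(6)]
        by (rule d)+
      ultimately have "star5 ?V m" unfolding star5_def by blast
      then show ?thesis by blast
    qed
  qed
qed

lemma check_sound:
  assumes "check prev cs" "\<And>g. g \<in> set prev \<Longrightarrow> good TYPE('a) g" "c \<in> set cs"
  shows "good TYPE('a) (fst c)"
  using assms
proof (induction cs arbitrary: prev)
  case (Cons c' cs)
  have g: "good TYPE('a) (fst c')" 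
    by (rule check_rule_sound[of prev _ "snd c'"]) (use Cons.prems(1,2) in auto)
  then have "\<And>g. g \<in> set (prev @ [fst c']) \<Longrightarrow> good TYPE('a) g" using Cons.prems(2) by auto
  then show ?case using Cons.IH[of "prev @ [fst c']"] Cons.prems(1,3) g by auto
qed simp

text \<open>The empty list, last in the certificate, lies below every \<open>m\<close>, so that it
  is good is the claim.\<close>

theorem five_vertices:
  fixes V :: "'a set"
  assumes "conn V m" "card V = 5"
  shows "wheeled m \<or> chain3 V m \<or> star5 V m"
proof -
  have "finite V" using assms(2) by (metis card.infinite zero_neq_numeral)
  then obtain f :: "nat \<Rightarrow> 'a" where f: "bij_betw f {..<5} V"
    using ex_bij_betw_nat_finite[of V] unfolding assms(2) atLeast0LessThan by blast
  have g: "good TYPE('a) []"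
    using check_sound[of "[]" cert5 "last cert5", where 'a = 'a] cert5_check by simp
  have "emb 5 f m []" using f unfolding emb_def bij_betw_def cnt_def by simp
  moreover have "f ` {..<5} = V" using f unfolding bij_betw_def by simp
  ultimately show ?thesis using g assms(1) unfolding good_def by blast
qed

text \<open>Pairs outside \<open>es\<close> have count 0, so only the entries of the list have to be
  compared.\<close>

lemma wheeled_cert:
  assumes "\<And>p q. m p q = m q p" "distinct vs"
    "list_all (\<lambda>(i, j). cnt es i j \<le> m (vs ! i) (vs ! j)) es" "check_wheel (length vs) ts w es"
  shows "wheeled m"
proof -
  have "cnt es i j \<le> m (vs ! i) (vs ! j)" if "i < length vs" "j < length vs" for i j
  proof (cases "(i, j) \<in> set es \<or> (j, i) \<in> set es")
    case True
    then show ?thesis using assms(1)[of "vs ! i"] assms(3) cnt_commute[of es i j] by (auto simp: list_all_iff)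
  next
    case False
    then have "cnt es i j = 0" unfolding cnt_def by (auto simp: filter_empty_conv)
    then show ?thesis by simp
  qed
  then have "emb (length vs) ((!) vs) m es"
    using assms(2) unfolding emb_def by (auto simp: inj_on_def nth_eq_iff_index_eq)
  then show ?thesis using check_wheel_sound assms(4) by blast
qed

section \<open>Six-vertex expansions of the exceptional graphs that contain a wheel\<close>

text \<open>The letters tell how a sixth vertex \<open>w\<close> is attached to a graph of type
  \<open>star5\<close>: by a double edge to \<open>v\<close> (\<open>A\<close>), \<open>b\<close>
  (\<open>B\<close>) or \<open>x\<close> (\<open>X\<close>), or by a triple edge (\<open>T\<close>),
  so that contracting this edge restores the star; in \<open>E\<close> it subdivides an edge of the
  star and has a further neighbour.\<close>

lemma wheeled_six_A1:
  assumes "\<And>p q. m p q = m q p" "distinct [v, b, x, y, z, w]"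
    "1 \<le> m v x" "2 \<le> m v y" "2 \<le> m v z" "2 \<le> m v w" "1 \<le> m b x" "1 \<le> m b y" "1 \<le> m b z" "1 \<le> m x w"
  shows "wheeled m"
  by (rule wheeled_cert[where vs = "[v, b, x, y, z, w]" and es = "[(0, 2), (0, 3), (0, 3), (0, 4), (0, 4), (0, 5), (0, 5), (1, 2), (1, 3), (1, 4), (2, 5)]"
        and ts = "[(0, 3, 1), (4, 0, 5)]" and w = "[0, 1, 2, 5, 4]", OF assms(1,2)])
    (use assms(3-) in \<open>simp add: list_all_iff cnt_def\<close>, code_simp)

lemma wheeled_six_A2:
  assumes "\<And>p q. m p q = m q p" "distinct [v, b, x, y, z, w]"
    "1 \<le> m v x" "1 \<le> m v y" "2 \<le> m v z" "2 \<le> m v w" "1 \<le> m b x" "1 \<le> m b y" "1 \<le> m b z" "1 \<le> m x w" "1 \<le> m y w"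
  shows "wheeled m"
  by (rule wheeled_cert[where vs = "[v, b, x, y, z, w]" and es = "[(0, 2), (0, 3), (0, 4), (0, 4), (0, 5), (0, 5), (1, 2), (1, 3), (1, 4), (2, 5), (3, 5)]"
        and ts = "[(0, 4, 1)]" and w = "[0, 1, 2, 5, 3]", OF assms(1,2)])
    (use assms(3-) in \<open>simp add: list_all_iff cnt_def\<close>, code_simp)

lemma wheeled_six_B1:
  assumes "\<And>p q. m p q = m q p" "distinct [v, b, x, y, z, w]"
    "2 \<le> m v x" "2 \<le> m v y" "2 \<le> m v z" "1 \<le> m b x" "1 \<le> m b y" "1 \<le> m b z" "2 \<le> m b w" "1 \<le> m x w"
  shows "wheeled m"
  by (rule wheeled_cert[where vs = "[v, b, x, y, z, w]" and es = "[(0, 2), (0, 2), (0, 3), (0, 3), (0, 4), (0, 4), (1, 2), (1, 3), (1, 4), (1, 5), (1, 5), (2, 5)]"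
        and ts = "[(0, 3, 1), (0, 1, 5), (2, 0, 4)]" and w = "[2, 0, 4, 1, 5]", OF assms(1,2)])
    (use assms(3-) in \<open>simp add: list_all_iff cnt_def\<close>, code_simp)

lemma wheeled_six_B2:
  assumes "\<And>p q. m p q = m q p" "distinct [v, b, x, y, z, w]"
    "2 \<le> m v x" "2 \<le> m v y" "2 \<le> m v z" "2 \<le> m b x" "1 \<le> m b z" "2 \<le> m b w" "1 \<le> m y w"
  shows "wheeled m"
  by (rule wheeled_cert[where vs = "[v, b, x, y, z, w]" and es = "[(0, 2), (0, 2), (0, 3), (0, 3), (0, 4), (0, 4), (1, 2), (1, 2), (1, 4), (1, 5), (1, 5), (3, 5)]"
        and ts = "[(0, 3, 5), (2, 0, 4), (2, 1, 5)]" and w = "[2, 0, 4, 1, 5]", OF assms(1,2)])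
    (use assms(3-) in \<open>simp add: list_all_iff cnt_def\<close>, code_simp)

lemma wheeled_six_B3:
  assumes "\<And>p q. m p q = m q p" "distinct [v, b, x, y, z, w]"
    "2 \<le> m v x" "2 \<le> m v y" "2 \<le> m v z" "1 \<le> m b x" "1 \<le> m b z" "2 \<le> m b w" "1 \<le> m x w" "1 \<le> m y w"
  shows "wheeled m"
  by (rule wheeled_cert[where vs = "[v, b, x, y, z, w]" and es = "[(0, 2), (0, 2), (0, 3), (0, 3), (0, 4), (0, 4), (1, 2), (1, 4), (1, 5), (1, 5), (2, 5), (3, 5)]"
        and ts = "[(0, 3, 5), (2, 0, 4)]" and w = "[2, 0, 4, 1, 5]", OF assms(1,2)])
    (use assms(3-) in \<open>simp add: list_all_iff cnt_def\<close>, code_simp)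

lemma wheeled_six_X1:
  assumes "\<And>p q. m p q = m q p" "distinct [v, b, x, y, z, w]"
    "1 \<le> m v x" "2 \<le> m v y" "2 \<le> m v z" "1 \<le> m v w" "2 \<le> m b x" "1 \<le> m b y" "1 \<le> m b z" "2 \<le> m x w"
  shows "wheeled m"
  by (rule wheeled_cert[where vs = "[v, b, x, y, z, w]" and es = "[(0, 2), (0, 3), (0, 3), (0, 4), (0, 4), (0, 5), (1, 2), (1, 2), (1, 3), (1, 4), (2, 5), (2, 5)]"
        and ts = "[(0, 3, 1), (1, 2, 5), (2, 0, 4)]" and w = "[1, 0, 4, 2, 5]", OF assms(1,2)])
    (use assms(3-) in \<open>simp add: list_all_iff cnt_def\<close>, code_simp)

lemma wheeled_six_X2:
  assumes "\<And>p q. m p q = m q p" "distinct [v, b, x, y, z, w]"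
    "2 \<le> m v x" "2 \<le> m v y" "2 \<le> m v z" "1 \<le> m b x" "1 \<le> m b y" "1 \<le> m b z" "1 \<le> m b w" "2 \<le> m x w"
  shows "wheeled m"
  by (rule wheeled_cert[where vs = "[v, b, x, y, z, w]" and es = "[(0, 2), (0, 2), (0, 3), (0, 3), (0, 4), (0, 4), (1, 2), (1, 3), (1, 4), (1, 5), (2, 5), (2, 5)]"
        and ts = "[(0, 2, 5), (0, 3, 1), (2, 0, 4)]" and w = "[1, 0, 4, 2, 5]", OF assms(1,2)])
    (use assms(3-) in \<open>simp add: list_all_iff cnt_def\<close>, code_simp)

lemma wheeled_six_X3:
  assumes "\<And>p q. m p q = m q p" "distinct [v, b, x, y, z, w]"
    "1 \<le> m v x" "2 \<le> m v y" "2 \<le> m v z" "1 \<le> m v w" "1 \<le> m b x" "1 \<le> m b y" "1 \<le> m b z" "1 \<le> m b w" "2 \<le> m x w"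
  shows "wheeled m"
  by (rule wheeled_cert[where vs = "[v, b, x, y, z, w]" and es = "[(0, 2), (0, 3), (0, 3), (0, 4), (0, 4), (0, 5), (1, 2), (1, 3), (1, 4), (1, 5), (2, 5), (2, 5)]"
        and ts = "[(0, 3, 1), (2, 0, 4)]" and w = "[1, 0, 4, 2, 5]", OF assms(1,2)])
    (use assms(3-) in \<open>simp add: list_all_iff cnt_def\<close>, code_simp)

lemma wheeled_six_Tv:
  assumes "\<And>p q. m p q = m q p" "distinct [v, b, x, y, z, w]"
    "2 \<le> m v x" "2 \<le> m v y" "2 \<le> m v z" "3 \<le> m v w" "1 \<le> m b x" "1 \<le> m b y" "1 \<le> m b z"
  shows "wheeled m"
  by (rule wheeled_cert[where vs = "[v, b, x, y, z, w]" and es = "[(0, 2), (0, 2), (0, 3), (0, 3), (0, 4), (0, 4), (0, 5), (0, 5), (0, 5), (1, 2), (1, 3), (1, 4)]"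
        and ts = "[(0, 2, 1), (3, 0, 5), (4, 0, 5)]" and w = "[0, 1, 3, 5, 4]", OF assms(1,2)])
    (use assms(3-) in \<open>simp add: list_all_iff cnt_def\<close>, code_simp)

lemma wheeled_six_Tb:
  assumes "\<And>p q. m p q = m q p" "distinct [v, b, x, y, z, w]"
    "2 \<le> m v x" "2 \<le> m v y" "2 \<le> m v z" "2 \<le> m b x" "1 \<le> m b y" "1 \<le> m b z" "3 \<le> m b w"
  shows "wheeled m"
  by (rule wheeled_cert[where vs = "[v, b, x, y, z, w]" and es = "[(0, 2), (0, 2), (0, 3), (0, 3), (0, 4), (0, 4), (1, 2), (1, 2), (1, 3), (1, 4), (1, 5), (1, 5), (1, 5)]"
        and ts = "[(0, 3, 1), (0, 1, 5), (2, 0, 4), (2, 1, 5)]" and w = "[2, 0, 4, 1, 5]", OF assms(1,2)])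
    (use assms(3-) in \<open>simp add: list_all_iff cnt_def\<close>, code_simp)

lemma wheeled_six_Tx:
  assumes "\<And>p q. m p q = m q p" "distinct [v, b, x, y, z, w]"
    "2 \<le> m v x" "2 \<le> m v y" "2 \<le> m v z" "2 \<le> m b x" "1 \<le> m b y" "1 \<le> m b z" "3 \<le> m x w"
  shows "wheeled m"
  by (rule wheeled_cert[where vs = "[v, b, x, y, z, w]" and es = "[(0, 2), (0, 2), (0, 3), (0, 3), (0, 4), (0, 4), (1, 2), (1, 2), (1, 3), (1, 4), (2, 5), (2, 5), (2, 5)]"
        and ts = "[(0, 2, 5), (0, 3, 1), (1, 2, 5), (2, 0, 4)]" and w = "[1, 0, 4, 2, 5]", OF assms(1,2)])
    (use assms(3-) in \<open>simp add: list_all_iff cnt_def\<close>, code_simp)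

lemma wheeled_six_E1:
  assumes "\<And>p q. m p q = m q p" "distinct [v, b, x, y, z, w]"
    "1 \<le> m v x" "2 \<le> m v y" "2 \<le> m v z" "1 \<le> m v w" "1 \<le> m b x" "1 \<le> m b y" "1 \<le> m b z" "1 \<le> m b w" "1 \<le> m x w"
  shows "wheeled m"
  by (rule wheeled_cert[where vs = "[v, b, x, y, z, w]" and es = "[(0, 2), (0, 3), (0, 3), (0, 4), (0, 4), (0, 5), (1, 2), (1, 3), (1, 4), (1, 5), (2, 5)]"
        and ts = "[(0, 3, 1), (2, 0, 4)]" and w = "[1, 0, 4, 2, 5]", OF assms(1,2)])
    (use assms(3-) in \<open>simp add: list_all_iff cnt_def\<close>, code_simp)

lemma wheeled_six_E2:
  assumes "\<And>p q. m p q = m q p" "distinct [v, b, x, y, z, w]"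
    "1 \<le> m v x" "2 \<le> m v y" "2 \<le> m v z" "1 \<le> m v w" "1 \<le> m b x" "1 \<le> m b y" "1 \<le> m b z" "1 \<le> m x w" "1 \<le> m y w"
  shows "wheeled m"
  by (rule wheeled_cert[where vs = "[v, b, x, y, z, w]" and es = "[(0, 2), (0, 3), (0, 3), (0, 4), (0, 4), (0, 5), (1, 2), (1, 3), (1, 4), (2, 5), (3, 5)]"
        and ts = "[(0, 4, 1)]" and w = "[0, 1, 2, 5, 3]", OF assms(1,2)])
    (use assms(3-) in \<open>simp add: list_all_iff cnt_def\<close>, code_simp)

lemma wheeled_six_E3:
  assumes "\<And>p q. m p q = m q p" "distinct [v, b, x, y, z, w]"
    "2 \<le> m v x" "2 \<le> m v y" "2 \<le> m v z" "1 \<le> m v w" "1 \<le> m b y" "1 \<le> m b z" "1 \<le> m b w" "1 \<le> m x w"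
  shows "wheeled m"
  by (rule wheeled_cert[where vs = "[v, b, x, y, z, w]" and es = "[(0, 2), (0, 2), (0, 3), (0, 3), (0, 4), (0, 4), (0, 5), (1, 3), (1, 4), (1, 5), (2, 5)]"
        and ts = "[(0, 3, 1), (2, 0, 4)]" and w = "[0, 1, 4, 2, 5]", OF assms(1,2)])
    (use assms(3-) in \<open>simp add: list_all_iff cnt_def\<close>, code_simp)

lemma wheeled_six_E4:
  assumes "\<And>p q. m p q = m q p" "distinct [v, b, x, y, z, w]"
    "2 \<le> m v x" "2 \<le> m v y" "2 \<le> m v z" "1 \<le> m b y" "1 \<le> m b z" "1 \<le> m b w" "1 \<le> m x w" "1 \<le> m y w"
  shows "wheeled m"
  by (rule wheeled_cert[where vs = "[v, b, x, y, z, w]" and es = "[(0, 2), (0, 2), (0, 3), (0, 3), (0, 4), (0, 4), (1, 3), (1, 4), (1, 5), (2, 5), (3, 5)]"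
        and ts = "[(0, 2, 5), (3, 0, 4)]" and w = "[3, 0, 4, 1, 5]", OF assms(1,2)])
    (use assms(3-) in \<open>simp add: list_all_iff cnt_def\<close>, code_simp)

section \<open>The minimal counterexample\<close>

lemma star5_deg:
  assumes "mg V m" "distinct [v, b, x, y, z]" "V = {v, b, x, y, z}"
    "m v x = 2" "m v y = 2" "m v z = 2" "m b y = 1" "m b z = 1" "m v b = 0" "m x y = 0" "m x z = 0" "m y z = 0"
  shows "deg V m v = 6" "deg V m b = 2 + m b x" "deg V m x = 2 + m b x" "deg V m y = 3" "deg V m z = 3"
proof -
  have s: "m x v = m v x" "m y v = m v y" "m z v = m v z" "m y b = m b y" "m z b = m b z" "m b v = m v b"
    "m y x = m x y" "m z x = m x z" "m z y = m y z" "m x b = m b x" using mgD(2)[OF assms(1)] by blast+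
  show "deg V m v = 6" "deg V m b = 2 + m b x" "deg V m x = 2 + m b x" "deg V m y = 3" "deg V m z = 3"
    unfolding deg_def assms(3) using assms(2) by (simp_all add: s assms(4-) mgD(3)[OF assms(1)])
qed

lemma conn_mg: "conn V m \<Longrightarrow> mg V m"
  by (simp add: conn_def)

lemma conn_fin: "conn V m \<Longrightarrow> finite V"
  using conn_mg mgD(1) by blast

lemma connD:
  "conn V m \<Longrightarrow> A \<subseteq> V \<Longrightarrow> A \<noteq> {} \<Longrightarrow> A \<noteq> V \<Longrightarrow>
    4 \<le> cut V m A \<or> cut V m A = 3 \<and> (card A = 1 \<or> card (V - A) = 1)"
  unfolding conn_def by blast

lemma conn_cut3: "conn V m \<Longrightarrow> A \<subseteq> V \<Longrightarrow> A \<noteq> {} \<Longrightarrow> A \<noteq> V \<Longrightarrow> 3 \<le> cut V m A"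
  using connD[of V m A] by linarith

lemma conn_cut4:
  assumes "conn V m" "A \<subseteq> V" "2 \<le> card A" "2 \<le> card (V - A)"
  shows "4 \<le> cut V m A"
proof -
  have "A \<noteq> {}" "A \<noteq> V" using assms(3,4) by auto
  then show ?thesis using connD[OF assms(1,2)] assms(3,4) by linarith
qed

lemma connI:
  assumes "mg V m" "v \<in> V" "4 \<le> deg V m v"
    "\<And>A. A \<subseteq> V \<Longrightarrow> A \<noteq> {} \<Longrightarrow> A \<noteq> V \<Longrightarrow> 4 \<le> cut V m A \<or> cut V m A = 3 \<and> (card A = 1 \<or> card (V - A) = 1)"
  shows "conn V m"
  unfolding conn_def using assms by blast

text \<open>The cuts of the contraction are cuts of \<open>m\<close>, and a side that is a single
  vertex of \<open>V\<close> stays single. The contracted vertex has degree \<open>cut V m Z\<close>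
  and serves as the vertex of degree at least 4.\<close>

lemma conn_con:
  assumes "conn V m" "Z \<subseteq> V" "v \<in> Z" "4 \<le> cut V m Z"
  shows "conn (V - (Z - {v})) (con m Z v)"
proof (rule connI)
  note mg = conn_mg[OF assms(1)]
  let ?V = "V - (Z - {v})"
  show "mg ?V (con m Z v)" by (rule mg_con[OF mg assms(2,3)])
  show v: "v \<in> ?V" using assms by blast
  show "4 \<le> deg ?V (con m Z v) v" using deg_con[OF mg assms(2,3) v] assms(4) by simp
  fix A assume A: "A \<subseteq> ?V" "A \<noteq> {}" "A \<noteq> ?V"
  show "4 \<le> cut ?V (con m Z v) A \<or> cut ?V (con m Z v) A = 3 \<and> (card A = 1 \<or> card (?V - A) = 1)"
  proof (cases "v \<in> A")
    case True
    have c: "cut ?V (con m Z v) A = cut V m (A \<union> Z)" by (rule cut_con(2)[OF mg assms(2,3) A(1) True])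
    have e: "V - (A \<union> Z) = ?V - A" using True by blast
    have "A \<union> Z \<noteq> V" using e A by blast
    moreover have "A \<union> Z \<subseteq> V" "A \<union> Z \<noteq> {}" using A assms by auto
    ultimately have "4 \<le> cut V m (A \<union> Z) \<or> cut V m (A \<union> Z) = 3 \<and> (card (A \<union> Z) = 1 \<or> card (?V - A) = 1)"
      using assms(1) unfolding conn_def e[symmetric] by blast
    moreover have "card A = 1" if c1: "card (A \<union> Z) = 1"
    proof -
      obtain t where t: "A \<union> Z = {t}" by (rule card_1_singletonE[OF c1])
      have "A \<subseteq> {t}" unfolding t[symmetric] by (rule Un_upper1)
      then have "A = {t}" using A(2) by (metis subset_singletonD)
      then show ?thesis by simp
    qed
    ultimately show ?thesis unfolding c by argo
  next
    case False
    have c: "cut ?V (con m Z v) A = cut V m A" by (rule cut_con(1)[OF mg assms(2,3) A(1) False])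
    have "A \<noteq> V" "A \<subseteq> V" using A False assms by auto
    then have "4 \<le> cut V m A \<or> cut V m A = 3 \<and> (card A = 1 \<or> card (V - A) = 1)"
      using assms(1) A(2) unfolding conn_def by blast
    moreover have "card (?V - A) = 1" if c1: "card (V - A) = 1"
    proof -
      obtain t where t: "V - A = {t}" by (rule card_1_singletonE[OF c1])
      have "v \<in> V - A" using v False by blast
      then have "t = v" unfolding t by simp
      have "?V - A \<subseteq> V - A" by blast
      moreover have "v \<in> ?V - A" using v False by blast
      ultimately have "?V - A = {v}" unfolding t \<open>t = v\<close> by blast
      then show ?thesis by simp
    qed
    ultimately show ?thesis unfolding c by argo
  qed
qed

text \<open>The handshake lemma for the graph induced on \<open>A\<close>, source of the parity
  arguments below.\<close>

lemma even_total: "finite A \<Longrightarrow> mg V m \<Longrightarrow> even (ew m A A)"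
proof (induction A rule: finite_induct)
  case (insert a A)
  have "ew m (insert a A) (insert a A) = (m a a + ew m {a} A) + (ew m A {a} + ew m A A)"
    unfolding ew_insert_left[OF insert(1,2)] ew_insert_right[OF insert(1,2)] by simp
  also have "\<dots> = 2 * ew m {a} A + ew m A A"
    using ew_commute[OF insert.prems, of A "{a}"] mgD(3)[OF insert.prems] by simp
  finally show ?case using insert by simp
qed simp

lemma deg_sum: "mg V m \<Longrightarrow> A \<subseteq> V \<Longrightarrow> (\<Sum>x\<in>A. deg V m x) = ew m A A + cut V m A"
proof -
  assume a: "mg V m" "A \<subseteq> V"
  have "(\<Sum>x\<in>A. deg V m x) = (\<Sum>x\<in>A. ew m {x} A + ew m {x} (V - A))" using deg_split[OF a] by simp
  then show ?thesis unfolding cut_def ew_def by (simp add: sum.distrib)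
qed

locale minimal_counterexample =
  fixes V :: "'a set" and m :: "'a \<Rightarrow> 'a \<Rightarrow> nat"
  assumes conn: "conn V m" and card: "6 \<le> card V" and nw: "\<not> wheeled m" and nc: "\<not> chain3 V m"
    and IH: "\<And>V' (m' :: 'a \<Rightarrow> 'a \<Rightarrow> nat). conn V' m' \<Longrightarrow> 5 \<le> card V' \<Longrightarrow>
      card V' + ew m' V' V' < card V + ew m V V \<Longrightarrow> \<not> wheeled m' \<Longrightarrow>
      chain3 V' m' \<or> card V' = 5 \<and> star5 V' m'"
begin

lemmas mg = conn_mg[OF conn] and fin = conn_fin[OF conn]
lemmas sym = mgD(2)[OF mg] and diag = mgD(3)[OF mg]

lemma finA: "A \<subseteq> V \<Longrightarrow> finite A"
  using fin finite_subset by blast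

lemma edgeD: "m p q \<noteq> 0 \<Longrightarrow> p \<in> V \<and> q \<in> V \<and> p \<noteq> q"
  using mg_edge[OF mg, of p q] by linarith

lemma deg_ge3: "x \<in> V \<Longrightarrow> 3 \<le> deg V m x"
proof -
  assume x: "x \<in> V"
  have "{x} \<noteq> V"
  proof
    assume "{x} = V"
    then have "card V = 1" by (metis card.empty card.insert empty_iff finite.emptyI One_nat_def)
    then show False using card by simp
  qed
  then show ?thesis using conn_cut3[OF conn, of "{x}"] deg_cut[OF mg x] x by simp
qed

text \<open>The cut condition for \<open>{x, y}\<close> turned into a bound on \<open>m x y\<close>;
  it makes edges between cubic vertices simple.\<close>

lemma cut_pair_ge4: "x \<in> V \<Longrightarrow> y \<in> V \<Longrightarrow> x \<noteq> y \<Longrightarrow> 4 + 2 * m x y \<le> deg V m x + deg V m y"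
proof -
  assume a: "x \<in> V" "y \<in> V" "x \<noteq> y"
  then have "card (V - {x, y}) = card V - 2" "card {x, y} = 2" by (simp_all add: card_Diff_subset)
  then have "4 \<le> cut V m {x, y}" using conn_cut4[OF conn, of "{x, y}"] card a by simp
  then show ?thesis using cut_pair[OF mg a] by linarith
qed

lemma chainI:
  "m p q = 2 \<Longrightarrow> m q r = 2 \<Longrightarrow> m p r = 0 \<Longrightarrow> p \<noteq> r \<Longrightarrow> deg V m p = 4 \<Longrightarrow> deg V m q = 4 \<Longrightarrow> deg V m r = 4 \<Longrightarrow> False"
proof -
  assume a: "m p q = 2" "m q r = 2" "m p r = 0" "p \<noteq> r" "deg V m p = 4" "deg V m q = 4" "deg V m r = 4"
  then have "{p, q, r} \<subseteq> V" using edgeD[of p q] edgeD[of q r] by simp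
  then show False using nc a unfolding chain3_def by blast
qed

lemma deg_zero:
  assumes "A \<subseteq> V" "ew m {w} A = deg V m w" "x \<notin> A"
  shows "m w x = 0"
proof (cases "x \<in> V")
  case True
  then have "ew m {w} (V - A) = 0" using deg_split[OF mg assms(1), of w] assms(2) by simp
  then show ?thesis using True assms(3) fin by (simp add: ew_def)
qed (simp add: mgD(5)[OF mg])

text \<open>Four vertices outside \<open>Z\<close> leave at least five in the contraction, as the
  induction hypothesis demands; a wheel is excluded by \<open>wheeled_con\<close>.\<close>

lemma contract:
  assumes "Z \<subseteq> V" "v \<in> Z" "2 \<le> card Z" "4 \<le> card (V - Z)" "4 \<le> cut V m Z"
    "\<And>Y. v \<in> Y \<Longrightarrow> Y \<subseteq> Z \<Longrightarrow> cut V m Z \<le> cut V m Y"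
  shows "chain3 (V - (Z - {v})) (con m Z v) \<or> card (V - Z) = 4 \<and> star5 (V - (Z - {v})) (con m Z v)"
proof -
  let ?V = "V - (Z - {v})"
  have "?V = insert v (V - Z)" using assms by auto
  then have c: "card ?V = card (V - Z) + 1" using fin assms(2) by simp
  moreover have "card (V - Z) = card V - card Z" by (rule card_Diff_subset[OF finA[OF assms(1)] assms(1)])
  moreover have "card Z \<le> card V" by (rule card_mono[OF fin assms(1)])
  ultimately have "card ?V < card V" using assms(3) by linarith
  then have "card ?V + ew (con m Z v) ?V ?V < card V + ew m V V"
    using total_con[OF mg assms(1,2)] by linarith
  moreover have "\<not> wheeled (con m Z v)" using wheeled_con[OF mg assms(1,2,6)] nw by blast
  ultimately show ?thesis
    using IH[OF conn_con[OF conn assms(1,2,5)]] c assms(4) by auto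
qed

text \<open>The hypothesis on \<open>w\<close> says that the boundary of \<open>{a, w}\<close> is no
  larger than that of \<open>{a}\<close>, the only other set to be compared.\<close>

lemma contract_pair:
  assumes "a \<in> V" "w \<in> V" "a \<noteq> w" "deg V m w \<le> 2 * m a w"
  shows "chain3 (V - {w}) (con m {a, w} a) \<or> card V = 6 \<and> star5 (V - {w}) (con m {a, w} a)"
proof -
  have c: "card (V - {a, w}) = card V - 2" using assms fin by (simp add: card_Diff_subset)
  have e: "V - ({a, w} - {a}) = V - {w}" using assms(3) by blast
  have "chain3 (V - ({a, w} - {a})) (con m {a, w} a) \<or>
      card (V - {a, w}) = 4 \<and> star5 (V - ({a, w} - {a})) (con m {a, w} a)"
  proof (rule contract)
    show "4 \<le> cut V m {a, w}" by (rule conn_cut4[OF conn]) (use assms c card in auto)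
    show "cut V m {a, w} \<le> cut V m Y" if "a \<in> Y" "Y \<subseteq> {a, w}" for Y
    proof (cases "Y = {a, w}")
      case False
      then have "Y = {a}" using that by auto
      then show ?thesis using cut_pair[OF mg assms(1-3)] deg_cut[OF mg assms(1)] assms(4) by simp
    qed simp
  qed (use assms c card in auto)
  then show ?thesis unfolding e using c card by auto
qed

text \<open>Since \<open>m\<close> has no chain, the contracted vertex belongs to the new one, and
  its degree there is the size of the cut. The two alternatives are its positions: in the middle or
  at an end.\<close>

lemma chain3_con:
  assumes "Z \<subseteq> V" "v \<in> Z" "chain3 (V - (Z - {v})) (con m Z v)"
  shows "cut V m Z = 4"
    "(\<exists>p\<in>V - Z. \<exists>r\<in>V - Z. p \<noteq> r \<and> ew m {p} Z = 2 \<and> ew m {r} Z = 2 \<and> m p r = 0 \<and> deg V m p = 4 \<and> deg V m r = 4) \<or>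
     (\<exists>q\<in>V - Z. \<exists>r\<in>V - Z. ew m {q} Z = 2 \<and> m q r = 2 \<and> ew m {r} Z = 0 \<and> deg V m q = 4 \<and> deg V m r = 4)"
proof -
  let ?V = "V - (Z - {v})" and ?m = "con m Z v"
  obtain p q r where c: "{p, q, r} \<subseteq> ?V" "p \<noteq> r" "?m p q = 2" "?m q r = 2" "?m p r = 0"
    "deg ?V ?m p = 4" "deg ?V ?m q = 4" "deg ?V ?m r = 4"
    using assms(3) unfolding chain3_def by blast
  note d = deg_con[OF mg assms(1,2)]
  have dV: "deg V m t = deg ?V ?m t" if "t \<in> ?V" "t \<noteq> v" for t using d[of t] that by simp
  have pq: "p \<noteq> q" "q \<noteq> r" using c(3,4) by (auto simp: con_def)
  have s: "?m t u = ?m u t" for t u using mgD(2)[OF mg_con[OF mg assms(1,2)]] .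
  have zv: "?m t v = ew m {t} Z" if "t \<in> ?V" "t \<noteq> v" for t using that by (auto simp: con_def)
  have zz: "?m t u = m t u" if "t \<in> ?V" "t \<noteq> v" "u \<in> ?V" "u \<noteq> v" for t u
    using that diag by (auto simp: con_def)
  have "v \<in> {p, q, r}"
  proof (rule ccontr)
    assume n: "v \<notin> {p, q, r}"
    show False by (rule chainI[of p q r]) (use n c zz dV in auto)
  qed
  then show "cut V m Z = 4" using c d[of v] by auto
  have VZ: "t \<in> V - Z" if "t \<in> ?V" "t \<noteq> v" for t using that by blast
  consider "q = v" | "p = v" | "r = v" using \<open>v \<in> {p, q, r}\<close> by blast
  then show "(\<exists>p\<in>V - Z. \<exists>r\<in>V - Z. p \<noteq> r \<and> ew m {p} Z = 2 \<and> ew m {r} Z = 2 \<and> m p r = 0 \<and> deg V m p = 4 \<and> deg V m r = 4) \<or>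
     (\<exists>q\<in>V - Z. \<exists>r\<in>V - Z. ew m {q} Z = 2 \<and> m q r = 2 \<and> ew m {r} Z = 0 \<and> deg V m q = 4 \<and> deg V m r = 4)"
  proof cases
    case 1
    have t: "p \<in> ?V" "r \<in> ?V" "p \<noteq> v" "r \<noteq> v" using c(1) pq 1 by auto
    have "ew m {p} Z = 2" "ew m {r} Z = 2" "m p r = 0" "deg V m p = 4" "deg V m r = 4"
      using zv[OF t(1,3)] zv[OF t(2,4)] zz[OF t(1,3,2,4)] dV[OF t(1,3)] dV[OF t(2,4)] c s[of v r] 1 by auto
    then show ?thesis using VZ[OF t(1,3)] VZ[OF t(2,4)] c(2) by blast
  next
    case 2
    have t: "q \<in> ?V" "r \<in> ?V" "q \<noteq> v" "r \<noteq> v" using c(1,2) pq 2 by auto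
    have "ew m {q} Z = 2" "ew m {r} Z = 0" "m q r = 2" "deg V m q = 4" "deg V m r = 4"
      using zv[OF t(1,3)] zv[OF t(2,4)] zz[OF t(1,3,2,4)] dV[OF t(1,3)] dV[OF t(2,4)] c s[of v r] s[of v q] 2 by auto
    then show ?thesis using VZ[OF t(1,3)] VZ[OF t(2,4)] by blast
  next
    case 3
    have t: "q \<in> ?V" "p \<in> ?V" "q \<noteq> v" "p \<noteq> v" using c(1,2) pq 3 by auto
    have "ew m {q} Z = 2" using zv[OF t(1,3)] c(4) 3 by simp
    moreover have "ew m {p} Z = 0" using zv[OF t(2,4)] c(5) 3 by simp
    moreover have "m q p = 2" using zz[OF t(1,3,2,4)] c(3) s[of q p] by linarith
    moreover have "deg V m q = 4" "deg V m p = 4" using dV[OF t(1,3)] dV[OF t(2,4)] c(6,7) by linarith+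
    ultimately have "ew m {q} Z = 2" "ew m {p} Z = 0" "m q p = 2" "deg V m q = 4" "deg V m p = 4" by blast+
    then show ?thesis using VZ[OF t(1,3)] VZ[OF t(2,4)] by blast
  qed
qed

end

text \<open>The degrees in \<open>star5\<close> are 6 at \<open>v\<close>, 3 at \<open>y\<close> and
  \<open>z\<close>, and \<open>2 + m b x\<close> at \<open>b\<close> and \<open>x\<close>, which
  locates a vertex of degree at least 4.\<close>

lemma star5_cases:
  assumes "star5 V m" "mg V m" "a \<in> V" "4 \<le> deg V m a"
  obtains v b x y z where "distinct [v, b, x, y, z]" "V = {v, b, x, y, z}"
    "m v x = 2" "m v y = 2" "m v z = 2" "m b x = 1 \<or> m b x = 2" "m b y = 1" "m b z = 1"
    "m v b = 0" "m x y = 0" "m x z = 0" "m y z = 0"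
    "deg V m v = 6" "deg V m b = 2 + m b x" "deg V m x = 2 + m b x" "deg V m y = 3" "deg V m z = 3"
    "a = v \<or> (a = b \<or> a = x) \<and> m b x = 2"
proof -
  obtain v b x y z where c: "distinct [v, b, x, y, z]" "V = {v, b, x, y, z}"
    "m v x = 2" "m v y = 2" "m v z = 2" "m b x = 1 \<or> m b x = 2" "m b y = 1" "m b z = 1"
    "m v b = 0" "m x y = 0" "m x z = 0" "m y z = 0"
    using assms(1) unfolding star5_def by blast
  note d = star5_deg[OF assms(2) c(1-5,7-12)]
  have "a \<in> {v, b, x, y, z}" using assms(3) unfolding c(2) .
  moreover have "a \<noteq> y" "a \<noteq> z" using d(4,5) assms(4) by auto
  moreover have "m b x = 2" if "a = b \<or> a = x" using that d(2,3) assms(4) c(6) by auto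
  ultimately have "a = v \<or> (a = b \<or> a = x) \<and> m b x = 2" by blast
  then show thesis by (rule that[OF c d])
qed

lemma con_pair:
  assumes "mg V m" "a \<noteq> w" "p \<noteq> w" "q \<noteq> w" "p \<noteq> q"
  shows "con m {a, w} a p q = m p q + (if p = a then m w q else 0) + (if q = a then m p w else 0)"
proof -
  have "ew m {a, w} {q} = m a q + m w q" "ew m {p} {a, w} = m p a + m p w"
    using assms(2) by (simp_all add: ew_def)
  then show ?thesis using assms(2-5) unfolding con_def by auto
qed

lemma deg_con_pair:
  assumes "mg V m" "a \<in> V" "w \<in> V" "a \<noteq> w" "u \<in> V - {w}"
  shows "deg (V - {w}) (con m {a, w} a) u = (if u = a then deg V m a + deg V m w - 2 * m a w else deg V m u)"
proof -
  have e: "V - ({a, w} - {a}) = V - {w}" using assms(4) by blast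
  have s: "{a, w} \<subseteq> V" using assms by blast
  have "deg (V - {w}) (con m {a, w} a) u = (if u = a then cut V m {a, w} else deg V m u)"
    using deg_con[OF assms(1) s, of a u] assms(5) unfolding e by simp
  then show ?thesis using cut_pair[OF assms(1-4)] by auto
qed

section \<open>Double edges between vertices of degree four\<close>

context minimal_counterexample
begin

lemma deg_ge: "finite A \<Longrightarrow> A \<subseteq> V \<Longrightarrow> ew m {x} A \<le> deg V m x"
  unfolding deg_ew using ew_mono[of "{x}" V "{x}" A m] fin by simp

lemma con_pair_mg: "a \<in> V \<Longrightarrow> w \<in> V \<Longrightarrow> a \<noteq> w \<Longrightarrow> mg (V - {w}) (con m {a, w} a)"
proof -
  assume a: "a \<in> V" "w \<in> V" "a \<noteq> w"
  then have "V - ({a, w} - {a}) = V - {w}" "{a, w} \<subseteq> V" by auto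
  then show ?thesis using mg_con[OF mg, of "{a, w}" a] by simp
qed

lemma chain3_con_pair:
  assumes "a \<in> V" "w \<in> V" "a \<noteq> w" "chain3 (V - {w}) (con m {a, w} a)"
  shows "cut V m {a, w} = 4"
    "(\<exists>p\<in>V - {a, w}. \<exists>r\<in>V - {a, w}. p \<noteq> r \<and> m p a + m p w = 2 \<and> m r a + m r w = 2 \<and> m p r = 0 \<and> deg V m p = 4 \<and> deg V m r = 4) \<or>
     (\<exists>q\<in>V - {a, w}. \<exists>r\<in>V - {a, w}. m q a + m q w = 2 \<and> m q r = 2 \<and> m r a + m r w = 0 \<and> deg V m q = 4 \<and> deg V m r = 4)"
proof -
  have e: "V - ({a, w} - {a}) = V - {w}" using assms(3) by blast
  have s: "{a, w} \<subseteq> V" "a \<in> {a, w}" using assms by auto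
  have w: "ew m {t} {a, w} = m t a + m t w" for t using assms(3) by (simp add: ew_def)
  note c = chain3_con[OF s, unfolded e, OF assms(4), unfolded w]
  show "cut V m {a, w} = 4" by (rule c(1))
  show "(\<exists>p\<in>V - {a, w}. \<exists>r\<in>V - {a, w}. p \<noteq> r \<and> m p a + m p w = 2 \<and> m r a + m r w = 2 \<and> m p r = 0 \<and> deg V m p = 4 \<and> deg V m r = 4) \<or>
     (\<exists>q\<in>V - {a, w}. \<exists>r\<in>V - {a, w}. m q a + m q w = 2 \<and> m q r = 2 \<and> m r a + m r w = 0 \<and> deg V m q = 4 \<and> deg V m r = 4)"
    by (rule c(2))
qed

text \<open>Contracting \<open>{s, w}\<close> onto \<open>s\<close> adds two edges between
  \<open>s\<close> and \<open>t\<close> in place of \<open>w\<close> and keeps all degrees. A chain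
  in the contraction expands to one in \<open>m\<close>. In \<open>star5\<close> the edges between
  \<open>s\<close> and \<open>t\<close> must join two vertices of degree at least 4, so they lie
  between \<open>v\<close> and \<open>x\<close> or between \<open>b\<close> and \<open>x\<close>,
  with \<open>b\<close> and \<open>x\<close> of degree 4; reinserting \<open>w\<close> gives a chain
  again.\<close>

lemma no_chain2_degree4:
  assumes "m w s = 2" "m w t = 2" "s \<noteq> t" "deg V m w = 4"
  shows False
proof -
  have V: "w \<in> V" "s \<in> V" "t \<in> V" "w \<noteq> s" "w \<noteq> t" using edgeD[of w s] edgeD[of w t] assms by auto
  have "ew m {w} {s, t} = deg V m w" using assms by (simp add: ew_def)
  then have w0: "m w u = 0" if "u \<noteq> s" "u \<noteq> t" for u
    using deg_zero[of "{s, t}" w u] V that by simp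
  have sw: "m s w = 2" "m t w = 2" using sym[of s w] sym[of t w] assms by auto
  have ds: "4 \<le> deg V m s" "4 \<le> deg V m t"
    using cut_pair_ge4[OF V(1,2,4)] cut_pair_ge4[OF V(1,3,5)] assms by simp_all
  have "chain3 (V - {w}) (con m {s, w} s) \<or> card V = 6 \<and> star5 (V - {w}) (con m {s, w} s)"
    by (rule contract_pair[OF V(2,1) V(4)[symmetric]]) (simp add: assms sw)
  then show False
  proof (elim disjE conjE)
    assume "chain3 (V - {w}) (con m {s, w} s)"
    note c = chain3_con_pair[OF V(2,1) V(4)[symmetric] this]
    have dws: "deg V m s = 4" using c(1) cut_pair[OF mg V(2,1) V(4)[symmetric]] assms(4) sw by simp
    from c(2) show False
    proof (elim disjE bexE conjE)
      fix p r
      assume p: "p \<in> V - {s, w}" "r \<in> V - {s, w}" "p \<noteq> r" "m p s + m p w = 2" "m r s + m r w = 2" "m p r = 0"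
        "deg V m p = 4" "deg V m r = 4"
      have one: False if "u \<in> V - {s, w}" "m u s = 2" "u \<noteq> t" "deg V m u = 4" for u
      proof (rule chainI[of w s u])
        show "m s u = 2" using that(2) sym[of s u] by simp
        show "m w u = 0" using w0 that by simp
      qed (use that assms dws in auto)
      have "m u w = 0" if "u \<in> V - {s, w}" "u \<noteq> t" for u using w0[of u] that sym[of u w] by simp
      then show False using one[of p] one[of r] p by (cases "p = t") auto
    next
      fix q r
      assume q: "q \<in> V - {s, w}" "r \<in> V - {s, w}" "m q s + m q w = 2" "m q r = 2" "m r s + m r w = 0"
        "deg V m q = 4" "deg V m r = 4"
      show False
      proof (cases "q = t")
        case True
        have "r \<noteq> t" using q(4) True diag by auto
        show False
          by (rule chainI[of w t r]) (use q True assms w0[of r] \<open>r \<noteq> t\<close> in auto)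
      next
        case False
        have "m q s = 2" using w0[of q] q False sym[of q w] by simp
        show False
          by (rule chainI[of w s q]) (use q False assms dws w0[of q] \<open>m q s = 2\<close> sym[of q s] in auto)
      qed
    qed
  next
    assume st: "star5 (V - {w}) (con m {s, w} s)"
    let ?V = "V - {w}" and ?m = "con m {s, w} s"
    have mm: "?m p q = m p q + (if {p, q} = {s, t} then 2 else 0)" if "p \<in> ?V" "q \<in> ?V" "p \<noteq> q" for p q
      using con_pair[OF mg V(4)[symmetric], of p q] that w0[of p] w0[of q] sym[of p w] assms sw
      by (auto simp: doubleton_eq_iff)
    have dd: "deg ?V ?m u = deg V m u" if "u \<in> ?V" for u
      using deg_con_pair[OF mg V(2,1) V(4)[symmetric] that] assms(4) sw by simp
    have sV: "s \<in> ?V" "t \<in> ?V" using V by auto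
    obtain v b x y z where c: "distinct [v, b, x, y, z]" "?V = {v, b, x, y, z}"
      "?m v x = 2" "?m v y = 2" "?m v z = 2" "?m b x = 1 \<or> ?m b x = 2" "?m b y = 1" "?m b z = 1"
      "?m v b = 0" "?m x y = 0" "?m x z = 0" "?m y z = 0"
      "deg ?V ?m v = 6" "deg ?V ?m b = 2 + ?m b x" "deg ?V ?m x = 2 + ?m b x" "deg ?V ?m y = 3" "deg ?V ?m z = 3"
      "s = v \<or> (s = b \<or> s = x) \<and> ?m b x = 2"
      by (rule star5_cases[OF st con_pair_mg[OF V(2,1) V(4)[symmetric]] sV(1)]) (use dd[OF sV(1)] ds in auto)
    have in5: "v \<in> ?V" "b \<in> ?V" "x \<in> ?V" "y \<in> ?V" "z \<in> ?V" unfolding c(2) by auto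
    have "t \<in> {v, b, x, y, z}" using sV(2) unfolding c(2) .
    \<comment> \<open>\<open>y\<close> and \<open>z\<close> are cubic, but the pair bound gives
      \<open>t\<close> degree at least 4.\<close>
    moreover have "t \<noteq> y" "t \<noteq> z" using c(16,17) dd[OF sV(2)] ds(2) by auto
    moreover have "?m s t \<noteq> 0" "?m t s \<noteq> 0" using mm[OF sV] mm[OF sV(2,1)] assms(3) by auto
    moreover have tb: "?m b x = 2" if "t = x" using that c(15) dd[OF sV(2)] ds(2) c(6) by auto
    ultimately have "{s, t} = {v, x} \<and> ?m b x = 2 \<or> {s, t} = {b, x} \<and> ?m b x = 2"
      using c(18,9) assms(3) by auto
    then show False
    proof (elim disjE conjE)
      assume e: "{s, t} = {v, x}" "?m b x = 2"
      then have b: "b \<noteq> s" "b \<noteq> t" using c(1) by auto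
      then have "m b x = 2" using mm[OF in5(2,3)] e c(1) by (auto simp: doubleton_eq_iff)
      moreover have "m w x = 2" using e(1) assms(1,2) by (auto simp: doubleton_eq_iff)
      ultimately show False
        using chainI[of w x b] w0[OF b] assms(4) dd[OF in5(3)] dd[OF in5(2)] c(14,15) e(2) in5(2) sym[of x b] by auto
    next
      assume e: "{s, t} = {b, x}" "?m b x = 2"
      then have "m b x = 0" using mm[OF in5(2,3)] c(1) by (auto simp: doubleton_eq_iff)
      moreover have "m w x = 2" "m w b = 2" using e(1) assms(1,2) by (auto simp: doubleton_eq_iff)
      ultimately show False
        using chainI[of b w x] assms(4) dd[OF in5(3)] dd[OF in5(2)] c(1,14,15) e(2) sym[of b w] by auto
    qed
  qed
qed

text \<open>After contracting the digon, a chain or \<open>star5\<close> shows a vertex with exactly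
  two edges to the contracted one; in \<open>star5\<close> the contracted vertex has degree 4, so it
  is \<open>b\<close> or \<open>x\<close>, and the other of these two is meant. Without common
  neighbours both edges go to \<open>q\<close> or both to \<open>r\<close>, which then has two
  double edges.\<close>

lemma no_digon_without_common_neighbour:
  assumes "m q r = 2" "deg V m q = 4" "deg V m r = 4" "\<And>x. m q x = 0 \<or> m r x = 0"
  shows False
proof -
  have V: "q \<in> V" "r \<in> V" "q \<noteq> r" using edgeD[of q r] assms(1) by auto
  have no: False if "m q y + m r y = 2" "y \<noteq> q" "y \<noteq> r" for y
    using assms(4)[of y]
  proof
    assume "m q y = 0"
    then show False using that no_chain2_degree4[of r q y] assms(1,3) sym[of q r] by auto
  next
    assume "m r y = 0"
    then show False using that no_chain2_degree4[of q r y] assms(1,2) by auto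
  qed
  have "chain3 (V - {r}) (con m {q, r} q) \<or> card V = 6 \<and> star5 (V - {r}) (con m {q, r} q)"
    by (rule contract_pair[OF V]) (simp add: assms)
  then show False
  proof (elim disjE conjE)
    assume "chain3 (V - {r}) (con m {q, r} q)"
    from chain3_con_pair(2)[OF V this] have "\<exists>y\<in>V - {q, r}. m y q + m y r = 2" by blast
    then obtain y where "y \<in> V - {q, r}" "m y q + m y r = 2" by blast
    then show False using no[of y] sym[of y q] sym[of y r] by auto
  next
    let ?V = "V - {r}" and ?m = "con m {q, r} q"
    assume st: "star5 ?V ?m"
    have qV: "q \<in> ?V" using V by auto
    have dq: "deg ?V ?m q = 4" using deg_con_pair[OF mg V qV] assms by simp
    obtain v b x y z where c: "distinct [v, b, x, y, z]" "?V = {v, b, x, y, z}" "deg ?V ?m v = 6"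
      "q = v \<or> (q = b \<or> q = x) \<and> ?m b x = 2"
      by (rule star5_cases[OF st con_pair_mg[OF V] qV]) (use dq in auto)
    have in5: "b \<noteq> r" "x \<noteq> r" "b \<noteq> x" using c(1,2) by auto
    have bx: "?m b x = 2" "q = b \<or> q = x" using c(3,4) dq by auto
    have cp: "?m b x = m b x + (if b = q then m r x else 0) + (if x = q then m b r else 0)"
      by (rule con_pair[OF mg V(3) in5])
    show False
      using bx(2)
    proof
      assume "q = b"
      then show False using cp bx(1) no[of x] in5 by auto
    next
      assume "q = x"
      then show False using cp bx(1) no[of b] in5 sym[of b q] sym[of b r] by auto
    qed
  qed
qed

end

section \<open>Cyclic arrangements of four cuts of size two\<close>

text \<open>Both ways of obtaining the sum 2 in one formula: \<open>a = b\<close> stands for a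
  single value 2.\<close>

lemma sum2_ex:
  fixes f :: "'a \<Rightarrow> nat"
  assumes "finite A" "sum f A = 2"
  shows "\<exists>a\<in>A. \<exists>b\<in>A. \<forall>x\<in>A. f x = (if x = a then 1 else 0) + (if x = b then 1 else 0)"
proof (rule sum_eq_2E[OF assms])
  fix a assume a: "a \<in> A" "f a = 2" "\<And>x. x \<in> A \<Longrightarrow> x \<noteq> a \<Longrightarrow> f x = 0"
  have "f x = (if x = a then 1 else 0) + (if x = a then 1 else 0)" if "x \<in> A" for x
    using a(2) a(3)[OF that] by simp
  then show ?thesis using a(1) by blast
next
  fix a b assume a: "a \<in> A" "b \<in> A" "a \<noteq> b" "f a = 1" "f b = 1"
    "\<And>x. x \<in> A \<Longrightarrow> x \<noteq> a \<Longrightarrow> x \<noteq> b \<Longrightarrow> f x = 0"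
  have "f x = (if x = a then 1 else 0) + (if x = b then 1 else 0)" if "x \<in> A" for x
    using a(3-5) a(6)[OF that] by auto
  then show ?thesis using a(1,2) by blast
qed

text \<open>By the degrees, a pair avoiding \<open>b\<close> has boundary at least 5. Hence
  \<open>star5\<close> has no two disjoint pairs with boundary 4, which refutes it in the analysis
  of rings of cuts.\<close>

lemma star5_pair:
  assumes "star5 V m" "mg V m"
  shows "\<exists>b. \<forall>A\<subseteq>V. card A = 2 \<longrightarrow> cut V m A = 4 \<longrightarrow> b \<in> A"
proof -
  obtain v b x y z where c: "distinct [v, b, x, y, z]" "V = {v, b, x, y, z}"
    "m v x = 2" "m v y = 2" "m v z = 2" "m b x = 1 \<or> m b x = 2" "m b y = 1" "m b z = 1"
    "m v b = 0" "m x y = 0" "m x z = 0" "m y z = 0"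
    using assms(1) unfolding star5_def by blast
  note d = star5_deg[OF assms(2) c(1-5,7-12)]
  have "b \<in> A" if A: "A \<subseteq> V" "card A = 2" "cut V m A = 4" for A
  proof (rule ccontr)
    assume b: "b \<notin> A"
    obtain i j where ij: "A = {i, j}" "i \<noteq> j" using A(2) card_2_iff by metis
    have V: "i \<in> V" "j \<in> V" "i \<noteq> b" "j \<noteq> b" using A(1) b unfolding ij(1) by auto
    have "4 + 2 * m i j = deg V m i + deg V m j" using cut_pair[OF assms(2) V(1,2) ij(2)] A(3) ij(1) by simp
    moreover have "i \<in> {v, x, y, z}" "j \<in> {v, x, y, z}" using V c(2) by auto
    moreover have "m x v = 2" "m y v = 2" "m z v = 2" "m y x = 0" "m z x = 0" "m z y = 0"
      using c mgD(2)[OF assms(2)] by metis+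
    ultimately show False using ij(2) c(3-6,10-12) d by auto
  qed
  then show ?thesis by blast
qed

context minimal_counterexample
begin

text \<open>The sets \<open>Z\<close>, \<open>{p}\<close>, \<open>Y\<close>, \<open>{r}\<close> form
  a ring with two edges between consecutive members. Splitting off the edges at \<open>p\<close> in
  two pairs, each joining \<open>Z\<close> to \<open>Y\<close>, removes \<open>p\<close> and keeps
  all other degrees. The point is that no cut becomes too small; the vertex \<open>r\<close> of
  degree 4 keeps the graph noncubic.\<close>

lemma no_cut_ring:
  assumes V: "V = Z \<union> Y \<union> {p, r}" and dj: "Z \<inter> Y = {}" "p \<notin> Z \<union> Y" "r \<notin> Z \<union> Y" "p \<noteq> r"
    and cardZ: "2 \<le> card Z" and cardY: "2 \<le> card Y"
    and e: "ew m Z Y = 0" "m p r = 0" "ew m {p} Z = 2" "ew m {p} Y = 2" "ew m {r} Z = 2" "ew m {r} Y = 2"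
  shows False
proof -
  have sub: "Z \<subseteq> V" "Y \<subseteq> V" "p \<in> V" "r \<in> V" using V by auto
  have f: "finite Z" "finite Y" using finA sub by auto
  have degV: "deg V m u = ew m {u} Z + ew m {u} Y + m u p + m u r" for u
  proof -
    have "ew m {u} V = ew m {u} (Z \<union> Y) + ew m {u} {p, r}"
      unfolding V by (rule ew_Un_right) (use f dj in auto)
    moreover have "ew m {u} (Z \<union> Y) = ew m {u} Z + ew m {u} Y" by (rule ew_Un_right[OF f dj(1)])
    moreover have "ew m {u} {p, r} = m u p + m u r" using dj(4) by (simp add: ew_def)
    ultimately show ?thesis unfolding deg_ew by simp
  qed
  have dp: "deg V m p = 4" "deg V m r = 4" using degV[of p] degV[of r] e diag sym[of r p] by simp_all
  have ZY0: "m z y = 0" if "z \<in> Z" "y \<in> Y" for z y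
    using e(1) that ew_eq_0[OF f] by blast
  have sp: "sum (m p) Z = 2" "sum (m p) Y = 2" using e(3,4) by (simp_all add: ew_def)
  obtain z1 z2 where z: "z1 \<in> Z" "z2 \<in> Z" "\<And>u. u \<in> Z \<Longrightarrow> m p u = (if u = z1 then 1 else 0) + (if u = z2 then 1 else 0)"
    using sum2_ex[OF f(1) sp(1)] by metis
  obtain y1 y2 where y: "y1 \<in> Y" "y2 \<in> Y" "\<And>u. u \<in> Y \<Longrightarrow> m p u = (if u = y1 then 1 else 0) + (if u = y2 then 1 else 0)"
    using sum2_ex[OF f(2) sp(2)] by metis
  have neq: "z1 \<noteq> y1" "z1 \<noteq> y2" "z2 \<noteq> y1" "z2 \<noteq> y2" "z1 \<noteq> p" "z2 \<noteq> p" "y1 \<noteq> p" "y2 \<noteq> p"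
    "z1 \<noteq> r" "z2 \<noteq> r" "y1 \<noteq> r" "y2 \<noteq> r" using z(1,2) y(1,2) dj by auto
  have mp: "m p u = (if u = z1 then 1 else 0) + (if u = z2 then 1 else 0) + (if u = y1 then 1 else 0) + (if u = y2 then 1 else 0)" for u
  proof (cases "u \<in> V")
    case True
    then consider "u \<in> Z" | "u \<in> Y" | "u = p" | "u = r" using V by blast
    then show ?thesis
    proof cases
      case 1
      then have "u \<noteq> y1" "u \<noteq> y2" using y(1,2) dj(1) by auto
      then show ?thesis using z(3)[OF 1] by simp
    next
      case 2
      then have "u \<noteq> z1" "u \<noteq> z2" using z(1,2) dj(1) by auto
      then show ?thesis using y(3)[OF 2] by simp
    qed (use neq diag e(2) in simp_all)
  next
    case False
    then have "u \<noteq> z1" "u \<noteq> z2" "u \<noteq> y1" "u \<noteq> y2" using z(1,2) y(1,2) sub by auto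
    then show ?thesis using mgD(5)[OF mg False] by simp
  qed
  \<comment> \<open>Otherwise \<open>p\<close> has two double edges. So the two new edges are not
    parallel to each other.\<close>
  have nd: "\<not> (z1 = z2 \<and> y1 = y2)"
  proof
    assume "z1 = z2 \<and> y1 = y2"
    then have "m p z1 = 2" "m p y1 = 2" using mp neq by auto
    then show False using no_chain2_degree4[of p z1 y1] neq(1) dp(1) by blast
  qed
  let ?I = "\<lambda>A u. if u \<in> A then 1 else (0::nat)"
  have ewp: "ew m {p} A = ?I A z1 + ?I A z2 + ?I A y1 + ?I A y2" if "finite A" for A
    using that unfolding ew_def by (simp add: mp sum.distrib)
  define W where "W = V - {p}"
  define m' where "m' = add1 (add1 (off m p) z1 y1) z2 y2"
  have inW: "z1 \<in> W" "z2 \<in> W" "y1 \<in> W" "y2 \<in> W" "r \<in> W" using z y neq sub dj unfolding W_def by auto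
  have mg1: "mg W (off m p)" unfolding W_def by (rule mg_off[OF mg])
  have mg2: "mg W (add1 (off m p) z1 y1)" by (rule mg_add1[OF mg1 inW(1,3) neq(1)])
  have mg': "mg W m'" unfolding m'_def by (rule mg_add1[OF mg2 inW(2,4) neq(4)])
  let ?S = "\<lambda>A u w. if (u \<in> A) = (w \<in> A) then 0 else (1::nat)"
  have cut': "cut W m' A = ew m A (W - A) + ?S A z1 y1 + ?S A z2 y2" if A: "A \<subseteq> W" for A
  proof -
    have "V - A - {p} = W - A" unfolding W_def by blast
    then have "cut W (off m p) A = ew m A (W - A)" using cut_off[OF mg, of A p] A unfolding W_def by simp
    then show ?thesis
      unfolding m'_def cut_add1[OF mg2 A inW(2,4) neq(4)] cut_add1[OF mg1 A inW(1,3) neq(1)] by simp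
  qed
  have cutA: "cut V m A = ew m A (W - A) + (?I A z1 + ?I A z2 + ?I A y1 + ?I A y2)"
    "cut V m (insert p A) = ew m A (W - A) + (?I (V - A) z1 + ?I (V - A) z2 + ?I (V - A) y1 + ?I (V - A) y2)"
    if A: "A \<subseteq> W" for A
  proof -
    have e: "V - A - {p} = W - A" "A \<subseteq> V" "p \<notin> A" using A unfolding W_def by auto
    show "cut V m A = ew m A (W - A) + (?I A z1 + ?I A z2 + ?I A y1 + ?I A y2)"
      using cut_remove(1)[OF mg e(2) sub(3) e(3)] ewp[OF finA[OF e(2)]] unfolding e(1) by simp
    show "cut V m (insert p A) = ew m A (W - A) + (?I (V - A) z1 + ?I (V - A) z2 + ?I (V - A) y1 + ?I (V - A) y2)"
      using cut_remove(2)[OF mg e(2) sub(3) e(3)] ewp[of "V - A"] fin unfolding e(1) by simp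
  qed
  have inV: "z1 \<in> V" "z2 \<in> V" "y1 \<in> V" "y2 \<in> V" using inW unfolding W_def by auto
  \<comment> \<open>The set \<open>B \<inter> T\<close> receives one edge from \<open>p\<close> and
    has at least three boundary edges. The others avoid \<open>p\<close> and the part of
    \<open>B\<close> in \<open>T'\<close>, so they end in \<open>W - B\<close>.\<close>
  have half: "2 \<le> ew m (B \<inter> T) (W - B)"
    if B: "B \<subseteq> W" "r \<notin> B" and T: "T = Z \<and> T' = Y \<or> T = Y \<and> T' = Z" and one: "ew m {p} (B \<inter> T) = 1" for B T T'
  proof -
    let ?B = "B \<inter> T"
    have fB: "finite ?B" "finite (B \<inter> T')" "finite (W - B)" using T f fin unfolding W_def by auto
    have BV: "?B \<subseteq> V" using B unfolding W_def by auto
    have "?B \<noteq> {}" using one by auto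
    moreover have "?B \<noteq> V" using B sub(3) unfolding W_def by auto
    ultimately have "3 \<le> cut V m ?B" using conn_cut3[OF conn BV] by blast
    moreover have VB: "V - ?B = insert p ((B \<inter> T') \<union> (W - B))"
      using B T V dj unfolding W_def by blast
    moreover have "cut V m ?B = ew m ?B (insert p ((B \<inter> T') \<union> (W - B)))" unfolding cut_def VB ..
    moreover have "ew m ?B (insert p ((B \<inter> T') \<union> (W - B))) = ew m ?B {p} + ew m ?B ((B \<inter> T') \<union> (W - B))"
      by (rule ew_insert_right) (use fB B in \<open>auto simp: W_def\<close>)
    moreover have "ew m ?B ((B \<inter> T') \<union> (W - B)) = ew m ?B (B \<inter> T') + ew m ?B (W - B)"
      by (rule ew_Un_right) (use fB in auto)
    moreover have "ew m ?B (B \<inter> T') = 0"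
      unfolding ew_def using T ZY0 sym by (intro sum.neutral ballI) (metis IntD2)
    moreover have "ew m ?B {p} = 1" using one ew_commute[OF mg] by metis
    ultimately show ?thesis by linarith
  qed
  have bad: "4 \<le> ew m B (W - B)"
    if B: "B \<subseteq> W" "r \<notin> B" "ew m {p} (B \<inter> Z) = 1" "ew m {p} (B \<inter> Y) = 1" for B
  proof -
    have e: "(B \<inter> Z) \<union> (B \<inter> Y) = B" using B(1,2) V unfolding W_def by blast
    have "ew m ((B \<inter> Z) \<union> (B \<inter> Y)) (W - B) = ew m (B \<inter> Z) (W - B) + ew m (B \<inter> Y) (W - B)"
      by (rule ew_Un_left) (use f dj(1) in auto)
    moreover have "2 \<le> ew m (B \<inter> Z) (W - B)" by (rule half[OF B(1,2) _ B(3), of Y]) simp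
    moreover have "2 \<le> ew m (B \<inter> Y) (W - B)" by (rule half[OF B(1,2) _ B(4), of Z]) simp
    ultimately show ?thesis unfolding e by linarith
  qed
  \<comment> \<open>The critical cuts have one new edge inside \<open>A\<close> and the other
    outside: neither crosses, although \<open>p\<close> contributes two edges on either side. Up to
    complements \<open>r\<close> is outside, and then at least two edges leave the part of
    \<open>A\<close> in \<open>Z\<close> and two the part in \<open>Y\<close>.\<close>
  have badA: "4 \<le> ew m A (W - A)"
    if A: "A \<subseteq> W" "(z1 \<in> A) = (y1 \<in> A)" "(z2 \<in> A) = (y2 \<in> A)" "(z1 \<in> A) \<noteq> (z2 \<in> A)" for A
  proof -
    have one: "ew m {p} (B \<inter> Z) = 1" "ew m {p} (B \<inter> Y) = 1"
      if "(z1 \<in> B) = (y1 \<in> B)" "(z2 \<in> B) = (y2 \<in> B)" "(z1 \<in> B) \<noteq> (z2 \<in> B)" for B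
      using that z(1,2) y(1,2) dj(1) ewp[of "B \<inter> Z"] ewp[of "B \<inter> Y"] f by auto
    show ?thesis
    proof (cases "r \<in> A")
      case False
      then show ?thesis using bad[OF A(1) False] one[OF A(2-4)] by blast
    next
      case True
      let ?B = "W - A"
      have "(z1 \<in> ?B) = (y1 \<in> ?B)" "(z2 \<in> ?B) = (y2 \<in> ?B)" "(z1 \<in> ?B) \<noteq> (z2 \<in> ?B)"
        using A(2-4) inW by auto
      then have "4 \<le> ew m ?B (W - ?B)" using bad[of ?B] one[of ?B] True by blast
      moreover have "W - ?B = A" using A(1) by blast
      ultimately show ?thesis using ew_commute[OF mg, of A ?B] by simp
    qed
  qed
  \<comment> \<open>Apart from the critical cuts, a cut has the same size as one of the two cuts of
    \<open>m\<close> with \<open>p\<close> put back.\<close>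
  have tri: "4 \<le> cut W m' A \<or> cut W m' A = cut V m A \<or> cut W m' A = cut V m (insert p A)" if A: "A \<subseteq> W" for A
  proof (cases "(z1 \<in> A) = (y1 \<in> A) \<and> (z2 \<in> A) = (y2 \<in> A) \<and> (z1 \<in> A) \<noteq> (z2 \<in> A)")
    case True
    then show ?thesis using badA[OF A] cut'[OF A] by auto
  next
    case False
    then show ?thesis unfolding cut'[OF A] cutA[OF A] using inV
      by (cases "z1 \<in> A"; cases "z2 \<in> A"; cases "y1 \<in> A"; cases "y2 \<in> A"; simp)
  qed
  have deg': "deg W m' u = deg V m u" if u: "u \<in> W" for u
  proof -
    have "{u} \<subseteq> W" "u \<in> V" using u unfolding W_def by auto
    then show ?thesis
      using deg_cut[OF mg' u] deg_cut[OF mg, of u] cut'[of "{u}"] cutA(1)[of "{u}"] neq by auto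
  qed
  have connW: "conn W m'"
  proof (rule connI[OF mg' inW(5)])
    show "4 \<le> deg W m' r" using deg'[OF inW(5)] dp(2) by simp
    fix A assume A: "A \<subseteq> W" "A \<noteq> {}" "A \<noteq> W"
    have AV: "A \<subseteq> V" "p \<notin> A" "insert p A \<subseteq> V" using A(1) sub(3) unfolding W_def by auto
    have c1: "V - insert p A = W - A" unfolding W_def by blast
    have "insert p A \<noteq> V" using c1 A by blast
    then have 1: "4 \<le> cut V m (insert p A) \<or> cut V m (insert p A) = 3 \<and> (card (insert p A) = 1 \<or> card (W - A) = 1)"
      using connD[OF conn AV(3)] unfolding c1 by blast
    have "card (insert p A) \<noteq> 1" using A(2) AV finA[OF AV(1)] by simp
    have "card (V - A) \<noteq> 1"
    proof -
      have "V - A = insert p (W - A)" "p \<notin> W - A" using AV sub(3) unfolding W_def by auto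
      moreover have "finite (W - A)" "W - A \<noteq> {}" using A fin unfolding W_def by auto
      ultimately show ?thesis by simp
    qed
    moreover have "A \<noteq> V" using AV sub(3) by blast
    ultimately have 2: "4 \<le> cut V m A \<or> cut V m A = 3 \<and> card A = 1"
      using connD[OF conn AV(1) A(2)] by blast
    show "4 \<le> cut W m' A \<or> cut W m' A = 3 \<and> (card A = 1 \<or> card (W - A) = 1)"
      using tri[OF A(1)]
    proof (elim disjE)
      assume e: "cut W m' A = cut V m A"
      show ?thesis unfolding e using 2 by blast
    next
      assume e: "cut W m' A = cut V m (insert p A)"
      show ?thesis unfolding e using 1 \<open>card (insert p A) \<noteq> 1\<close> by blast
    qed simp
  qed
  have cardW: "card V = card W + 1" using card_Suc_Diff1[OF fin sub(3)] unfolding W_def by linarith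
  have "ew m' W W \<le> ew m V V"
  proof -
    have "ew m' W W = (\<Sum>u\<in>W. deg V m u)" unfolding total_deg using deg' by simp
    also have "\<dots> \<le> (\<Sum>u\<in>V. deg V m u)" unfolding W_def using fin by (intro sum_mono2) auto
    finally show ?thesis unfolding total_deg .
  qed
  then have meas: "card W + ew m' W W < card V + ew m V V" using cardW by linarith
  have zy0: "m z1 y1 = 0" "m z2 y2 = 0" using ZY0 z y by auto
  have m'v: "m' u w = m u w + (if {u, w} = {z1, y1} then 1 else 0) + (if {u, w} = {z2, y2} then 1 else 0)"
    if "u \<noteq> p" "w \<noteq> p" for u w
    using that unfolding m'_def add1_def off_def by auto
  have nw': "\<not> wheeled m'"
  proof
    assume "wheeled m'"
    let ?n = "split m z1 p y1"
    have pz: "1 \<le> m z1 p" "1 \<le> m p y1" using mp[of z1] mp[of y1] sym[of z1 p] by auto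
    have d1: "distinct [z1, p, y1]" using neq by auto
    have offn: "off ?n p = add1 (off m p) z1 y1"
      using neq unfolding split_def off_def add1_def sub1_def by (intro ext) (auto simp: doubleton_eq_iff)
    \<comment> \<open>\<open>z1 = z2\<close> or \<open>y1 = y2\<close> may occur, so the edges left
      for the second splitting are counted after the first.\<close>
    have nz: "?n z2 p = m z2 p - (if z2 = z1 then 1 else 0)" "?n p y2 = m p y2 - (if y2 = y1 then 1 else 0)"
      using neq unfolding split_def add1_def sub1_def by (auto simp: doubleton_eq_iff)
    have "wheeled ?n"
    proof (rule wheeled_suppress[of ?n p z2 y2])
      show "wheeled (add1 (off ?n p) z2 y2)" using \<open>wheeled m'\<close> unfolding offn m'_def .
      show "1 \<le> ?n z2 p" unfolding nz using mp[of z2] sym[of z2 p] by auto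
      show "1 \<le> ?n p y2" unfolding nz using mp[of y2] by auto
    qed (use neq in auto)
    then have "wheeled m" by (rule wheeled.split[OF d1 pz])
    then show False using nw by blast
  qed
  have "5 \<le> card W" using cardW card by simp
  from IH[OF connW this meas nw'] show False
  proof (elim disjE conjE)
    assume "chain3 W m'"
    then obtain a b c where c: "{a, b, c} \<subseteq> W" "a \<noteq> c" "m' a b = 2" "m' b c = 2" "m' a c = 0"
      "deg W m' a = 4" "deg W m' b = 4" "deg W m' c = 4" unfolding chain3_def by blast
    have np: "a \<noteq> p" "b \<noteq> p" "c \<noteq> p" using c(1) unfolding W_def by auto
    \<comment> \<open>The new edges are parallel neither to each other nor to old ones, so the
      double edges of the chain are double in \<open>m\<close> already.\<close>
    have pd: "{z1, y1} \<noteq> {z2, y2}" using nd neq by (auto simp: doubleton_eq_iff)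
    have two: "m u w = 2" if "m' u w = 2" "u \<noteq> p" "w \<noteq> p" for u w
    proof -
      have "m u w = 0" if "{u, w} = {z1, y1} \<or> {u, w} = {z2, y2}"
        using that zy0 sym[of y1 z1] sym[of y2 z2] by (auto simp: doubleton_eq_iff)
      then show ?thesis using m'v[OF that(2,3)] that(1) pd by (auto split: if_splits)
    qed
    show False
    proof (rule chainI[of a b c])
      show "m a c = 0" using m'v[OF np(1,3)] c(5) by simp
    qed (use two c np deg' in auto)
  next
    assume st: "card W = 5" "star5 W m'"
    \<comment> \<open>On five vertices \<open>Z\<close> and \<open>Y\<close> have two elements each,
      and both have boundary 4: two edges to \<open>r\<close> and the two new ones. Disjoint pairs
      of this kind do not exist in \<open>star5\<close>.\<close>
    have W: "W = insert r (Z \<union> Y)" using V dj unfolding W_def by auto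
    have "card W = card Z + card Y + 1" unfolding W using f dj by (simp add: card_Un_disjoint)
    then have c2: "card Z = 2" "card Y = 2" using st(1) cardZ cardY by auto
    have WZ: "Z \<subseteq> W" "Y \<subseteq> W" "W - Z = insert r Y" "W - Y = insert r Z" using W dj by auto
    have "ew m Z (insert r Y) = ew m Z {r} + ew m Z Y" "ew m Y (insert r Z) = ew m Y {r} + ew m Y Z"
      by (rule ew_insert_right; use f dj in auto)+
    then have "ew m Z (W - Z) = 2" "ew m Y (W - Y) = 2"
      unfolding WZ(3,4) using e ew_commute[OF mg, of Z "{r}"] ew_commute[OF mg, of Y "{r}"] ew_commute[OF mg, of Y Z] by auto
    moreover have "z1 \<notin> Y" "z2 \<notin> Y" "y1 \<notin> Z" "y2 \<notin> Z" using z y dj by auto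
    ultimately have c4: "cut W m' Z = 4" "cut W m' Y = 4"
      using cut'[OF WZ(1)] cut'[OF WZ(2)] z y by auto
    obtain b where b: "\<forall>A\<subseteq>W. card A = 2 \<longrightarrow> cut W m' A = 4 \<longrightarrow> b \<in> A"
      using star5_pair[OF st(2) mg'] by blast
    have "b \<in> Z" using b WZ(1) c2(1) c4(1) by simp
    moreover have "b \<in> Y" using b WZ(2) c2(2) c4(2) by simp
    ultimately show False using dj(1) by blast
  qed
qed

text \<open>If the contracted vertex is the middle of the chain, then \<open>Z\<close>, the two ends
  and the remaining vertices form a ring of cuts. If it is an end, the other two form a digon, and
  all further edges of \<open>q\<close> lead into \<open>Z\<close>, where \<open>r\<close> has no
  neighbour.\<close>

lemma no_chain3_contraction:
  assumes "Z \<subseteq> V" "v \<in> Z" "2 \<le> card Z" "4 \<le> card (V - Z)" "chain3 (V - (Z - {v})) (con m Z v)"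
  shows False
proof -
  note c = chain3_con[OF assms(1,2,5)]
  have fZ: "finite Z" by (rule finA[OF assms(1)])
  from c(2) show False
  proof (elim disjE bexE conjE)
    fix p r
    assume p: "p \<in> V - Z" "r \<in> V - Z" "p \<noteq> r" "ew m {p} Z = 2" "ew m {r} Z = 2" "m p r = 0"
      "deg V m p = 4" "deg V m r = 4"
    define Y where "Y = V - Z - {p, r}"
    have fY: "finite Y" using fin unfolding Y_def by auto
    have VZ: "V - Z = insert p (insert r Y)" "p \<notin> insert r Y" "r \<notin> Y" using p(1-3) unfolding Y_def by auto
    have cY: "2 \<le> card Y" using assms(4) fY VZ by simp
    have ins: "ew m A (V - Z) = ew m A {p} + ew m A {r} + ew m A Y" for A
      unfolding VZ(1) using fY VZ(2,3) by (simp add: ew_insert_right[of "insert r Y" p] ew_insert_right[of Y r])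
    have "ew m Z Y = 0"
      using c(1) ins[of Z] p(4,5) ew_commute[OF mg, of Z "{p}"] ew_commute[OF mg, of Z "{r}"] unfolding cut_def by simp
    moreover have "ew m {p} Y = 2"
      using deg_split[OF mg assms(1), of p] ins[of "{p}"] p diag by simp
    moreover have "ew m {r} Y = 2"
      using deg_split[OF mg assms(1), of r] ins[of "{r}"] p diag sym[of r p] by simp
    moreover have "V = Z \<union> Y \<union> {p, r}" using p assms(1) unfolding Y_def by auto
    ultimately show False
      using no_cut_ring[of Z Y p r] p cY assms(3) unfolding Y_def by blast
  next
    fix q r
    assume q: "q \<in> V - Z" "r \<in> V - Z" "ew m {q} Z = 2" "m q r = 2" "ew m {r} Z = 0"
      "deg V m q = 4" "deg V m r = 4"
    have fq: "finite (insert r Z)" "insert r Z \<subseteq> V" using q assms(1) fZ by auto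
    have "ew m {q} (insert r Z) = deg V m q"
      using ew_insert_right[of Z r m "{q}"] q fZ by simp
    then have q0: "m q u = 0" if "u \<notin> insert r Z" for u using deg_zero[OF fq(2)] that by blast
    have r0: "m r u = 0" if "u \<in> Z" for u using q(5) that fZ by (simp add: ew_def)
    show False
    proof (rule no_digon_without_common_neighbour[OF q(4,6,7)])
      show "m q u = 0 \<or> m r u = 0" for u using q0[of u] r0[of u] diag[of r] by (cases "u \<in> insert r Z") auto
    qed
  qed
qed

end

section \<open>Multiple edges at a vertex of degree three or four\<close>

text \<open>For a vertex of degree \<open>d\<close> with \<open>n\<close> parallel edges to one
  neighbour: how the other \<open>d - n\<close> edges distribute, at most one each, over three
  possible neighbours. The last alternative records \<open>d = 4\<close>, for there a chain has to
  be recognised.\<close>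

lemma small_sum3:
  fixes d n i j k :: nat
  assumes "n = 2 \<and> (d = 3 \<or> d = 4) \<or> n = 3 \<and> d = 3" "i \<le> 1" "j \<le> 1" "k \<le> 1" "i + j + k = d - n"
  shows "n = 3 \<and> i = 0 \<and> j = 0 \<and> k = 0 \<or> n = 2 \<and> i = 1 \<and> j = 0 \<and> k = 0 \<or>
    n = 2 \<and> i = 0 \<and> j = 1 \<and> k = 0 \<or> n = 2 \<and> i = 0 \<and> j = 0 \<and> k = 1 \<or>
    n = 2 \<and> i = 1 \<and> j = 1 \<and> k = 0 \<or> n = 2 \<and> i = 1 \<and> j = 0 \<and> k = 1 \<or>
    n = 2 \<and> i = 0 \<and> j = 1 \<and> k = 1 \<and> d = 4"
proof -
  have "i = 0 \<or> i = 1" "j = 0 \<or> j = 1" "k = 0 \<or> k = 1" using assms(2-4) by linarith+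
  then show ?thesis using assms(1,5) by (elim disjE conjE) simp_all
qed

context minimal_counterexample
begin

text \<open>Contract the multiple edge. A chain is excluded, so \<open>V\<close> has six vertices,
  and \<open>w\<close> is attached to a \<open>star5\<close> at \<open>v\<close>, \<open>b\<close>
  or \<open>x\<close>. The other edges of \<open>w\<close> are simple, which leaves few cases; all
  but one are wheels by the lists above.\<close>

lemma no_digon_of_small_degree:
  assumes H: "m a w = 2 \<and> (deg V m w = 3 \<or> deg V m w = 4) \<or> m a w = 3 \<and> deg V m w = 3"
  shows False
proof -
  have V: "a \<in> V" "w \<in> V" "a \<noteq> w" using edgeD[of a w] H by auto
  let ?V = "V - {w}" and ?m = "con m {a, w} a"
  have "chain3 ?V ?m \<or> card V = 6 \<and> star5 ?V ?m"
    by (rule contract_pair[OF V]) (use H in auto)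
  then show False
  proof (elim disjE conjE)
    assume ch: "chain3 ?V ?m"
    have e: "V - ({a, w} - {a}) = V - {w}" using V(3) by blast
    have "card (V - {a, w}) = card V - 2" "card {a, w} = 2" using V fin by (simp_all add: card_Diff_subset)
    then have "4 \<le> card (V - {a, w})" "2 \<le> card {a, w}" using card by linarith+
    then show False using no_chain3_contraction[of "{a, w}" a] V ch unfolding e by blast
  next
    assume st: "star5 ?V ?m"
    have aV: "a \<in> ?V" using V by auto
    have da: "deg ?V ?m a = deg V m a + deg V m w - 2 * m a w" using deg_con_pair[OF mg V aV] by simp
    then have da4: "4 \<le> deg ?V ?m a" using cut_pair_ge4[OF V] by linarith
    obtain v b x y z where c: "distinct [v, b, x, y, z]" "?V = {v, b, x, y, z}"
      "?m v x = 2" "?m v y = 2" "?m v z = 2" "?m b x = 1 \<or> ?m b x = 2" "?m b y = 1" "?m b z = 1"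
      "?m v b = 0" "?m x y = 0" "?m x z = 0" "?m y z = 0"
      "deg ?V ?m v = 6" "deg ?V ?m b = 2 + ?m b x" "deg ?V ?m x = 2 + ?m b x" "deg ?V ?m y = 3" "deg ?V ?m z = 3"
      "a = v \<or> (a = b \<or> a = x) \<and> ?m b x = 2"
      by (rule star5_cases[OF st con_pair_mg[OF V] aV da4])
    have in5: "v \<in> ?V" "b \<in> ?V" "x \<in> ?V" "y \<in> ?V" "z \<in> ?V" unfolding c(2) by auto
    have ND: "distinct [v, b, x, y, z, w]" using c(1) in5 by auto
    have cp: "?m p q = m p q + (if p = a then m w q else 0) + (if q = a then m p w else 0)"
      if "p \<noteq> w" "q \<noteq> w" "p \<noteq> q" for p q by (rule con_pair[OF mg V(3) that])
    have eqs: "m v x + (if v = a then m w x else 0) + (if x = a then m v w else 0) = 2"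
      "m v y + (if v = a then m w y else 0) + (if y = a then m v w else 0) = 2"
      "m v z + (if v = a then m w z else 0) + (if z = a then m v w else 0) = 2"
      "m b x + (if b = a then m w x else 0) + (if x = a then m b w else 0) = ?m b x"
      "m b y + (if b = a then m w y else 0) + (if y = a then m b w else 0) = 1"
      "m b z + (if b = a then m w z else 0) + (if z = a then m b w else 0) = 1"
      "m v b + (if v = a then m w b else 0) + (if b = a then m v w else 0) = 0"
      "m x y + (if x = a then m w y else 0) + (if y = a then m x w else 0) = 0"
      "m x z + (if x = a then m w z else 0) + (if z = a then m x w else 0) = 0"
      using cp[of v x] cp[of v y] cp[of v z] cp[of b x] cp[of b y] cp[of b z] cp[of v b] cp[of x y] cp[of x z] c(3-12) ND
      by simp_all
    have "V = {v, b, x, y, z, w}" using c(2) V by blast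
    then have "deg V m w = (\<Sum>u\<in>{v, b, x, y, z, w}. m w u)" unfolding deg_def by simp
    then have tot: "deg V m w = m w v + m w b + m w x + m w y + m w z" using ND diag by simp
    have sw: "m v w = m w v" "m b w = m w b" "m x w = m w x" "m y w = m w y" "m z w = m w z" by (rule sym)+
    have aw: "m w a = m a w" by (rule sym)
    \<comment> \<open>At most two edges of \<open>w\<close> do not lead to \<open>a\<close>, and a
      second double edge is excluded by \<open>no_chain2_degree4\<close>.\<close>
    have le1: "m w u \<le> 1" if "u \<noteq> a" "u \<in> {v, b, x, y, z}" for u
    proof -
      have "ew m {w} {a, u} \<le> deg V m w" by (rule deg_ge) (use that c(2) V in auto)
      then have "m w a + m w u \<le> deg V m w" using that by (simp add: ew_def)
      moreover have "\<not> (m w a = 2 \<and> m w u = 2 \<and> deg V m w = 4)" using no_chain2_degree4[of w a u] that(1) by auto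
      ultimately show ?thesis using H aw by auto
    qed
    consider "a = v" | "a = b" "?m b x = 2" | "a = x" "?m b x = 2" using c(18) by blast
    then show False
    proof cases
      case 1
      have ne: "b \<noteq> a" "x \<noteq> a" "y \<noteq> a" "z \<noteq> a" using 1 c(1) by auto
      have F: "m v x + m w x = 2" "m v y + m w y = 2" "m v z + m w z = 2" "1 \<le> m b x" "m b y = 1" "m b z = 1"
        "m w b = 0" "m a w = m v w"
        using eqs ne 1 c(6) by auto
      have L: "m w x \<le> 1" "m w y \<le> 1" "m w z \<le> 1" using le1 ne by auto
      have S: "m w x + m w y + m w z = deg V m w - m a w" using tot F sw by linarith
      consider "m a w = 3" "m w x = 0" "m w y = 0" "m w z = 0"
        | "m a w = 2" "m w x = 1" "m w y = 0" "m w z = 0" | "m a w = 2" "m w x = 0" "m w y = 1" "m w z = 0"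
        | "m a w = 2" "m w x = 0" "m w y = 0" "m w z = 1" | "m a w = 2" "m w x = 1" "m w y = 1" "m w z = 0"
        | "m a w = 2" "m w x = 1" "m w y = 0" "m w z = 1" | "m a w = 2" "m w x = 0" "m w y = 1" "m w z = 1"
        using small_sum3[OF H L S] by (elim disjE conjE) simp_all
      then have "wheeled m"
      proof cases
        case 1
        show ?thesis by (rule wheeled_six_Tv[of m v b x y z w]; (rule sym | use F sw 1 in linarith | use ND in auto))
      next
        case 2
        show ?thesis by (rule wheeled_six_A1[of m v b x y z w]; (rule sym | use F sw 2 in linarith | use ND in auto))
      next
        case 3
        show ?thesis by (rule wheeled_six_A1[of m v b y x z w]; (rule sym | use F sw 3 in linarith | use ND in auto))
      next
        case 4
        show ?thesis by (rule wheeled_six_A1[of m v b z x y w]; (rule sym | use F sw 4 in linarith | use ND in auto))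
      next
        case 5
        show ?thesis by (rule wheeled_six_A2[of m v b x y z w]; (rule sym | use F sw 5 in linarith | use ND in auto))
      next
        case 6
        show ?thesis by (rule wheeled_six_A2[of m v b x z y w]; (rule sym | use F sw 6 in linarith | use ND in auto))
      next
        case 7
        show ?thesis by (rule wheeled_six_A2[of m v b y z x w]; (rule sym | use F sw 7 in linarith | use ND in auto))
      qed
      then show False using nw by blast
    next
      case 2
      have ne: "v \<noteq> a" "x \<noteq> a" "y \<noteq> a" "z \<noteq> a" using 2 c(1) by auto
      have F: "m v x = 2" "m v y = 2" "m v z = 2" "m b x + m w x = 2" "m b y + m w y = 1" "m b z + m w z = 1"
        "m v w = 0" "m a w = m b w"
        using eqs ne 2 by simp_all
      have L: "m w x \<le> 1" "m w y \<le> 1" "m w z \<le> 1" using le1 ne by auto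
      have S: "m w x + m w y + m w z = deg V m w - m a w" using tot F sw by linarith
      consider "m a w = 3" "m w x = 0" "m w y = 0" "m w z = 0"
        | "m a w = 2" "m w x = 1" "m w y = 0" "m w z = 0" | "m a w = 2" "m w x = 0" "m w y = 1" "m w z = 0"
        | "m a w = 2" "m w x = 0" "m w y = 0" "m w z = 1" | "m a w = 2" "m w x = 1" "m w y = 1" "m w z = 0"
        | "m a w = 2" "m w x = 1" "m w y = 0" "m w z = 1"
        | "m a w = 2" "m w x = 0" "m w y = 1" "m w z = 1" "deg V m w = 4"
        using small_sum3[OF H L S] by (elim disjE conjE) simp_all
      then have "wheeled m"
      proof cases
        case 1
        show ?thesis by (rule wheeled_six_Tb[of m v b x y z w]; (rule sym | use F sw 1 in linarith | use ND in auto))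
      next
        case 2
        show ?thesis by (rule wheeled_six_B1[of m v b x y z w]; (rule sym | use F sw 2 in linarith | use ND in auto))
      next
        case 3
        show ?thesis by (rule wheeled_six_B2[of m v b x y z w]; (rule sym | use F sw 3 in linarith | use ND in auto))
      next
        case 4
        show ?thesis by (rule wheeled_six_B2[of m v b x z y w]; (rule sym | use F sw 4 in linarith | use ND in auto))
      next
        case 5
        show ?thesis by (rule wheeled_six_B3[of m v b x y z w]; (rule sym | use F sw 5 in linarith | use ND in auto))
      next
        case 6
        show ?thesis by (rule wheeled_six_B3[of m v b x z y w]; (rule sym | use F sw 6 in linarith | use ND in auto))
      next
        case 7
        \<comment> \<open>Here \<open>x\<close>, \<open>b\<close>, \<open>w\<close> all have degree
          4, and the double edges \<open>x b\<close> and \<open>b w\<close> form a chain.\<close>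
        have "deg V m x = 4" using deg_con_pair[OF mg V in5(3)] ne c(15) 2 by simp
        moreover have "deg V m b = 4" using da c(14) 2 7 by simp
        ultimately have False
          using chainI[of x b w] F 7 sw sym[of x b] ND by auto
        then show ?thesis ..
      qed
      then show False using nw by blast
    next
      case 3
      have ne: "v \<noteq> a" "b \<noteq> a" "y \<noteq> a" "z \<noteq> a" using 3 c(1) by auto
      have F: "m v x + m w v = 2" "m v y = 2" "m v z = 2" "m b x + m w b = 2" "m b y = 1" "m b z = 1"
        "m w y = 0" "m w z = 0" "m a w = m x w"
        using eqs ne 3 sw by simp_all
      have L: "m w v \<le> 1" "m w b \<le> 1" using le1 ne by auto
      have S: "m w v + m w b + 0 = deg V m w - m a w" using tot F sw by linarith
      have D: "m a w = 3 \<and> m w v = 0 \<and> m w b = 0 \<or> m a w = 2 \<and> m w v = 1 \<and> m w b = 0 \<or>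
          m a w = 2 \<and> m w v = 0 \<and> m w b = 1 \<or> m a w = 2 \<and> m w v = 1 \<and> m w b = 1"
        using small_sum3[OF H L le0 S] zero_neq_one by blast
      consider "m a w = 3" "m w v = 0" "m w b = 0" | "m a w = 2" "m w v = 1" "m w b = 0"
        | "m a w = 2" "m w v = 0" "m w b = 1" | "m a w = 2" "m w v = 1" "m w b = 1"
        using D by (elim disjE conjE; simp only: simp_thms)
      then have "wheeled m"
      proof cases
        case 1
        show ?thesis by (rule wheeled_six_Tx[of m v b x y z w]; (rule sym | use F sw 1 in linarith | use ND in auto))
      next
        case 2
        show ?thesis by (rule wheeled_six_X1[of m v b x y z w]; (rule sym | use F sw 2 in linarith | use ND in auto))
      next
        case 3
        show ?thesis by (rule wheeled_six_X2[of m v b x y z w]; (rule sym | use F sw 3 in linarith | use ND in auto))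
      next
        case 4
        show ?thesis by (rule wheeled_six_X3[of m v b x y z w]; (rule sym | use F sw 4 in linarith | use ND in auto))
      qed
      then show False using nw by blast
    qed
  qed
qed

section \<open>Nontrivial cuts of size four\<close>

text \<open>Every set between \<open>{u}\<close> and \<open>Z\<close> has boundary at least 4, so
  with four vertices outside, \<open>Z\<close> may be contracted onto \<open>u\<close>. A chain is
  excluded. In \<open>star5\<close> the contracted vertex has degree 4, so it is neither
  \<open>v\<close> nor \<open>y\<close>, and the double edge from \<open>v\<close> to the cubic
  vertex \<open>y\<close> is present in \<open>m\<close>, against
  \<open>no_digon_of_small_degree\<close>.\<close>

lemma opposite_le3:
  assumes "Z \<subseteq> V" "u \<in> Z" "4 \<le> deg V m u" "cut V m Z = 4" "2 \<le> card Z"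
  shows "card (V - Z) \<le> 3"
proof (rule ccontr)
  assume n: "\<not> card (V - Z) \<le> 3"
  let ?V = "V - (Z - {u})" and ?m = "con m Z u"
  have fZ: "finite Z" by (rule finA[OF assms(1)])
  have "chain3 ?V ?m \<or> card (V - Z) = 4 \<and> star5 ?V ?m"
  proof (rule contract[OF assms(1,2,5)])
    fix Y assume Y: "u \<in> Y" "Y \<subseteq> Z"
    show "cut V m Z \<le> cut V m Y"
    proof (cases "Y = {u}")
      case True
      then show ?thesis using assms deg_cut[OF mg, of u] by auto
    next
      case False
      have fY: "finite Y" using Y(2) fZ finite_subset by blast
      have "{u} \<subset> Y" using Y False by blast
      then have "card {u} < card Y" by (rule psubset_card_mono[OF fY])
      moreover have "card (V - Z) \<le> card (V - Y)" by (rule card_mono) (use fin Y in auto)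
      ultimately show ?thesis using conn_cut4[OF conn, of Y] Y assms(1,4) n by auto
    qed
  qed (use n assms in auto)
  then show False
  proof (elim disjE conjE)
    assume "chain3 ?V ?m"
    then show False using no_chain3_contraction[OF assms(1,2,5)] n by simp
  next
    assume st: "star5 ?V ?m"
    have uV: "u \<in> ?V" using assms by auto
    have du: "deg ?V ?m u = 4" using deg_con[OF mg assms(1,2) uV] assms(4) by simp
    obtain v b x y z where c: "distinct [v, b, x, y, z]" "?V = {v, b, x, y, z}" "?m v y = 2"
      "deg ?V ?m v = 6" "deg ?V ?m y = 3" "u = v \<or> (u = b \<or> u = x) \<and> ?m b x = 2"
      by (rule star5_cases[OF st mg_con[OF mg assms(1,2)] uV]) (use du in auto)
    have ne: "v \<noteq> u" "y \<noteq> u" "v \<noteq> y" using c du by auto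
    have in5: "v \<in> ?V" "y \<in> ?V" unfolding c(2) by auto
    have "m v y = 2" using c(3) ne in5 unfolding con_def by auto
    moreover have "deg V m y = 3" using deg_con[OF mg assms(1,2) in5(2)] ne c(5) by simp
    ultimately show False using no_digon_of_small_degree[of v y] by blast
  qed
qed

text \<open>A side with a vertex of degree at least 4 bounds the other side by 3, and such a side
  exists. A side of cubic vertices has even size by parity, hence exactly two vertices; if neither
  side is cubic, both have at most three, hence exactly three.\<close>

lemma cut4_cases:
  assumes "X \<subseteq> V" "cut V m X = 4" "2 \<le> card X" "2 \<le> card (V - X)"
  shows "card X = 2 \<and> (\<forall>x\<in>X. deg V m x = 3) \<or> card (V - X) = 2 \<and> (\<forall>x\<in>V - X. deg V m x = 3) \<or>
    card V = 6 \<and> card X = 3"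
proof -
  have cc: "card X + card (V - X) = card V"
    using card_Diff_subset[OF finA[OF assms(1)] assms(1)] card_mono[OF fin assms(1)] by simp
  have cubic2: "card Y = 2 \<and> (\<forall>x\<in>Y. deg V m x = 3)"
    if Y: "Y \<subseteq> V" "cut V m Y = 4" "2 \<le> card Y" "card Y \<le> 3" and cub: "\<forall>x\<in>Y. deg V m x = 3" for Y
  proof -
    have "(\<Sum>x\<in>Y. deg V m x) = 3 * card Y" using cub by simp
    then have "3 * card Y = ew m Y Y + 4" using deg_sum[OF mg Y(1)] Y(2) by simp
    moreover have "even (ew m Y Y)" by (rule even_total[OF finA[OF Y(1)] mg])
    ultimately have "even (3 * card Y)" by simp
    then have "card Y \<noteq> 3" by auto
    then show ?thesis using Y cub by auto
  qed
  obtain t where t: "t \<in> V" "4 \<le> deg V m t" using conn unfolding conn_def by blast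
  have cV: "cut V m (V - X) = 4" "V - X \<subseteq> V" "V - (V - X) = X" using cut_compl[OF mg assms(1)] assms(1,2) by auto
  have noncubic: "\<exists>x\<in>Y. 4 \<le> deg V m x" if Y: "\<not> (\<forall>x\<in>Y. deg V m x = 3)" "Y \<subseteq> V" for Y
  proof -
    obtain x where x: "x \<in> Y" "deg V m x \<noteq> 3" using Y(1) by blast
    have "3 \<le> deg V m x" by (rule deg_ge3) (use x(1) Y(2) in blast)
    then have "4 \<le> deg V m x" using x(2) by linarith
    then show ?thesis using x(1) by blast
  qed
  show ?thesis
  proof (cases "\<exists>x\<in>X. 4 \<le> deg V m x")
    case True
    then have 1: "card (V - X) \<le> 3" using opposite_le3[OF assms(1) _ _ assms(2,3)] by blast
    show ?thesis
    proof (cases "\<exists>x\<in>V - X. 4 \<le> deg V m x")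
      case True
      then have "card X \<le> 3" using opposite_le3[OF cV(2) _ _ cV(1) assms(4)] cV(3) by auto
      then show ?thesis using 1 cc card by auto
    next
      case False
      then have "\<forall>x\<in>V - X. deg V m x = 3" using noncubic[of "V - X"] by blast
      then show ?thesis using cubic2[OF cV(2,1) assms(4) 1] by blast
    qed
  next
    case False
    then have cX: "\<forall>x\<in>X. deg V m x = 3" using noncubic[of X] assms(1) by blast
    have "t \<in> V - X" using t False by blast
    then have "card X \<le> 3" using opposite_le3[OF cV(2) _ t(2) cV(1) assms(4)] cV(3) by auto
    then show ?thesis using cubic2[OF assms(1,2,3) _ cX] by blast
  qed
qed

section \<open>Deleting edges and suppressing cubic vertices\<close>

text \<open>If no such cut separates the ends, deleting \<open>uz\<close> keeps the cut conditions.
  The vertex \<open>t\<close> keeps degree at least 4; the summand 1 is the edge it loses as an end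
  of \<open>uz\<close>. The smaller graph then has a chain, whose double edges contradict what is
  known about \<open>m\<close>.\<close>

lemma delete_edge:
  assumes uz: "1 \<le> m u z" "4 \<le> deg V m u" "4 \<le> deg V m z"
    and t: "t \<in> V" "4 + (if t = u \<or> t = z then 1 else 0) \<le> deg V m t"
  shows "\<exists>X\<subseteq>V. z \<in> X \<and> u \<notin> X \<and> cut V m X = 4 \<and> 2 \<le> card X \<and> 2 \<le> card (V - X)"
proof (rule ccontr)
  assume no: "\<not> ?thesis"
  define m' where "m' = sub1 m u z"
  have V: "u \<in> V" "z \<in> V" "u \<noteq> z" using mg_edge[OF mg uz(1)] by auto
  have mg': "mg V m'" unfolding m'_def by (rule mg_sub1[OF mg])
  have c: "cut V m A = cut V m' A + (if (u \<in> A) = (z \<in> A) then 0 else 1)" if "A \<subseteq> V" for A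
    unfolding m'_def by (rule cut_sub1[OF mg that uz(1)])
  have no4: "cut V m A \<noteq> 4" if A: "A \<subseteq> V" "(u \<in> A) \<noteq> (z \<in> A)" "2 \<le> card A" "2 \<le> card (V - A)" for A
  proof (cases "z \<in> A")
    case True
    then show ?thesis using no A by blast
  next
    case False
    have "V - (V - A) = A" using A(1) by blast
    then show ?thesis using no A False V cut_compl[OF mg A(1)] by (metis DiffD2 DiffI Diff_subset)
  qed
  have deg': "deg V m x = deg V m' x + (if x = u \<or> x = z then 1 else 0)" if "x \<in> V" for x
    using c[of "{x}"] deg_cut[OF mg that] deg_cut[OF mg' that] that V(3) by auto
  have "conn V m'"
  proof (rule connI[OF mg' t(1)])
    show "4 \<le> deg V m' t" using deg'[OF t(1)] t(2) by (simp split: if_splits)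
    fix A assume A: "A \<subseteq> V" "A \<noteq> {}" "A \<noteq> V"
    note D = connD[OF conn A]
    show "4 \<le> cut V m' A \<or> cut V m' A = 3 \<and> (card A = 1 \<or> card (V - A) = 1)"
    proof (cases "(u \<in> A) = (z \<in> A)")
      case True
      then show ?thesis using c[OF A(1)] D by simp
    next
      case False
      have f: "finite A" "finite (V - A)" using A(1) finA fin by auto
      have ge1: "card A \<noteq> 0" "card (V - A) \<noteq> 0" using f A by auto
      have "4 \<le> cut V m A"
      proof (cases "card A = 1 \<or> card (V - A) = 1")
        case True
        then have "\<exists>x. (x = u \<or> x = z) \<and> cut V m A = cut V m {x}"
        proof
          assume "card A = 1"
          then obtain x where x: "A = {x}" by (rule card_1_singletonE)
          have "x = u \<or> x = z" using False unfolding x by auto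
          then show ?thesis unfolding x by blast
        next
          assume "card (V - A) = 1"
          then obtain x where x: "V - A = {x}" by (rule card_1_singletonE)
          have "u \<in> V - A \<or> z \<in> V - A" using False V by simp
          then have "x = u \<or> x = z" unfolding x by auto
          moreover have "cut V m A = cut V m {x}" using cut_compl[OF mg A(1)] unfolding x by simp
          ultimately show ?thesis by blast
        qed
        then obtain x where "x = u \<or> x = z" "cut V m A = cut V m {x}" by blast
        then show ?thesis using deg_cut[OF mg V(1)] deg_cut[OF mg V(2)] uz(2,3) by (elim disjE) simp_all
      next
        case False
        then show ?thesis using D by blast
      qed
      moreover have "cut V m A \<noteq> 4" if "\<not> (card A = 1 \<or> card (V - A) = 1)"
        by (rule no4[OF A(1) False]) (use that ge1 in linarith)+
      ultimately show ?thesis using c[OF A(1)] False by (simp split: if_splits) linarith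
    qed
  qed
  moreover have "card V + ew m' V V < card V + ew m V V"
    using total_sub1[OF mg uz(1)] unfolding m'_def by linarith
  moreover have "\<not> wheeled m'"
    using nw wheeled_mono[of m' m] unfolding m'_def by (meson sub1_le)
  ultimately have "chain3 V m'" using IH[of V m'] card by auto
  then obtain p q r where r: "{p, q, r} \<subseteq> V" "p \<noteq> r" "m' p q = 2" "m' q r = 2" "m' p r = 0"
    "deg V m' p = 4" "deg V m' q = 4" "deg V m' r = 4" unfolding chain3_def by blast
  have keep: "m x y = m' x y" if "{x, y} \<noteq> {u, z}" for x y
    using that unfolding m'_def sub1_def by simp
  have qq: "q \<noteq> p" "q \<noteq> r" using r(3,4) mgD(3)[OF mg'] by auto
  show False
  proof (cases "q = u \<or> q = z")
    case False
    then have "{q, p} \<noteq> {u, z}" "{q, r} \<noteq> {u, z}" by (auto simp: doubleton_eq_iff)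
    then have "m q p = 2" "m q r = 2" using keep r(3,4) mgD(2)[OF mg', of q p] by auto
    then show False using no_chain2_degree4[of q p r] r(1,2,7) deg'[of q] False by auto
  next
    case True
    \<comment> \<open>\<open>q\<close> is an end of the deleted edge and \<open>q'\<close> the other
      end. Some end \<open>s\<close> of the chain differs from \<open>q'\<close>, so it has degree 4
      in \<open>m\<close> too, and the double edge \<open>q s\<close> is excluded.\<close>
    define q' where "q' = (if q = u then z else u)"
    have q': "{u, z} = {q, q'}" using True V(3) unfolding q'_def by auto
    obtain s where s: "s \<in> {p, r}" "s \<noteq> q'" using r(2) by blast
    have "s \<noteq> q" using s qq by auto
    have "{q, s} \<noteq> {u, z}" unfolding q' using s(2) \<open>s \<noteq> q\<close> by (auto simp: doubleton_eq_iff)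
    then have "m q s = 2" using keep[of q s] s r(3,4) mgD(2)[OF mg', of q p] by auto
    moreover have "s \<noteq> u" "s \<noteq> z" using s(2) \<open>s \<noteq> q\<close> True unfolding q'_def by auto
    then have "deg V m s = 4" using deg'[of s] s(1) r by auto
    ultimately show False using no_digon_of_small_degree[of q s] by blast
  qed
qed

text \<open>The edge \<open>uz\<close> is deleted, and \<open>z\<close>, then of degree 2, is
  replaced by an edge between its other neighbours \<open>p\<close> and \<open>q\<close>. Only a cut
  of size 4 with \<open>z\<close>, \<open>p\<close>, \<open>q\<close> on one side and
  \<open>u\<close> on the other can become a forbidden cut of size 3, whence
  \<open>3 \<le> card X\<close>.\<close>

lemma suppress_cubic:
  assumes uz: "1 \<le> m u z" "4 \<le> deg V m u" "deg V m z = 3"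
    and t: "5 \<le> deg V m u \<or> (\<exists>t\<in>V. t \<noteq> u \<and> 4 \<le> deg V m t)"
  shows "\<exists>X\<subseteq>V. z \<in> X \<and> u \<notin> X \<and> cut V m X = 4 \<and> 3 \<le> card X \<and> 2 \<le> card (V - X)"
proof (rule ccontr)
  assume no: "\<not> ?thesis"
  have V: "u \<in> V" "z \<in> V" "u \<noteq> z" using mg_edge[OF mg uz(1)] by auto
  have le1: "m z x \<le> 1" for x
  proof -
    have "m z x \<le> deg V m z"
      using deg_ge[of "{x}" z] mgD(5)[OF mg, of x z] by (cases "x \<in> V") auto
    moreover have "m x z \<noteq> 2" "m x z \<noteq> 3" using no_digon_of_small_degree[of x z] uz(3) by auto
    ultimately show ?thesis using uz(3) sym[of x z] by auto
  qed
  have zu: "m z u = 1" using le1[of u] uz(1) sym[of u z] by auto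
  have "sum (m z) (V - {u}) = 2"
    using uz(3) zu sum.remove[OF fin V(1), of "m z"] unfolding deg_def by simp
  then obtain p q where pq: "p \<in> V - {u}" "q \<in> V - {u}"
    "\<And>x. x \<in> V - {u} \<Longrightarrow> m z x = (if x = p then 1 else 0) + (if x = q then 1 else 0)"
    using sum2_ex[of "V - {u}" "m z"] fin by (metis finite_Diff)
  have pnq: "p \<noteq> q" using pq(3)[OF pq(1)] le1[of p] by auto
  have zpq: "m z p = 1" "m z q = 1" using pq(3)[OF pq(1)] pq(3)[OF pq(2)] pnq by auto
  have ne: "p \<noteq> z" "q \<noteq> z" "p \<noteq> u" "q \<noteq> u" using zpq diag pq(1,2) by auto
  have mz: "m z x = (if x = u then 1 else 0) + (if x = p then 1 else 0) + (if x = q then 1 else 0)" for x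
  proof (cases "x \<in> V - {u}")
    case True
    then show ?thesis using pq(3)[OF True] by auto
  next
    case False
    then show ?thesis using zu ne pq(1,2) mgD(5)[OF mg, of x z] by auto
  qed
  define W m' where "W = V - {z}" and "m' = add1 (off m z) p q"
  have inW: "p \<in> W" "q \<in> W" "u \<in> W" using pq(1,2) ne V unfolding W_def by auto
  have mg1: "mg W (off m z)" unfolding W_def by (rule mg_off[OF mg])
  have mg': "mg W m'" unfolding m'_def by (rule mg_add1[OF mg1 inW(1,2) pnq])
  let ?I = "\<lambda>A u. if u \<in> A then 1 else (0::nat)"
  have ewz: "ew m {z} A = ?I A u + ?I A p + ?I A q" if "finite A" for A
    using that unfolding ew_def by (simp add: mz sum.distrib)
  have cut': "cut W m' A = ew m A (W - A) + (if (p \<in> A) = (q \<in> A) then 0 else 1)" if A: "A \<subseteq> W" for A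
  proof -
    have "V - A - {z} = W - A" unfolding W_def by blast
    then have "cut W (off m z) A = ew m A (W - A)" using cut_off[OF mg, of A z] A unfolding W_def by simp
    then show ?thesis unfolding m'_def cut_add1[OF mg1 A inW(1,2) pnq] by simp
  qed
  have cutA: "cut V m A = ew m A (W - A) + (?I A u + ?I A p + ?I A q)"
    "cut V m (insert z A) = ew m A (W - A) + (?I (V - A) u + ?I (V - A) p + ?I (V - A) q)"
    if A: "A \<subseteq> W" for A
  proof -
    have e: "V - A - {z} = W - A" "A \<subseteq> V" "z \<notin> A" using A unfolding W_def by auto
    show "cut V m A = ew m A (W - A) + (?I A u + ?I A p + ?I A q)"
      using cut_remove(1)[OF mg e(2) V(2) e(3)] ewz[OF finA[OF e(2)]] unfolding e(1) by simp
    show "cut V m (insert z A) = ew m A (W - A) + (?I (V - A) u + ?I (V - A) p + ?I (V - A) q)"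
      using cut_remove(2)[OF mg e(2) V(2) e(3)] ewz[of "V - A"] fin unfolding e(1) by simp
  qed
  have deg': "deg V m x = deg W m' x + (if x = u then 1 else 0)" if x: "x \<in> W" for x
  proof -
    have "{x} \<subseteq> W" "x \<in> V" using x unfolding W_def by auto
    then show ?thesis
      using deg_cut[OF mg' x] deg_cut[OF mg, of x] cut'[of "{x}"] cutA(1)[of "{x}"] ne pnq by auto
  qed
  have side: "4 \<le> cut W m' A \<or> cut W m' A = 3 \<and> (card A = 1 \<or> card (W - A) = 1)"
    if A: "A \<subseteq> W" "A \<noteq> {}" "u \<notin> A" for A
  proof -
    have AV: "A \<subseteq> V" "z \<notin> A" "A \<noteq> V" "insert z A \<subseteq> V" "u \<notin> insert z A" using A V unfolding W_def by auto
    have fA: "finite A" by (rule finA[OF AV(1)])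
    \<comment> \<open>If \<open>A\<close> does not contain both \<open>p\<close> and
      \<open>q\<close>, its cut is the one in \<open>m\<close> with \<open>z\<close> on the side of
      \<open>u\<close>. Otherwise \<open>z\<close> joins \<open>A\<close>, and the lost edge
      \<open>uz\<close> makes the only difference.\<close>
    show ?thesis
    proof (cases "p \<in> A \<and> q \<in> A")
      case False
      have e: "cut W m' A = cut V m A" using cut'[OF A(1)] cutA(1)[OF A(1)] A(3) False by auto
      have "card {u, z} \<le> card (V - A)" by (rule card_mono) (use fin V A(3) AV(2) in auto)
      then have "card (V - A) \<noteq> 1" using V(3) by simp
      then show ?thesis unfolding e using connD[OF conn AV(1) A(2) AV(3)] by blast
    next
      case True
      have e: "cut V m (insert z A) = cut W m' A + 1"
        using cut'[OF A(1)] cutA(2)[OF A(1)] A(3) True V by auto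
      have WA: "V - insert z A = W - A" unfolding W_def by blast
      have "card {p, q, z} \<le> card (insert z A)" by (rule card_mono) (use fA True in auto)
      then have c3: "3 \<le> card (insert z A)" using pnq ne by simp
      have "card {u} \<le> card (W - A)" by (rule card_mono) (use fin inW A(3) in \<open>auto simp: W_def\<close>)
      then have c1: "1 \<le> card (W - A)" by simp
      show ?thesis
      proof (cases "card (W - A) = 1")
        case True
        then obtain x where x: "W - A = {x}" using card_1_singletonE by blast
        have "u \<in> W - A" using inW(3) A(3) by (rule DiffI)
        then have "W - A = {u}" unfolding x by simp
        then have "cut V m (insert z A) = cut V m {u}" using cut_compl[OF mg AV(4)] WA by simp
        then show ?thesis using e uz(2) deg_cut[OF mg V(1)] True by linarith
      next
        case False
        then have "2 \<le> card (V - insert z A)" unfolding WA using c1 by linarith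
        then have "4 \<le> cut V m (insert z A)" "cut V m (insert z A) \<noteq> 4"
          using conn_cut4[OF conn AV(4)] c3 no AV(4,5) by auto
        then show ?thesis using e by linarith
      qed
    qed
  qed
  \<comment> \<open>Only \<open>u\<close> loses an edge: either it has one to spare or another
    noncubic vertex takes its place.\<close>
  have nc': "\<exists>t\<in>W. 4 \<le> deg W m' t"
  proof (cases "5 \<le> deg V m u")
    case True
    then show ?thesis using deg'[OF inW(3)] inW(3) by auto
  next
    case False
    then obtain t where t: "t \<in> V" "t \<noteq> u" "4 \<le> deg V m t" using t by blast
    then have "t \<in> W" using uz(3) unfolding W_def by auto
    then show ?thesis using deg'[of t] t by auto
  qed
  then obtain t where t: "t \<in> W" "4 \<le> deg W m' t" by blast
  have connW: "conn W m'"
  proof (rule connI[OF mg' t])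
    fix A assume A: "A \<subseteq> W" "A \<noteq> {}" "A \<noteq> W"
    show "4 \<le> cut W m' A \<or> cut W m' A = 3 \<and> (card A = 1 \<or> card (W - A) = 1)"
    proof (cases "u \<in> A")
      case False
      then show ?thesis using side A by blast
    next
      case True
      have "W - (W - A) = A" "W - A \<noteq> {}" using A by auto
      then show ?thesis using side[of "W - A"] True cut_compl[OF mg' A(1)] by auto
    qed
  qed
  have cardW: "card V = card W + 1" using card_Suc_Diff1[OF fin V(2)] unfolding W_def by linarith
  have "ew m' W W \<le> ew m V V"
  proof -
    have "ew m' W W \<le> (\<Sum>x\<in>W. deg V m x)" unfolding total_deg using deg' by (intro sum_mono) simp
    also have "\<dots> \<le> (\<Sum>x\<in>V. deg V m x)" unfolding W_def using fin by (intro sum_mono2) auto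
    finally show ?thesis unfolding total_deg .
  qed
  then have meas: "card W + ew m' W W < card V + ew m V V" using cardW by linarith
  have nw': "\<not> wheeled m'"
  proof
    assume "wheeled m'"
    then have "wheeled m" unfolding m'_def
      by (rule wheeled_suppress) (use zpq ne pnq sym[of p z] in auto)
    then show False using nw by blast
  qed
  have m'v: "m' x y = m x y + (if {x, y} = {p, q} then 1 else 0)" if "x \<noteq> z" "y \<noteq> z" for x y
    using that unfolding m'_def add1_def off_def by auto
  have "5 \<le> card W" using cardW card by simp
  from IH[OF connW this meas nw'] show False
  proof (elim disjE conjE)
    assume "chain3 W m'"
    then obtain a b c where c: "{a, b, c} \<subseteq> W" "a \<noteq> c" "m' a b = 2" "m' b c = 2"
      "deg W m' a = 4" "deg W m' b = 4" "deg W m' c = 4" unfolding chain3_def by blast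
    \<comment> \<open>At most one of the double edges of the chain involves \<open>pq\<close>. The
      other is double in \<open>m\<close>, and one of its ends differs from \<open>u\<close> and so
      has degree 4 there.\<close>
    have link: False if "x \<in> W" "y \<in> W" "m' x y = 2" "{x, y} \<noteq> {p, q}" "deg W m' x = 4" "deg W m' y = 4" for x y
    proof -
      have "m x y = 2" using m'v[of x y] that unfolding W_def by auto
      moreover have "x \<noteq> y" using that(3) mgD(3)[OF mg'] by auto
      moreover have "deg V m x = 4 \<or> deg V m y = 4" using deg'[of x] deg'[of y] that \<open>x \<noteq> y\<close> by auto
      ultimately show False using no_digon_of_small_degree[of x y] no_digon_of_small_degree[of y x] sym[of x y] by auto
    qed
    have "{a, b} \<noteq> {p, q} \<or> {b, c} \<noteq> {p, q}" using c(2) by (auto simp: doubleton_eq_iff)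
    then show False using link[of a b] link[of b c] c by auto
  next
    assume st: "star5 W m'"
    obtain v b x y w where c: "distinct [v, b, x, y, w]" "W = {v, b, x, y, w}"
      "m' v x = 2" "m' v y = 2" "m' v w = 2" "m' b x = 1 \<or> m' b x = 2" "m' b y = 1" "m' b w = 1"
      "m' v b = 0" "m' x y = 0" "m' x w = 0" "m' y w = 0"
      using st unfolding star5_def by blast
    \<comment> \<open>Weakening to lower bounds makes \<open>x\<close>, \<open>y\<close>,
      \<open>w\<close> interchangeable, although \<open>m' b x\<close> may be 2.\<close>
    have lb: "distinct [v, b, x, y, w] \<and> W = {v, b, x, y, w} \<and> 2 \<le> m' v x \<and> 2 \<le> m' v y \<and> 2 \<le> m' v w \<and>
      1 \<le> m' b x \<and> 1 \<le> m' b y \<and> 1 \<le> m' b w" using c by auto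
    have nz: "m' p q \<noteq> 0" using m'v[OF ne(1,2)] by simp
    have pin: "p = v \<or> p = b \<or> p = x \<or> p = y \<or> p = w" "q = v \<or> q = b \<or> q = x \<or> q = y \<or> q = w"
      using inW(1,2) unfolding c(2) by blast+
    have Z0: "m' b v = 0" "m' y x = 0" "m' w x = 0" "m' w y = 0"
      using c(9-12) mgD(2)[OF mg', of b v] mgD(2)[OF mg', of y x] mgD(2)[OF mg', of w x] mgD(2)[OF mg', of w y]
      by linarith+
    have "{p, q} = {v, x} \<or> {p, q} = {v, y} \<or> {p, q} = {v, w} \<or>
        {p, q} = {b, x} \<or> {p, q} = {b, y} \<or> {p, q} = {b, w}"
      using pin(1)
    proof (elim disjE)
      assume e: "p = v"
      then have "q = x \<or> q = y \<or> q = w" using pin(2) nz pnq c(9) by metis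
      then show ?thesis unfolding e by blast
    next
      assume e: "p = b"
      then have "q = x \<or> q = y \<or> q = w" using pin(2) nz pnq Z0(1) by metis
      then show ?thesis unfolding e by blast
    next
      assume e: "p = x"
      then have "q = v \<or> q = b" using pin(2) nz pnq c(10,11) by metis
      then show ?thesis unfolding e by blast
    next
      assume e: "p = y"
      then have "q = v \<or> q = b" using pin(2) nz pnq c(12) Z0(2) by metis
      then show ?thesis unfolding e by blast
    next
      assume e: "p = w"
      then have "q = v \<or> q = b" using pin(2) nz pnq Z0(3,4) by metis
      then show ?thesis unfolding e by blast
    qed
    then obtain c1 c2 c3 where d: "distinct [v, b, c1, c2, c3]" "W = {v, b, c1, c2, c3}"
      "2 \<le> m' v c1" "2 \<le> m' v c2" "2 \<le> m' v c3" "1 \<le> m' b c1" "1 \<le> m' b c2" "1 \<le> m' b c3"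
      "{p, q} = {v, c1} \<or> {p, q} = {b, c1}"
    proof -
      assume a: "{p, q} = {v, x} \<or> {p, q} = {v, y} \<or> {p, q} = {v, w} \<or>
        {p, q} = {b, x} \<or> {p, q} = {b, y} \<or> {p, q} = {b, w}"
      assume th: "\<And>c1 c2 c3. distinct [v, b, c1, c2, c3] \<Longrightarrow> W = {v, b, c1, c2, c3} \<Longrightarrow>
        2 \<le> m' v c1 \<Longrightarrow> 2 \<le> m' v c2 \<Longrightarrow> 2 \<le> m' v c3 \<Longrightarrow> 1 \<le> m' b c1 \<Longrightarrow> 1 \<le> m' b c2 \<Longrightarrow> 1 \<le> m' b c3 \<Longrightarrow>
        {p, q} = {v, c1} \<or> {p, q} = {b, c1} \<Longrightarrow> thesis"
      show thesis
        using a
      proof (elim disjE)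
        assume "{p, q} = {v, x}" then show thesis using th[of x y w] lb by auto
      next
        assume "{p, q} = {b, x}" then show thesis using th[of x y w] lb by auto
      next
        assume e: "{p, q} = {v, y}"
        show thesis by (rule th[of y x w]) (use lb e in auto)
      next
        assume e: "{p, q} = {b, y}"
        show thesis by (rule th[of y x w]) (use lb e in auto)
      next
        assume e: "{p, q} = {v, w}"
        show thesis by (rule th[of w x y]) (use lb e in auto)
      next
        assume e: "{p, q} = {b, w}"
        show thesis by (rule th[of w x y]) (use lb e in auto)
      qed
    qed
    have ND: "distinct [v, b, c1, c2, c3, z]" using d(1,2) unfolding W_def by auto
    have zn: "v \<noteq> z" "b \<noteq> z" "c1 \<noteq> z" "c2 \<noteq> z" "c3 \<noteq> z" using ND by auto
    have uin: "u \<in> {v, b, c1, c2, c3}" "u \<noteq> p" "u \<noteq> q" using inW(3) d(2) ne by auto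
    have sz: "m i z = m z i" for i by (rule sym)
    \<comment> \<open>\<open>z\<close> subdivides an edge of the star at \<open>v\<close> or at
      \<open>b\<close>, and its third neighbour \<open>u\<close> is one of the three remaining
      vertices.\<close>
    from d(9) have "wheeled m"
    proof
      assume e: "{p, q} = {v, c1}"
      have n: "{v, c2} \<noteq> {p, q}" "{v, c3} \<noteq> {p, q}" "{b, c1} \<noteq> {p, q}" "{b, c2} \<noteq> {p, q}" "{b, c3} \<noteq> {p, q}"
        unfolding e using ND by (auto simp: doubleton_eq_iff)
      have F: "1 \<le> m v c1" "2 \<le> m v c2" "2 \<le> m v c3" "1 \<le> m b c1" "1 \<le> m b c2" "1 \<le> m b c3"
        using m'v[OF zn(1,3)] m'v[OF zn(1,4)] m'v[OF zn(1,5)] m'v[OF zn(2,3)] m'v[OF zn(2,4)] m'v[OF zn(2,5)] n e d(3-8) by auto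
      have zz: "m v z = 1" "m c1 z = 1" using e zpq sz by (auto simp: doubleton_eq_iff)
      have "u \<noteq> v" "u \<noteq> c1" using e uin(2,3) by (auto simp: doubleton_eq_iff)
      then consider "u = b" | "u = c2" | "u = c3" using uin(1) by blast
      then show "wheeled m"
      proof cases
        case 1
        then have uz1: "m b z = 1" using zu sz by simp
        show ?thesis by (rule wheeled_six_E1[of m v b c1 c2 c3 z]; (rule sym | use F zz uz1 in linarith | use ND in auto))
      next
        case 2
        then have uz1: "m c2 z = 1" using zu sz by simp
        show ?thesis by (rule wheeled_six_E2[of m v b c1 c2 c3 z]; (rule sym | use F zz uz1 in linarith | use ND in auto))
      next
        case 3
        then have uz1: "m c3 z = 1" using zu sz by simp
        show ?thesis by (rule wheeled_six_E2[of m v b c1 c3 c2 z]; (rule sym | use F zz uz1 in linarith | use ND in auto))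
      qed
    next
      assume e: "{p, q} = {b, c1}"
      have n: "{v, c2} \<noteq> {p, q}" "{v, c3} \<noteq> {p, q}" "{v, c1} \<noteq> {p, q}" "{b, c2} \<noteq> {p, q}" "{b, c3} \<noteq> {p, q}"
        unfolding e using ND by (auto simp: doubleton_eq_iff)
      have F: "2 \<le> m v c1" "2 \<le> m v c2" "2 \<le> m v c3" "1 \<le> m b c2" "1 \<le> m b c3"
        using m'v[OF zn(1,3)] m'v[OF zn(1,4)] m'v[OF zn(1,5)] m'v[OF zn(2,4)] m'v[OF zn(2,5)] n d(3-8) by auto
      have zz: "m b z = 1" "m c1 z = 1" using e zpq sz by (auto simp: doubleton_eq_iff)
      have "u \<noteq> b" "u \<noteq> c1" using e uin(2,3) by (auto simp: doubleton_eq_iff)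
      then consider "u = v" | "u = c2" | "u = c3" using uin(1) by blast
      then show "wheeled m"
      proof cases
        case 1
        then have uz1: "m v z = 1" using zu sz by simp
        show ?thesis by (rule wheeled_six_E3[of m v b c1 c2 c3 z]; (rule sym | use F zz uz1 in linarith | use ND in auto))
      next
        case 2
        then have uz1: "m c2 z = 1" using zu sz by simp
        show ?thesis by (rule wheeled_six_E4[of m v b c1 c2 c3 z]; (rule sym | use F zz uz1 in linarith | use ND in auto))
      next
        case 3
        then have uz1: "m c3 z = 1" using zu sz by simp
        show ?thesis by (rule wheeled_six_E4[of m v b c1 c3 c2 z]; (rule sym | use F zz uz1 in linarith | use ND in auto))
      qed
    qed
    then show False using nw by blast
  qed
qed

end

lemma off_add1: "y \<noteq> p \<Longrightarrow> y \<noteq> q \<Longrightarrow> off (add1 m p q) y = add1 (off m y) p q"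
  unfolding off_def add1_def doubleton_eq_iff by (intro ext) simp

context minimal_counterexample
begin

text \<open>The hypothesis \<open>t\<close> ensures that a vertex of degree at least 4 survives. In
  the blocking cut no side is a cubic pair: \<open>u\<close> is noncubic, and the side of
  \<open>z\<close> has at least three vertices unless \<open>z\<close> is noncubic. This leaves six
  vertices divided three to three.\<close>

lemma edge_cut:
  assumes uz: "1 \<le> m u z" "4 \<le> deg V m u"
    and t: "deg V m z = 3 \<and> (5 \<le> deg V m u \<or> (\<exists>t\<in>V. t \<noteq> u \<and> 4 \<le> deg V m t)) \<or>
      4 \<le> deg V m z \<and> (5 \<le> deg V m u \<or> 5 \<le> deg V m z \<or> (\<exists>t\<in>V. t \<noteq> u \<and> t \<noteq> z \<and> 4 \<le> deg V m t))"
  shows "card V = 6 \<and> (\<exists>X\<subseteq>V. z \<in> X \<and> u \<notin> X \<and> card X = 3 \<and> cut V m X = 4)"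
proof -
  have V: "u \<in> V" "z \<in> V" using mg_edge[OF mg uz(1)] by auto
  let ?P = "\<exists>X\<subseteq>V. z \<in> X \<and> u \<notin> X \<and> cut V m X = 4 \<and> 2 \<le> card X \<and> 2 \<le> card (V - X) \<and>
      (card X \<noteq> 2 \<or> 4 \<le> deg V m z)"
  have big: ?P if ex: "\<exists>X\<subseteq>V. z \<in> X \<and> u \<notin> X \<and> cut V m X = 4 \<and> 3 \<le> card X \<and> 2 \<le> card (V - X)"
  proof -
    obtain X where X: "X \<subseteq> V" "z \<in> X" "u \<notin> X" "cut V m X = 4" "3 \<le> card X" "2 \<le> card (V - X)"
      using ex by blast
    then have "2 \<le> card X" "card X \<noteq> 2" by linarith+
    then show ?thesis using X by blast
  qed
  have noncub: ?P if "\<exists>X\<subseteq>V. z \<in> X \<and> u \<notin> X \<and> cut V m X = 4 \<and> 2 \<le> card X \<and> 2 \<le> card (V - X)"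
    "4 \<le> deg V m z" using that by blast
  have ?P
    using t
  proof (elim disjE conjE)
    assume z: "deg V m z = 3" "5 \<le> deg V m u"
    show ?thesis by (rule big[OF suppress_cubic[OF uz z(1)]]) (use z in blast)
  next
    assume z: "deg V m z = 3" "\<exists>t\<in>V. t \<noteq> u \<and> 4 \<le> deg V m t"
    show ?thesis by (rule big[OF suppress_cubic[OF uz z(1)]]) (use z in blast)
  next
    assume z: "4 \<le> deg V m z" "5 \<le> deg V m u"
    show ?thesis by (rule noncub[OF delete_edge[OF uz z(1) V(1)] z(1)]) (use z in simp)
  next
    assume z: "4 \<le> deg V m z" "5 \<le> deg V m z"
    show ?thesis by (rule noncub[OF delete_edge[OF uz z(1) V(2)] z(1)]) (use z in simp)
  next
    assume z: "4 \<le> deg V m z" "\<exists>t\<in>V. t \<noteq> u \<and> t \<noteq> z \<and> 4 \<le> deg V m t"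
    then obtain t where t: "t \<in> V" "t \<noteq> u" "t \<noteq> z" "4 \<le> deg V m t" by blast
    show ?thesis by (rule noncub[OF delete_edge[OF uz z(1) t(1)] z(1)]) (use t in simp)
  qed
  then obtain X where X: "X \<subseteq> V" "z \<in> X" "u \<notin> X" "cut V m X = 4" "2 \<le> card X" "2 \<le> card (V - X)"
    "card X \<noteq> 2 \<or> 4 \<le> deg V m z" by blast
  have "\<not> (card X = 2 \<and> (\<forall>x\<in>X. deg V m x = 3))" using X(2,7) by fastforce
  moreover have "\<not> (\<forall>x\<in>V - X. deg V m x = 3)" using V(1) X(3) uz(2) by fastforce
  ultimately have "card V = 6 \<and> card X = 3" using cut4_cases[OF X(1,4,5,6)] by blast
  then show ?thesis using X by blast
qed

section \<open>The remaining graphs\<close>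

lemma neighbour: "3 \<le> ew m {u} A \<or> ew m {u} A \<noteq> 0 \<Longrightarrow> \<exists>z\<in>A. 1 \<le> m u z"
  by (rule ccontr) (auto simp: ew_def not_le)

text \<open>The pair bound gives \<open>m u t \<le> 2\<close>, less than the degree of
  \<open>u\<close>.\<close>

lemma other_neighbour:
  assumes "deg V m u = 4" "deg V m t = 4" "u \<in> V" "t \<in> V" "u \<noteq> t"
  shows "\<exists>z. z \<noteq> t \<and> 1 \<le> m u z"
proof -
  have "4 + 2 * m u t \<le> 8" using cut_pair_ge4[OF assms(3-5)] assms(1,2) by simp
  moreover have "deg V m u = m u t + sum (m u) (V - {t})"
    unfolding deg_def by (rule sum.remove[OF fin assms(4)])
  ultimately have "ew m {u} (V - {t}) \<noteq> 0" using assms(1) by (simp add: ew_def)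
  then show ?thesis using neighbour[of u "V - {t}"] by blast
qed

text \<open>All edges are simple, and some edge \<open>xy\<close> joins two cubic vertices. It is
  deleted and both ends are suppressed, which keeps all other degrees, in particular that of
  \<open>u\<close>. The smaller graph has a single noncubic vertex, of degree 4, whereas a chain has
  three and \<open>star5\<close> has a vertex of degree 6.\<close>

lemma cubic_except_one:
  assumes u: "u \<in> V" "deg V m u = 4" and cubic: "\<And>t. t \<in> V \<Longrightarrow> t \<noteq> u \<Longrightarrow> deg V m t = 3"
    and seven: "7 \<le> card V"
  shows False
proof -
  have le1: "m x t \<le> 1" if x: "x \<in> V" "x \<noteq> u" for x t
  proof (cases "t \<in> V \<and> t \<noteq> x")
    case True
    then have "4 + 2 * m x t \<le> 3 + deg V m t" using cut_pair_ge4[of x t] x cubic[OF x] by auto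
    moreover have "deg V m t \<le> 4" using u(2) cubic[of t] True by (cases "t = u") auto
    ultimately show ?thesis by linarith
  next
    case False
    then show ?thesis using mgD(5)[OF mg, of t x] diag by auto
  qed
  have "V \<noteq> {u}" using seven by auto
  then obtain x where x: "x \<in> V" "x \<noteq> u" using u(1) by blast
  have "deg V m x = m x u + sum (m x) (V - {u})"
    unfolding deg_def by (rule sum.remove[OF fin u(1)])
  then have "ew m {x} (V - {u}) \<noteq> 0" using cubic[OF x] le1[OF x, of u] by (simp add: ew_def)
  then obtain y where y: "y \<in> V" "y \<noteq> u" "1 \<le> m x y" using neighbour[of x "V - {u}"] by auto
  have xy1: "m x y = 1" "m y x = 1" using le1[OF x, of y] y(3) sym[of x y] by auto
  have xny: "x \<noteq> y" using xy1 diag by auto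
  have three: "\<exists>p q. p \<noteq> q \<and> p \<noteq> a \<and> p \<noteq> b \<and> q \<noteq> a \<and> q \<noteq> b \<and> p \<in> V \<and> q \<in> V \<and>
      (\<forall>t. m a t = (if t = b then 1 else 0) + (if t = p then 1 else 0) + (if t = q then 1 else 0))"
    if a: "a \<in> V" "a \<noteq> u" "b \<in> V" "m a b = 1" for a b
  proof -
    have "deg V m a = m a b + sum (m a) (V - {b})"
      unfolding deg_def by (rule sum.remove[OF fin a(3)])
    then have s: "sum (m a) (V - {b}) = 2" using cubic[OF a(1,2)] a(4) by simp
    have "finite (V - {b})" using fin by blast
    from sum2_ex[OF this s] obtain p q where pq: "p \<in> V - {b}" "q \<in> V - {b}"
      "\<And>t. t \<in> V - {b} \<Longrightarrow> m a t = (if t = p then 1 else 0) + (if t = q then 1 else 0)" by blast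
    have ne: "p \<noteq> q" using pq(3)[OF pq(1)] le1[OF a(1,2), of p] by auto
    have one: "m a p = 1" "m a q = 1" using pq(3)[OF pq(1)] pq(3)[OF pq(2)] ne by auto
    have "m a t = (if t = b then 1 else 0) + (if t = p then 1 else 0) + (if t = q then 1 else 0)" for t
    proof (cases "t \<in> V - {b}")
      case True
      then show ?thesis using pq(3)[OF True] by simp
    next
      case False
      then have "t \<noteq> p" "t \<noteq> q" using pq(1,2) by auto
      moreover have "m a t = (if t = b then 1 else 0)"
      proof (cases "t = b")
        case False
        then have "t \<notin> V" using \<open>t \<notin> V - {b}\<close> by blast
        then show ?thesis using False mgD(5)[OF mg, of t a] by simp
      qed (simp add: a(4))
      ultimately show ?thesis by simp
    qed
    moreover have "p \<noteq> a" "q \<noteq> a" using one diag by auto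
    ultimately show ?thesis using ne pq(1,2) by blast
  qed
  obtain p q where pq: "p \<noteq> q" "p \<noteq> x" "p \<noteq> y" "q \<noteq> x" "q \<noteq> y" "p \<in> V" "q \<in> V"
    "\<And>t. m x t = (if t = y then 1 else 0) + (if t = p then 1 else 0) + (if t = q then 1 else 0)"
    using three[OF x y(1) xy1(1)] by blast
  obtain r s where rs: "r \<noteq> s" "r \<noteq> y" "r \<noteq> x" "s \<noteq> y" "s \<noteq> x" "r \<in> V" "s \<in> V"
    "\<And>t. m y t = (if t = x then 1 else 0) + (if t = r then 1 else 0) + (if t = s then 1 else 0)"
    using three[OF y(1,2) x(1) xy1(2)] by blast
  define W where "W = V - {x} - {y}"
  define m1 where "m1 = add1 (off m x) p q"
  define m' where "m' = add1 (add1 (off (off m x) y) p q) r s"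
  have inW: "p \<in> W" "q \<in> W" "r \<in> W" "s \<in> W" "u \<in> W" using pq rs u x y unfolding W_def by auto
  have mg0: "mg W (off (off m x) y)" unfolding W_def by (rule mg_off[OF mg_off[OF mg]])
  have mg1: "mg W (add1 (off (off m x) y) p q)" by (rule mg_add1[OF mg0 inW(1,2) pq(1)])
  have mg': "mg W m'" unfolding m'_def by (rule mg_add1[OF mg1 inW(3,4) rs(1)])
  let ?I = "\<lambda>A u. if u \<in> A then 1 else (0::nat)"
  let ?S = "\<lambda>A u w. if (u \<in> A) = (w \<in> A) then 0 else (1::nat)"
  have cut': "cut W m' A = ew m A (W - A) + ?S A p q + ?S A r s" if A: "A \<subseteq> W" for A
  proof -
    have n: "x \<notin> A" "y \<notin> A" "x \<notin> W - A" "y \<notin> W - A" using A unfolding W_def by auto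
    have "cut W (off (off m x) y) A = ew m A (W - A)"
      unfolding cut_def ew_off[OF n(2,4)] ew_off[OF n(1,3)] ..
    then show ?thesis unfolding m'_def cut_add1[OF mg1 A inW(3,4) rs(1)] cut_add1[OF mg0 A inW(1,2) pq(1)] by simp
  qed
  \<comment> \<open>The four ways of distributing \<open>x\<close> and \<open>y\<close> over the
    sides of a cut of the reduced graph.\<close>
  have cuts: "cut V m A = ew m A (W - A) + (?I A p + ?I A q) + (?I A r + ?I A s)"
    "cut V m (insert x A) + (?I A p + ?I A q) = ew m A (W - A) + 3 + (?I A r + ?I A s)"
    "cut V m (insert y A) + (?I A r + ?I A s) = ew m A (W - A) + 3 + (?I A p + ?I A q)"
    "cut V m (insert x (insert y A)) + (?I A p + ?I A q) + (?I A r + ?I A s) = ew m A (W - A) + 4"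
    if A: "A \<subseteq> W" for A
  proof -
    have n: "x \<notin> A" "y \<notin> A" "A \<subseteq> V" using A unfolding W_def by auto
    have f: "finite A" "finite (W - A)" using finA[OF n(3)] fin unfolding W_def by auto
    have ex: "ew m {x} A = ?I A p + ?I A q" unfolding ew_def using f n by (simp add: pq(8) sum.distrib)
    have ey: "ew m {y} A = ?I A r + ?I A s" unfolding ew_def using f n by (simp add: rs(8) sum.distrib)
    have "V - A = insert x (insert y (W - A))" using n x y unfolding W_def by auto
    moreover have "ew m A (insert x (insert y (W - A))) = ew m A {x} + ew m A (insert y (W - A))"
      by (rule ew_insert_right) (use f xny in \<open>auto simp: W_def\<close>)
    moreover have "ew m A (insert y (W - A)) = ew m A {y} + ew m A (W - A)"
      by (rule ew_insert_right) (use f in \<open>auto simp: W_def\<close>)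
    ultimately show c: "cut V m A = ew m A (W - A) + (?I A p + ?I A q) + (?I A r + ?I A s)"
      unfolding cut_def using ex ey ew_commute[OF mg, of A "{x}"] ew_commute[OF mg, of A "{y}"] by simp
    have d: "deg V m x = 3" "deg V m y = 3" using cubic x y by auto
    show "cut V m (insert x A) + (?I A p + ?I A q) = ew m A (W - A) + 3 + (?I A r + ?I A s)"
      using cut_insert[OF mg n(3) x(1) n(1)] c ex d by linarith
    show cy: "cut V m (insert y A) + (?I A r + ?I A s) = ew m A (W - A) + 3 + (?I A p + ?I A q)"
      using cut_insert[OF mg n(3) y(1) n(2)] c ey d by linarith
    have "insert y A \<subseteq> V" "x \<notin> insert y A" using n y xny by auto
    moreover have "ew m {x} (insert y A) = 1 + ew m {x} A" using f n xy1 by (simp add: ew_def)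
    ultimately show "cut V m (insert x (insert y A)) + (?I A p + ?I A q) + (?I A r + ?I A s) = ew m A (W - A) + 4"
      using cut_insert[OF mg _ x(1), of "insert y A"] cy ex d by linarith
  qed
  have deg': "deg W m' t = deg V m t" if t: "t \<in> W" for t
  proof -
    have "{t} \<subseteq> W" "t \<in> V" using t unfolding W_def by auto
    then show ?thesis
      using deg_cut[OF mg' t] deg_cut[OF mg, of t] cut'[of "{t}"] cuts(1)[of "{t}"] pq(1) rs(1) by auto
  qed
  \<comment> \<open>The delicate case: \<open>x\<close> and \<open>y\<close> lie on opposite sides
    and the deleted edge crosses, so the reduced cut is smaller by one. If the cut in
    \<open>m\<close> has size 4, then \<open>cut4_cases\<close> with at least seven vertices leaves
    a pair opposite to \<open>insert a A\<close>, hence a single vertex once \<open>b\<close> is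
    removed.\<close>
  have big: "4 \<le> k \<or> k = 3 \<and> card (W - A) = 1"
    if A: "A \<subseteq> W" "A \<noteq> W" and ab: "{a, b} = {x, y}" "cut V m (insert a A) = k + 1"
      and cd: "c \<in> A" "d \<in> A" "c \<noteq> d" for A a b c d k
  proof -
    have n: "a \<notin> A" "a \<noteq> b" "insert a A \<subseteq> V" "V - insert a A = insert b (W - A)" "b \<notin> W - A"
      using A ab(1) x y xny unfolding W_def by (auto simp: doubleton_eq_iff)
    have "A \<subseteq> V" using A(1) unfolding W_def by blast
    then have f: "finite A" "finite (W - A)" using finA fin unfolding W_def by simp_all
    have "card {a, c, d} \<le> card (insert a A)" by (rule card_mono) (use f cd in auto)
    moreover have "a \<noteq> c" "a \<noteq> d" using cd n(1) by metis+
    then have "card {a, c, d} = 3" using cd(3) by simp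
    ultimately have 3: "3 \<le> card (insert a A)" by simp
    have cW: "card (V - insert a A) = card (W - A) + 1" unfolding n(4) using f n(5) by simp
    have "card (W - A) \<noteq> 0" using f A by auto
    then have 2: "2 \<le> card (V - insert a A)" using cW by simp
    have four: "4 \<le> cut V m (insert a A)" by (rule conn_cut4[OF conn n(3) _ 2]) (use 3 in simp)
    show ?thesis
    proof (cases "cut V m (insert a A) = 4")
      case True
      have "card (V - insert a A) = 2"
        using cut4_cases[OF n(3) True _ 2] 3 seven by auto
      then show ?thesis using cW True ab(2) by simp
    next
      case False
      then show ?thesis using four ab(2) by simp
    qed
  qed
  have connW: "conn W m'"
  proof (rule connI[OF mg' inW(5)])
    show "4 \<le> deg W m' u" using deg'[OF inW(5)] u(2) by simp
    fix A assume A: "A \<subseteq> W" "A \<noteq> {}" "A \<noteq> W"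
    have AV: "A \<subseteq> V" "A \<noteq> V" "insert x (insert y A) \<subseteq> V" "V - insert x (insert y A) = W - A"
      using A(1) x y unfolding W_def by auto
    have f: "finite A" by (rule finA[OF AV(1)])
    have "card {x, y} \<le> card (V - A)" by (rule card_mono) (use fin A(1) x y in \<open>auto simp: W_def\<close>)
    then have "card (V - A) \<noteq> 1" using xny by simp
    then have D1: "4 \<le> cut V m A \<or> cut V m A = 3 \<and> card A = 1"
      using connD[OF conn AV(1) A(2) AV(2)] by blast
    have "card {x, y} \<le> card (insert x (insert y A))" by (rule card_mono) (use f in auto)
    then have "card (insert x (insert y A)) \<noteq> 1" using xny by simp
    moreover have "insert x (insert y A) \<noteq> V" using AV(4) A by blast
    ultimately have D2: "4 \<le> cut V m (insert x (insert y A)) \<or>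
        cut V m (insert x (insert y A)) = 3 \<and> card (W - A) = 1"
      using connD[OF conn AV(3)] unfolding AV(4) by blast
    have "cut W m' A = cut V m A \<or> cut W m' A = cut V m (insert x (insert y A)) \<or>
        p \<in> A \<and> q \<in> A \<and> cut V m (insert x A) = cut W m' A + 1 \<or>
        r \<in> A \<and> s \<in> A \<and> cut V m (insert y A) = cut W m' A + 1"
      using cuts[OF A(1)] cut'[OF A(1)]
      by (cases "p \<in> A"; cases "q \<in> A"; cases "r \<in> A"; cases "s \<in> A"; simp)
    then show "4 \<le> cut W m' A \<or> cut W m' A = 3 \<and> (card A = 1 \<or> card (W - A) = 1)"
    proof (elim disjE conjE)
      assume e: "cut W m' A = cut V m A"
      show ?thesis unfolding e using D1 by blast
    next
      assume e: "cut W m' A = cut V m (insert x (insert y A))"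
      show ?thesis unfolding e using D2 by blast
    next
      assume "p \<in> A" "q \<in> A" "cut V m (insert x A) = cut W m' A + 1"
      then show ?thesis using big[OF A(1,3) refl, of "cut W m' A" p q] pq(1) by blast
    next
      assume "r \<in> A" "s \<in> A" "cut V m (insert y A) = cut W m' A + 1"
      then show ?thesis using big[OF A(1,3) insert_commute, of "cut W m' A" r s] rs(1) by blast
    qed
  qed
  have cardW: "card V = card W + 2"
    using fin x(1) y(1) xny unfolding W_def by (simp add: card_Diff_singleton)
      (use seven in linarith)
  have "ew m' W W \<le> ew m V V"
  proof -
    have "ew m' W W = (\<Sum>t\<in>W. deg V m t)" unfolding total_deg using deg' by simp
    also have "\<dots> \<le> (\<Sum>t\<in>V. deg V m t)" unfolding W_def using fin by (intro sum_mono2) auto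
    finally show ?thesis unfolding total_deg .
  qed
  then have meas: "card W + ew m' W W < card V + ew m V V" using cardW by linarith
  have nw': "\<not> wheeled m'"
  proof
    assume w: "wheeled m'"
    have "off m1 y = add1 (off (off m x) y) p q"
      unfolding m1_def by (rule off_add1[OF pq(3)[symmetric] pq(5)[symmetric]])
    then have "m' = add1 (off m1 y) r s" unfolding m'_def by simp
    moreover have "{r, y} \<noteq> {p, q}" "{y, s} \<noteq> {p, q}" using pq(3,5) unfolding doubleton_eq_iff by blast+
    then have "m1 r y = m r y" "m1 y s = m y s"
      unfolding m1_def add1_def off_def using rs(3,5) xny by simp_all
    moreover have "m r y = 1" "m y s = 1" using rs(8)[of r] rs(8)[of s] rs(1,3,5) sym[of r y] by auto
    ultimately have "wheeled m1"
      using wheeled_suppress[of m1 y r s] w rs(1,2,4) by auto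
    moreover have "m p x = 1" "m x q = 1" using pq(8)[of p] pq(8)[of q] pq(1,3,5) sym[of p x] by auto
    ultimately have "wheeled m"
      using wheeled_suppress[of m x p q] pq(1,2,4) unfolding m1_def by auto
    then show False using nw by blast
  qed
  have only_u: "t = u" if "t \<in> W" "4 \<le> deg W m' t" for t
    using that deg'[OF that(1)] cubic[of t] unfolding W_def by auto
  have "5 \<le> card W" using cardW seven by simp
  from IH[OF connW this meas nw'] show False
  proof (elim disjE conjE)
    assume "chain3 W m'"
    then obtain a b c where c: "{a, b, c} \<subseteq> W" "a \<noteq> c" "deg W m' a = 4" "deg W m' c = 4"
      unfolding chain3_def by blast
    then show False using only_u[of a] only_u[of c] by auto
  next
    assume st: "star5 W m'"
    obtain v where v: "v \<in> W" "deg W m' v = 6"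
      by (rule star5_cases[OF st mg' inW(5)]) (use deg'[OF inW(5)] u(2) in auto)
    then show False using only_u[of v] deg'[OF inW(5)] u(2) by auto
  qed
qed

text \<open>By parity both sides contain a noncubic vertex, and an edge at such a vertex inside
  \<open>X\<close> is blocked by a second division into three and three crossing the first. One
  diagonal of the four corners consists of two pairs with boundary 4, hence of cubic pairs. Either
  one of these pairs contains the noncubic vertex \<open>a\<close>, or the pairs form a ring of cuts
  with \<open>a\<close> and \<open>b\<close>.\<close>

lemma six_vertices:
  assumes six: "card V = 6"
    and X: "X \<subseteq> V" "card X = 3" "cut V m X = 4"
  shows False
proof -
  have c3: "\<exists>a\<in>Y. 4 \<le> deg V m a" if Y: "Y \<subseteq> V" "card Y = 3" "cut V m Y = 4" for Y
  proof (rule ccontr)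
    assume n: "\<not> ?thesis"
    have "deg V m t = 3" if "t \<in> Y" for t using n that deg_ge3[of t] Y(1) by fastforce
    then have "(\<Sum>t\<in>Y. deg V m t) = 9" using Y(2) by simp
    then have "9 = ew m Y Y + 4" using deg_sum[OF mg Y(1)] Y(3) by simp
    then have "ew m Y Y = 5" by simp
    then show False using even_total[OF finA[OF Y(1)] mg] by simp
  qed
  have compl: "V - Y \<subseteq> V \<and> card (V - Y) = 3 \<and> cut V m (V - Y) = 4" if "Y \<subseteq> V" "card Y = 3" "cut V m Y = 4" for Y
    using that six card_Diff_subset[OF finA[OF that(1)] that(1)] cut_compl[OF mg that(1)] by auto
  obtain a where a: "a \<in> X" "4 \<le> deg V m a" using c3[OF X] by blast
  obtain b where b: "b \<in> V - X" "4 \<le> deg V m b" using c3[of "V - X"] compl[OF X] by blast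
  have fX: "finite X" by (rule finA[OF X(1)])
  have aV: "a \<in> V" using a X by blast
  \<comment> \<open>If \<open>a\<close> had no neighbour in \<open>X\<close>, its edges would make
    up the whole boundary of \<open>X\<close>, and \<open>X - {a}\<close> would have none.\<close>
  have "ew m {a} (X - {a}) \<noteq> 0"
  proof
    assume z: "ew m {a} (X - {a}) = 0"
    have Xa: "X - {a} \<subseteq> V" "a \<notin> X - {a}" "insert a (X - {a}) = X" using X(1) a(1) by auto
    have "cut V m X + 0 = cut V m (X - {a}) + deg V m a"
      using cut_insert[OF mg Xa(1) aV Xa(2)] z unfolding Xa(3) by simp
    then have "cut V m (X - {a}) = 0" using X(3) a(2) by simp
    moreover have "X - {a} \<noteq> {}" "X - {a} \<noteq> V" using X(2) a(1) aV fX by (auto simp: card_Suc_eq numeral_3_eq_3)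
    ultimately show False using conn_cut3[OF conn Xa(1)] by simp
  qed
  then obtain x where x: "x \<in> X" "x \<noteq> a" "1 \<le> m a x" using neighbour[of a "X - {a}"] by blast
  have bne: "b \<in> V" "b \<noteq> a" "b \<noteq> x" using b(1) a(1) x(1) by auto
  have "deg V m x = 3 \<or> 4 \<le> deg V m x" using deg_ge3[of x] x(1) X(1) by force
  then obtain Y where Y: "Y \<subseteq> V" "x \<in> Y" "a \<notin> Y" "card Y = 3" "cut V m Y = 4"
    using edge_cut[OF x(3) a(2)] bne b(2) by blast
  define P Q R T where "P = X \<inter> Y" "Q = X - Y" "R = Y - X" "T = V - (X \<union> Y)"
  note d = P_Q_R_T_def
  have fin4: "finite P" "finite Q" "finite R" "finite T" unfolding d using fin fX finA[OF Y(1)] by auto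
  have cards: "card P + card Q = 3" "card P + card R = 3" "card R + card T = 3"
  proof -
    have "X = P \<union> Q" "Y = P \<union> R" "V - X = R \<union> T" "P \<inter> Q = {}" "P \<inter> R = {}" "R \<inter> T = {}"
      unfolding d using Y(1) by auto
    then show "card P + card Q = 3" "card P + card R = 3" "card R + card T = 3"
      using X(2) Y(4) compl[OF X] card_Un_disjoint[OF fin4(1,2)] card_Un_disjoint[OF fin4(1,3)]
        card_Un_disjoint[OF fin4(3,4)] by simp_all
  qed
  have aQ: "a \<in> Q" and xP: "x \<in> P" using a Y x unfolding d by auto
  have "card Q \<noteq> 0" "card P \<noteq> 0" using aQ xP fin4 by auto
  then have cP: "card P = 1 \<or> card P = 2" using cards by linarith
  have sub: "P \<subseteq> V" "Q \<subseteq> V" "R \<subseteq> V" "T \<subseteq> V" using X(1) Y(1) unfolding d by auto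
  have four: "4 \<le> cut V m Z" if "Z \<subseteq> V" "card Z = 2" for Z
    using conn_cut4[OF conn that(1)] that six card_Diff_subset[OF finA[OF that(1)] that(1)] by simp
  have cubic: "\<forall>t\<in>Z. deg V m t = 3" if "Z \<subseteq> V" "card Z = 2" "cut V m Z = 4" for Z
    using cut4_cases[OF that(1,3)] that(2) six card_Diff_subset[OF finA[OF that(1)] that(1)] by simp
  have PT: "cut V m P + cut V m T + 2 * ew m Q R = 8"
    using cut_corners[OF mg X(1) Y(1)] X(3) Y(5) unfolding d by simp
  have QR: "cut V m Q + cut V m R + 2 * ew m P T = 8"
  proof -
    have "X \<inter> (V - Y) = Q" "V - (X \<union> (V - Y)) = R" "X - (V - Y) = P" "V - Y - X = T"
      using X(1) Y(1) unfolding d by auto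
    then show ?thesis using cut_corners[OF mg X(1), of "V - Y"] X(3) compl[OF Y(1,4,5)] by simp
  qed
  show False
    using cP
  proof
    assume "card P = 1"
    then have "card Q = 2" "card R = 2" using cards by auto
    then have "cut V m Q = 4" using four[OF sub(2)] four[OF sub(3)] QR by linarith
    then show False using cubic[OF sub(2) \<open>card Q = 2\<close>] aQ a(2) by fastforce
  next
    assume P2: "card P = 2"
    then have c: "card T = 2" "card Q = 1" "card R = 1" using cards by auto
    have PT4: "cut V m P = 4" "cut V m T = 4" "ew m Q R = 0"
      using four[OF sub(1) P2] four[OF sub(4) c(1)] PT by linarith+
    have cub: "\<forall>t\<in>P \<union> T. deg V m t = 3"
      using cubic[OF sub(1) P2 PT4(1)] cubic[OF sub(4) c(1) PT4(2)] by blast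
    have Q: "Q = {a}" using c(2) aQ card_1_singletonE by (metis singletonD)
    have "b \<in> R \<union> T" using b(1) unfolding d by blast
    moreover have "b \<notin> T" using cub b(2) by fastforce
    ultimately have "b \<in> R" by blast
    then have R: "R = {b}" using c(3) card_1_singletonE by (metis singletonD)
    have dab: "deg V m a = 4" "deg V m b = 4" "ew m P T = 0"
      using QR deg_cut[OF mg aV] deg_cut[OF mg bne(1)] a(2) b(2) unfolding Q R by linarith+
    have Veq: "V = P \<union> T \<union> {a, b}" using Q R X(1) Y(1) unfolding d by blast
    have dj: "P \<inter> T = {}" "a \<notin> P \<union> T" "b \<notin> P \<union> T" using Q R unfolding d by blast+
    have ab0: "m a b = 0" using PT4(3) unfolding Q R by simp
    \<comment> \<open>Edges from \<open>a\<close> or \<open>b\<close> to cubic vertices are simple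
      by the pair bound, so at most two go to each pair; degree 4 then makes these bounds
      tight.\<close>
    have le2: "ew m {c} Z \<le> 2" if "c \<in> V" "deg V m c = 4" "c \<notin> Z" "Z \<subseteq> P \<union> T" "card Z = 2" for c Z
    proof -
      have "m c t \<le> 1" if "t \<in> Z" for t
      proof -
        have "t \<in> V" "t \<noteq> c" "deg V m t = 3"
          using that \<open>c \<notin> Z\<close> \<open>Z \<subseteq> P \<union> T\<close> cub sub by auto
        then show ?thesis using cut_pair_ge4[of c t] \<open>c \<in> V\<close> \<open>deg V m c = 4\<close> by simp
      qed
      then have "(\<Sum>t\<in>Z. m c t) \<le> (\<Sum>t\<in>Z. 1)" by (intro sum_mono) auto
      then show ?thesis using that(5) by (simp add: ew_def)
    qed
    have e4: "deg V m c = ew m {c} P + ew m {c} T + m c a + m c b" for c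
    proof -
      have "ew m {c} (P \<union> T \<union> {a, b}) = ew m {c} (P \<union> T) + ew m {c} {a, b}"
        by (rule ew_Un_right) (use fin4 dj in auto)
      moreover have "ew m {c} (P \<union> T) = ew m {c} P + ew m {c} T"
        by (rule ew_Un_right) (use fin4 dj in auto)
      moreover have "ew m {c} {a, b} = m c a + m c b" using bne(2) by (simp add: ew_def)
      ultimately show ?thesis unfolding deg_ew using Veq by simp
    qed
    have "ew m {a} P \<le> 2" "ew m {a} T \<le> 2" "ew m {b} P \<le> 2" "ew m {b} T \<le> 2"
      using le2[OF aV dab(1)] le2[OF bne(1) dab(2)] dj P2 c(1) by auto
    then have "ew m {a} P = 2" "ew m {a} T = 2" "ew m {b} P = 2" "ew m {b} T = 2"
      using e4[of a] e4[of b] dab ab0 diag sym[of b a] by simp_all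
    then show False
      using no_cut_ring[OF Veq dj bne(2)[symmetric] _ _ dab(3) ab0] P2 c(1) by simp
  qed
qed

text \<open>\<open>edge_cut\<close> leads to \<open>six_vertices\<close> as soon as some edge at
  \<open>u\<close> leaves a vertex of degree at least 4 behind. An edge fails to do so only if
  \<open>u\<close> has degree 4 and is the only noncubic vertex, or if its other end is the only
  other one, also of degree 4; but then \<open>u\<close> has a further neighbour.\<close>

lemma contradiction: False
proof -
  obtain u where u: "u \<in> V" "4 \<le> deg V m u" using conn unfolding conn_def by blast
  have cub: "deg V m t = 3 \<or> 4 \<le> deg V m t" if "t \<in> V" for t using deg_ge3[OF that] by linarith
  have nb: "\<exists>z\<in>V. 1 \<le> m u z" using neighbour[of u V] u(2) by (simp add: deg_ew)
  show False
  proof (cases "\<exists>t\<in>V. t \<noteq> u \<and> 4 \<le> deg V m t")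
    case True
    then obtain t where t: "t \<in> V" "t \<noteq> u" "4 \<le> deg V m t" by blast
    have "\<exists>z. 1 \<le> m u z \<and> (deg V m z = 3 \<or> 4 \<le> deg V m z \<and>
      (5 \<le> deg V m u \<or> 5 \<le> deg V m z \<or> (\<exists>t\<in>V. t \<noteq> u \<and> t \<noteq> z \<and> 4 \<le> deg V m t)))"
    proof (rule ccontr)
      assume n: "\<not> ?thesis"
      have only: "z = t \<and> deg V m u = 4 \<and> deg V m t = 4" if z: "1 \<le> m u z" for z
      proof -
        have "z \<in> V" using mg_edge[OF mg z] by blast
        then have "4 \<le> deg V m z" using cub n z by blast
        then have 5: "\<not> 5 \<le> deg V m u" "\<not> 5 \<le> deg V m z" "\<not> (\<exists>t\<in>V. t \<noteq> u \<and> t \<noteq> z \<and> 4 \<le> deg V m t)"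
          using n z by blast+
        have zt: "z = t" using 5(3) t by blast
        have "deg V m u = 4" using 5(1) u(2) by linarith
        moreover have "deg V m t = 4" using 5(2) t(3) unfolding zt by linarith
        ultimately show ?thesis using zt by blast
      qed
      obtain z where "1 \<le> m u z" using nb by blast
      then have "deg V m u = 4" "deg V m t = 4" using only by blast+
      then obtain z' where "z' \<noteq> t" "1 \<le> m u z'" using other_neighbour[of u t] u t by blast
      then show False using only by blast
    qed
    then obtain z where z: "1 \<le> m u z" "deg V m z = 3 \<or> 4 \<le> deg V m z \<and>
      (5 \<le> deg V m u \<or> 5 \<le> deg V m z \<or> (\<exists>t\<in>V. t \<noteq> u \<and> t \<noteq> z \<and> 4 \<le> deg V m t))" by blast
    then have "card V = 6 \<and> (\<exists>X\<subseteq>V. z \<in> X \<and> u \<notin> X \<and> card X = 3 \<and> cut V m X = 4)"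
      using edge_cut[OF z(1) u(2)] t by blast
    then show False using six_vertices by blast
  next
    case False
    then have cubic: "deg V m t = 3" if "t \<in> V" "t \<noteq> u" for t using cub that by blast
    have "\<not> 5 \<le> deg V m u"
    proof
      assume u5: "5 \<le> deg V m u"
      obtain z where z: "z \<in> V" "1 \<le> m u z" using nb by blast
      then have "deg V m z = 3" using cubic[of z] mg_edge[OF mg z(2)] by blast
      then have "card V = 6 \<and> (\<exists>X\<subseteq>V. z \<in> X \<and> u \<notin> X \<and> card X = 3 \<and> cut V m X = 4)"
        using edge_cut[OF z(2) u(2)] u5 by blast
      then show False using six_vertices by blast
    qed
    then have du: "deg V m u = 4" using u(2) by linarith
    show False
    proof (cases "card V = 6")
      case True
      \<comment> \<open>Five cubic vertices and one of degree 4 have an odd degree sum.\<close>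
      have "ew m V V = deg V m u + (\<Sum>t\<in>V - {u}. deg V m t)"
        unfolding total_deg by (rule sum.remove[OF fin u(1)])
      also have "(\<Sum>t\<in>V - {u}. deg V m t) = (\<Sum>t\<in>V - {u}. 3)" by (rule sum.cong) (use cubic in auto)
      also have "\<dots> = 15" using True u(1) fin by simp
      finally have "ew m V V = 19" using du by simp
      then show False using even_total[OF fin mg] by simp
    next
      case False
      then show False using cubic_except_one[OF u(1) du cubic] card by simp
    qed
  qed
qed

end

theorem wheeled_or_chain3:
  fixes V :: "'a set"
  assumes "conn V m" "5 \<le> card V"
  shows "wheeled m \<or> chain3 V m \<or> card V = 5 \<and> star5 V m"
  using assms
proof (induction "card V + ew m V V" arbitrary: V m rule: less_induct)
  case less
  show ?case
  proof (cases "card V = 5")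
    case True
    then show ?thesis using five_vertices[OF less.prems(1)] by blast
  next
    case False
    then have c: "6 \<le> card V" using less.prems(2) by linarith
    show ?thesis
    proof (rule ccontr)
      assume n: "\<not> ?thesis"
      then interpret minimal_counterexample V m
        using less c by unfold_locales blast+
      show False by (rule contradiction)
    qed
  qed
qed

section \<open>From multiplicities to multigraphs\<close>

definition mult :: "('v, 'e) mgraph \<Rightarrow> 'v \<Rightarrow> 'v \<Rightarrow> nat" where
  "mult G x y = card {e \<in> edges G. ends G e = {x, y}}"

lemma ends_two: "multigraph G \<Longrightarrow> e \<in> edges G \<Longrightarrow> ends G e = {x, y} \<Longrightarrow> x \<noteq> y \<and> x \<in> verts G \<and> y \<in> verts G"
  unfolding multigraph_def by (metis card_2_iff doubleton_eq_iff insert_absorb2 insert_subset)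

lemma ends_ex: "multigraph G \<Longrightarrow> e \<in> edges G \<Longrightarrow> \<exists>x y. ends G e = {x, y} \<and> x \<noteq> y \<and> x \<in> verts G \<and> y \<in> verts G"
proof -
  assume a: "multigraph G" "e \<in> edges G"
  then have "card (ends G e) = 2" unfolding multigraph_def by blast
  then obtain x y where "ends G e = {x, y}" using card_2_iff by metis
  then show ?thesis using ends_two[OF a] by blast
qed

lemma mg_mult:
  assumes "multigraph G"
  shows "mg (verts G) (mult G)"
  unfolding mg_def
proof (intro conjI allI impI)
  show "finite (verts G)" using assms unfolding multigraph_def by blast
  show "mult G x y = mult G y x" for x y unfolding mult_def by (simp only: insert_commute[of x y])
  show "mult G x x = 0" for x
  proof -
    have "{e \<in> edges G. ends G e = {x, x}} = {}" using ends_two[OF assms] by blast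
    then show ?thesis unfolding mult_def by (simp only: card.empty)
  qed
  show "x \<in> verts G" if "mult G x y \<noteq> 0" for x y
  proof -
    have "{e \<in> edges G. ends G e = {x, y}} \<noteq> {}" using that unfolding mult_def by (metis card.empty)
    then show ?thesis using ends_two[OF assms] by blast
  qed
qed

lemma mult_ex: "1 \<le> mult G x y \<Longrightarrow> \<exists>e\<in>edges G. ends G e = {x, y}"
proof (rule ccontr)
  assume "1 \<le> mult G x y" "\<not> (\<exists>e\<in>edges G. ends G e = {x, y})"
  moreover from this have "{e \<in> edges G. ends G e = {x, y}} = {}" by blast
  ultimately show False unfolding mult_def by simp
qed

text \<open>The crossing edges are partitioned by the ordered pair of their ends inside and outside
  \<open>X\<close>, so each is counted once.\<close>

lemma cut_size_cut:
  assumes "multigraph G" "X \<subseteq> verts G"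
  shows "cut_size G X = cut (verts G) (mult G) X"
proof -
  let ?I = "X \<times> (verts G - X)"
  let ?F = "\<lambda>p. {e \<in> edges G. ends G e = {fst p, snd p}}"
  have fin: "finite (edges G)" "finite (verts G)" using assms unfolding multigraph_def by auto
  then have fI: "finite ?I" using assms(2) finite_subset by auto
  have "{e \<in> edges G. card (ends G e \<inter> X) = 1} = (\<Union>p\<in>?I. ?F p)"
  proof (intro equalityI subsetI)
    fix e assume "e \<in> {e \<in> edges G. card (ends G e \<inter> X) = 1}"
    then have e: "e \<in> edges G" "card (ends G e \<inter> X) = 1" by auto
    obtain x y where xy: "ends G e = {x, y}" "x \<noteq> y" "x \<in> verts G" "y \<in> verts G" using ends_ex[OF assms(1) e(1)] by blast
    consider "x \<in> X" "y \<notin> X" | "x \<notin> X" "y \<in> X" | "x \<in> X" "y \<in> X" | "x \<notin> X" "y \<notin> X" by blast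
    then show "e \<in> (\<Union>p\<in>?I. ?F p)"
    proof cases
      case 1
      then show ?thesis using xy e(1) by (intro UN_I[of "(x, y)"]) auto
    next
      case 2
      then show ?thesis using xy e(1) by (intro UN_I[of "(y, x)"]) auto
    next
      case 3
      then have "ends G e \<inter> X = {x, y}" unfolding xy(1) by simp
      then show ?thesis using e(2) xy(2) by simp
    next
      case 4
      then have "ends G e \<inter> X = {}" unfolding xy(1) by simp
      then show ?thesis using e(2) by simp
    qed
  next
    fix e assume "e \<in> (\<Union>p\<in>?I. ?F p)"
    then obtain x y where e: "x \<in> X" "y \<notin> X" "e \<in> edges G" "ends G e = {x, y}" by auto
    then have "ends G e \<inter> X = {x}" by simp
    then show "e \<in> {e \<in> edges G. card (ends G e \<inter> X) = 1}" using e by simp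
  qed
  then have "cut_size G X = card (\<Union>p\<in>?I. ?F p)" unfolding cut_size_def by simp
  also have "\<dots> = (\<Sum>p\<in>?I. card (?F p))"
  proof (rule card_UN_disjoint[OF fI])
    show "\<forall>p\<in>?I. finite (?F p)" using fin by simp
    show "\<forall>p\<in>?I. \<forall>q\<in>?I. p \<noteq> q \<longrightarrow> ?F p \<inter> ?F q = {}"
    proof (intro ballI impI)
      fix p q assume pq: "p \<in> ?I" "q \<in> ?I" "p \<noteq> q"
      then have "{fst p, snd p} \<noteq> {fst q, snd q}" by (auto simp: doubleton_eq_iff)
      then show "?F p \<inter> ?F q = {}" by auto
    qed
  qed
  also have "\<dots> = (\<Sum>x\<in>X. \<Sum>y\<in>verts G - X. mult G x y)"
    unfolding mult_def sum.cartesian_product by (simp add: case_prod_unfold)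
  finally show ?thesis unfolding cut_def ew_def .
qed

lemma degree_deg:
  assumes "multigraph G" "v \<in> verts G"
  shows "degree G v = deg (verts G) (mult G) v"
proof -
  have "card (ends G e \<inter> {v}) = 1 \<longleftrightarrow> v \<in> ends G e" for e by (cases "v \<in> ends G e") auto
  then have "degree G v = cut_size G {v}" unfolding degree_def cut_size_def by simp
  then show ?thesis using cut_size_cut[OF assms(1), of "{v}"] deg_cut[OF mg_mult[OF assms(1)] assms(2)] assms(2) by simp
qed

lemma conn_mult:
  assumes "multigraph G" "edge_connected 3 G" "internally_edge_connected 4 G"
    and "v \<in> verts G" "4 \<le> degree G v"
  shows "conn (verts G) (mult G)"
proof (rule connI[OF mg_mult[OF assms(1)] assms(4)])
  show "4 \<le> deg (verts G) (mult G) v" using assms degree_deg by metis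
  fix A assume A: "A \<subseteq> verts G" "A \<noteq> {}" "A \<noteq> verts G"
  have fin: "finite (verts G)" using assms(1) unfolding multigraph_def by blast
  have "finite A" "finite (verts G - A)" "verts G - A \<noteq> {}" using A fin finite_subset[OF A(1) fin] by auto
  then have "card A \<noteq> 0" "card (verts G - A) \<noteq> 0" using A(2) by (simp_all only: card_0_eq not_False_eq_True)
  then have "1 \<le> card A \<and> 1 \<le> card (verts G - A)" by linarith
  then have "3 \<le> cut_size G A" using assms(2) A(1) unfolding edge_connected_def by blast
  then have "3 \<le> cut (verts G) (mult G) A" using cut_size_cut[OF assms(1) A(1)] by simp
  moreover have "4 \<le> cut (verts G) (mult G) A" if "card A \<noteq> 1" "card (verts G - A) \<noteq> 1"
  proof -
    have "2 \<le> card A \<and> 2 \<le> card (verts G - A)"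
      using that \<open>card A \<noteq> 0\<close> \<open>card (verts G - A) \<noteq> 0\<close> by linarith
    then have "4 \<le> cut_size G A" using assms(3) A(1) unfolding internally_edge_connected_def by blast
    then show ?thesis using cut_size_cut[OF assms(1) A(1)] by simp
  qed
  ultimately show "4 \<le> cut (verts G) (mult G) A \<or>
      cut (verts G) (mult G) A = 3 \<and> (card A = 1 \<or> card (verts G - A) = 1)" by linarith
qed

section \<open>Immersions and splitting off\<close>

text \<open>Paths are handled through reachability along a set \<open>F\<close> of edges: replacing
  an edge by a detour is then a matter of transitivity, and a path with distinct vertices is
  recovered at the end.\<close>

definition link :: "('v, 'e) mgraph \<Rightarrow> 'e set \<Rightarrow> ('v \<times> 'v) set" where
  "link G F = {(u, v). \<exists>e\<in>F. ends G e = {u, v}}"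

lemma path_link:
  assumes "is_path G vs es"
  shows "(hd vs, last vs) \<in> (link G (set es))\<^sup>*"
proof -
  have p: "length vs = Suc (length es)" "\<forall>i<length es. ends G (es ! i) = {vs ! i, vs ! Suc i}"
    using assms unfolding is_path_def by auto
  have "(vs ! 0, vs ! i) \<in> (link G (set es))\<^sup>*" if "i \<le> length es" for i
    using that
  proof (induction i)
    case (Suc i)
    then have "i < length es" by simp
    then have "es ! i \<in> set es" "ends G (es ! i) = {vs ! i, vs ! Suc i}" using p(2) by auto
    then have "(vs ! i, vs ! Suc i) \<in> link G (set es)" unfolding link_def by blast
    then show ?case using Suc by (meson Suc_leD rtrancl.rtrancl_into_rtrancl)
  qed simp
  moreover have "vs \<noteq> []" using p(1) by auto
  then have "hd vs = vs ! 0" "last vs = vs ! length es" using p(1) by (simp_all add: hd_conv_nth last_conv_nth)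
  ultimately show ?thesis by simp
qed

text \<open>Where the walk returns to a vertex of the path built so far, the path is cut back to
  this vertex.\<close>

lemma link_path:
  assumes "multigraph G" "F \<subseteq> edges G" "(s, t) \<in> (link G F)\<^sup>*" "s \<in> verts G"
  shows "\<exists>vs es. is_path G vs es \<and> hd vs = s \<and> last vs = t \<and> set es \<subseteq> F"
  using assms(3)
proof (induction rule: rtrancl_induct)
  case base
  have "is_path G [s] []" using assms(4) unfolding is_path_def by simp
  then show ?case by fastforce
next
  case (step u v)
  then obtain vs es where p: "is_path G vs es" "hd vs = s" "last vs = u" "set es \<subseteq> F" by blast
  obtain e where e: "e \<in> F" "ends G e = {u, v}" using step(2) unfolding link_def by blast
  have v: "v \<in> verts G" using ends_two[OF assms(1) _ e(2)] e(1) assms(2) by blast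
  have d: "length vs = Suc (length es)" "distinct vs" "set vs \<subseteq> verts G" "set es \<subseteq> edges G"
    "\<forall>i<length es. ends G (es ! i) = {vs ! i, vs ! Suc i}" using p(1) unfolding is_path_def by auto
  show ?case
  proof (cases "v \<in> set vs")
    case True
    then obtain k where k: "k < length vs" "vs ! k = v" by (metis in_set_conv_nth)
    have "is_path G (take (Suc k) vs) (take k es)"
      unfolding is_path_def
    proof (intro conjI allI impI)
      show "length (take (Suc k) vs) = Suc (length (take k es))" using d(1) k(1) by simp
      show "distinct (take (Suc k) vs)" using d(2) by (rule distinct_take)
      show "set (take (Suc k) vs) \<subseteq> verts G" using d(3) set_take_subset[of "Suc k" vs] by (rule order_trans[rotated])
      show "set (take k es) \<subseteq> edges G" using d(4) set_take_subset[of k es] by (rule order_trans[rotated])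
      show "ends G (take k es ! i) = {take (Suc k) vs ! i, take (Suc k) vs ! Suc i}" if "i < length (take k es)" for i
        using that d(5) by simp
    qed
    moreover have "vs \<noteq> []" using d(1) by auto
    then have "hd (take (Suc k) vs) = s" using p(2) by (simp add: hd_take)
    moreover have "last (take (Suc k) vs) = v" using k by (simp add: take_Suc_conv_app_nth)
    moreover have "set (take k es) \<subseteq> F" using p(4) set_take_subset[of k es] by (rule order_trans[rotated])
    ultimately show ?thesis by blast
  next
    case False
    have ne: "vs \<noteq> []" using d(1) by auto
    have lu: "vs ! length es = u" using p(3) d(1) ne by (simp add: last_conv_nth)
    have "is_path G (vs @ [v]) (es @ [e])"
      unfolding is_path_def
    proof (intro conjI allI impI)
      show "length (vs @ [v]) = Suc (length (es @ [e]))" using d(1) by simp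
      show "distinct (vs @ [v])" using d(2) False by simp
      show "set (vs @ [v]) \<subseteq> verts G" using d(3) v by simp
      show "set (es @ [e]) \<subseteq> edges G" using d(4) e(1) assms(2) by auto
      show "ends G ((es @ [e]) ! i) = {(vs @ [v]) ! i, (vs @ [v]) ! Suc i}" if i: "i < length (es @ [e])" for i
      proof (cases "i < length es")
        case True
        then show ?thesis using d(1,5) by (simp add: nth_append)
      next
        case False
        then have "i = length es" using i by simp
        then show ?thesis using lu d(1) e(2) by (simp add: nth_append)
      qed
    qed
    moreover have "hd (vs @ [v]) = s" "last (vs @ [v]) = v" "set (es @ [e]) \<subseteq> F" using p ne e(1) by auto
    ultimately show ?thesis by blast
  qed
qed

lemma immersesE:
  assumes "immerses G H"
  obtains \<phi> P Q where "inj_on \<phi> (verts H)" "\<phi> ` verts H \<subseteq> verts G"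
    "\<forall>e\<in>edges H. is_path G (P e) (Q e) \<and> {hd (P e), last (P e)} = \<phi> ` ends H e"
    "\<forall>e\<in>edges H. \<forall>f\<in>edges H. e \<noteq> f \<longrightarrow> set (Q e) \<inter> set (Q f) = {}"
  using assms unfolding immerses_def by (elim exE conjE) (rule that; assumption)

text \<open>The new edge takes over the name \<open>e1\<close> and \<open>e2\<close> disappears, so
  the split graph has the same type. At most one path uses \<open>e1\<close>; giving
  \<open>e2\<close> to it as well keeps the edge sets disjoint, and \<open>x\<close> and
  \<open>z\<close> stay connected through \<open>y\<close>.\<close>

lemma immerses_split:
  assumes G: "multigraph G" and d: "distinct [x, y, z]" and e1: "e1 \<in> edges G" "ends G e1 = {x, y}"
    and e2: "e2 \<in> edges G" "ends G e2 = {y, z}"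
    and im: "immerses (G\<lparr>edges := edges G - {e2}, ends := (ends G)(e1 := {x, z})\<rparr>) H"
  shows "immerses G H"
proof -
  let ?G = "G\<lparr>edges := edges G - {e2}, ends := (ends G)(e1 := {x, z})\<rparr>"
  obtain \<phi> P Q where i0: "inj_on \<phi> (verts H)" "\<phi> ` verts H \<subseteq> verts ?G"
    "\<forall>e\<in>edges H. is_path ?G (P e) (Q e) \<and> {hd (P e), last (P e)} = \<phi> ` ends H e"
    "\<forall>e\<in>edges H. \<forall>f\<in>edges H. e \<noteq> f \<longrightarrow> set (Q e) \<inter> set (Q f) = {}"
    using im by (rule immersesE)
  have i: "inj_on \<phi> (verts H)" "\<phi> ` verts H \<subseteq> verts G"
    "\<And>e. e \<in> edges H \<Longrightarrow> is_path ?G (P e) (Q e) \<and> {hd (P e), last (P e)} = \<phi> ` ends H e"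
    "\<And>e f. e \<in> edges H \<Longrightarrow> f \<in> edges H \<Longrightarrow> e \<noteq> f \<Longrightarrow> set (Q e) \<inter> set (Q f) = {}"
    using i0 by simp_all
  define F where "F e = (if e1 \<in> set (Q e) then insert e2 (set (Q e)) else set (Q e))" for e
  have Qsub: "set (Q e) \<subseteq> edges G - {e2}" if "e \<in> edges H" for e
    using i(3)[OF that] unfolding is_path_def by simp
  have ex: "\<exists>vs es. is_path G vs es \<and> {hd vs, last vs} = \<phi> ` ends H e \<and> set es \<subseteq> F e" if e: "e \<in> edges H" for e
  proof -
    have p: "is_path ?G (P e) (Q e)" using i(3)[OF e] by blast
    have st: "(hd (P e), last (P e)) \<in> (link ?G (set (Q e)))\<^sup>*" by (rule path_link[OF p])
    have "link ?G (set (Q e)) \<subseteq> (link G (F e))\<^sup>*"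
    proof
      fix t assume "t \<in> link ?G (set (Q e))"
      then obtain a b c where t: "t = (a, b)" "c \<in> set (Q e)" "ends ?G c = {a, b}" unfolding link_def by auto
      show "t \<in> (link G (F e))\<^sup>*"
      proof (cases "c = e1")
        case False
        then have "(a, b) \<in> link G (F e)" using t(2,3) unfolding link_def F_def by auto
        then show ?thesis unfolding t(1) by blast
      next
        case True
        then have ab: "{a, b} = {x, z}" "e1 \<in> F e" "e2 \<in> F e" using t(2,3) unfolding F_def by auto
        have "(x, y) \<in> link G (F e)" "(y, x) \<in> link G (F e)" "(y, z) \<in> link G (F e)" "(z, y) \<in> link G (F e)"
          using ab e1(2) e2(2) unfolding link_def by (auto simp: insert_commute)
        then have "(x, z) \<in> (link G (F e))\<^sup>*" "(z, x) \<in> (link G (F e))\<^sup>*" by (meson r_into_rtrancl rtrancl_trans)+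
        then show ?thesis using ab(1) unfolding t(1) by (auto simp: doubleton_eq_iff)
      qed
    qed
    then have "(link ?G (set (Q e)))\<^sup>* \<subseteq> (link G (F e))\<^sup>*" using rtrancl_subset_rtrancl by blast
    then have st': "(hd (P e), last (P e)) \<in> (link G (F e))\<^sup>*" using st by blast
    have "P e \<noteq> []" using p unfolding is_path_def by auto
    then have "hd (P e) \<in> set (P e)" by simp
    then have "hd (P e) \<in> verts G" using p unfolding is_path_def by auto
    moreover have "F e \<subseteq> edges G" using Qsub[OF e] e2(1) unfolding F_def by auto
    ultimately obtain vs es where ve: "is_path G vs es" "hd vs = hd (P e)" "last vs = last (P e)" "set es \<subseteq> F e"
      using link_path[OF G _ st'] by blast
    have "{hd vs, last vs} = \<phi> ` ends H e" unfolding ve(2,3) using i(3)[OF e] by blast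
    then show ?thesis using ve(1,4) by blast
  qed
  obtain P' Q' where pq: "\<And>e. e \<in> edges H \<Longrightarrow>
      is_path G (P' e) (Q' e) \<and> {hd (P' e), last (P' e)} = \<phi> ` ends H e \<and> set (Q' e) \<subseteq> F e"
    using ex by metis
  have "set (Q' e) \<inter> set (Q' f) = {}" if "e \<in> edges H" "f \<in> edges H" "e \<noteq> f" for e f
  proof -
    have "F e \<inter> F f = {}" using i(4)[OF that] Qsub[OF that(1)] Qsub[OF that(2)] unfolding F_def by auto
    then show ?thesis using pq[OF that(1)] pq[OF that(2)] by blast
  qed
  then show ?thesis unfolding immerses_def using i(1,2) pq by (intro exI[of _ \<phi>] exI[of _ P'] exI[of _ Q']) auto
qed

lemma mult_split:
  assumes G: "multigraph G" and d: "distinct [x, y, z]" and e1: "e1 \<in> edges G" "ends G e1 = {x, y}"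
    and e2: "e2 \<in> edges G" "ends G e2 = {y, z}"
  shows "multigraph (G\<lparr>edges := edges G - {e2}, ends := (ends G)(e1 := {x, z})\<rparr>)"
    "mult (G\<lparr>edges := edges G - {e2}, ends := (ends G)(e1 := {x, z})\<rparr>) = split (mult G) x y z"
proof -
  let ?G = "G\<lparr>edges := edges G - {e2}, ends := (ends G)(e1 := {x, z})\<rparr>"
  have V: "x \<in> verts G" "z \<in> verts G" using ends_two[OF G e1] ends_two[OF G e2] by auto
  show "multigraph ?G" using G V d unfolding multigraph_def by auto
  have ne: "e1 \<noteq> e2" using e1 e2 d by (auto simp: doubleton_eq_iff)
  have fin: "finite (edges G)" using G unfolding multigraph_def by blast
  show "mult ?G = split (mult G) x y z"
  proof (intro ext)
    fix u v
    let ?S = "{e \<in> edges G. ends G e = {u, v}}"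
    have f: "finite ?S" using fin by simp
    have dd: "{x, y} \<noteq> {y, z}" "{x, y} \<noteq> {x, z}" "{y, z} \<noteq> {x, z}" using d by (auto simp: doubleton_eq_iff)
    have sp: "split (mult G) x y z u v = (if {u, v} = {x, z} then mult G u v + 1
        else if {u, v} = {x, y} \<or> {u, v} = {y, z} then mult G u v - 1 else mult G u v)"
      using dd unfolding split_def add1_def sub1_def by auto
    consider "{u, v} = {x, z}" | "{u, v} = {x, y}" | "{u, v} = {y, z}"
      | "{u, v} \<noteq> {x, z}" "{u, v} \<noteq> {x, y}" "{u, v} \<noteq> {y, z}" by blast
    then show "mult ?G u v = split (mult G) x y z u v"
    proof cases
      case 1
      have "{e \<in> edges ?G. ends ?G e = {u, v}} = insert e1 ?S" "e1 \<notin> ?S"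
        unfolding 1 using dd e1 e2 ne by auto
      then show ?thesis using f 1 unfolding sp by (simp add: mult_def)
    next
      case 2
      have "{e \<in> edges ?G. ends ?G e = {u, v}} = ?S - {e1}" "e1 \<in> ?S"
        unfolding 2 using dd e1 e2 ne by auto
      then show ?thesis using f 2 dd unfolding sp by (simp add: mult_def)
    next
      case 3
      have "{e \<in> edges ?G. ends ?G e = {u, v}} = ?S - {e2}" "e2 \<in> ?S"
        unfolding 3 using dd e1 e2 ne by auto
      then show ?thesis using f 3 dd unfolding sp by (simp add: mult_def)
    next
      case 4
      have "{e \<in> edges ?G. ends ?G e = {u, v}} = ?S"
        using 4 e1 e2 ne by auto
      then show ?thesis using 4 unfolding sp by (simp add: mult_def)
    qed
  qed
qed

text \<open>A wheel gives paths of length one, disjoint because different edges of \<open>W4\<close>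
  have different pairs of ends; a splitting is carried out on named edges and undone by
  \<open>immerses_split\<close>.\<close>

lemma wheeled_immerses:
  assumes "wheeled m" "multigraph G" "m = mult G"
  shows "immerses G W4"
  using assms
proof (induction arbitrary: G rule: wheeled.induct)
  case (wheel h a b c d m)
  define \<phi> where "\<phi> = (\<lambda>i::nat. if i = 0 then a else if i = 1 then b else if i = 2 then c else if i = 3 then d else h)"
  have phi: "\<phi> 0 = a" "\<phi> 1 = b" "\<phi> 2 = c" "\<phi> 3 = d" "\<phi> 4 = h" unfolding \<phi>_def by auto
  have five: "{..4} = {0, 1, 2, 3, 4 :: nat}" by (auto simp: numeral_nat atMost_Suc)
  have inj: "inj_on \<phi> {..4}" unfolding five inj_on_def using wheel(1) phi by auto
  have edge: "\<exists>x\<in>edges G. ends G x = \<phi> ` {i, j}" if "1 \<le> m (\<phi> i) (\<phi> j)" for i j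
    using mult_ex[of G "\<phi> i" "\<phi> j"] that wheel.prems(2) by simp
  have W: "edges W4 = {{0, 1}, {1, 2}, {2, 3}, {3, 0}, {4, 0}, {4, 1}, {4, 2}, {4, 3}}" "ends W4 = (\<lambda>e. e)" "verts W4 = {..4}"
    unfolding W4_def by simp_all
  have eW: "\<exists>i j. e = {i, j} \<and> i \<le> 4 \<and> j \<le> 4 \<and> 1 \<le> m (\<phi> i) (\<phi> j)" if "e \<in> edges W4" for e
  proof -
    have "e \<in> {{0, 1}, {1, 2}, {2, 3}, {3, 0}, {4, 0}, {4, 1}, {4, 2}, {4, 3}}" using that unfolding W .
    then have "e = {0, 1} \<or> e = {1, 2} \<or> e = {2, 3} \<or> e = {3, 0} \<or> e = {4, 0} \<or> e = {4, 1} \<or> e = {4, 2} \<or> e = {4, 3}"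
      by (simp only: insert_iff empty_iff HOL.simp_thms)
    then show ?thesis
      by (elim disjE)
        (intro exI conjI, assumption; simp only: phi wheel(2-9); simp)+
  qed
  have "\<exists>vs es. is_path G vs es \<and> {hd vs, last vs} = \<phi> ` e \<and> set es \<subseteq> {x. ends G x = \<phi> ` e}" if "e \<in> edges W4" for e
  proof -
    obtain i j where ij: "e = {i, j}" "1 \<le> m (\<phi> i) (\<phi> j)" using eW[OF \<open>e \<in> edges W4\<close>] by blast
    obtain x where x: "x \<in> edges G" "ends G x = \<phi> ` {i, j}" using edge[OF ij(2)] by blast
    have "\<phi> i \<noteq> \<phi> j \<and> \<phi> i \<in> verts G \<and> \<phi> j \<in> verts G" by (rule ends_two[OF wheel.prems(1) x(1)]) (simp add: x(2))
    then have "is_path G [\<phi> i, \<phi> j] [x]" unfolding is_path_def using x by simp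
    then show ?thesis using x(2) unfolding ij(1) by (intro exI[of _ "[\<phi> i, \<phi> j]"] exI[of _ "[x]"]) simp
  qed
  then obtain P Q where pq: "\<And>e. e \<in> edges W4 \<Longrightarrow>
      is_path G (P e) (Q e) \<and> {hd (P e), last (P e)} = \<phi> ` e \<and> set (Q e) \<subseteq> {x. ends G x = \<phi> ` e}"
    by metis
  have "set (Q e) \<inter> set (Q f) = {}" if "e \<in> edges W4" "f \<in> edges W4" "e \<noteq> f" for e f
  proof -
    have "e \<subseteq> {..4}" "f \<subseteq> {..4}" using eW[OF that(1)] eW[OF that(2)] by auto
    then have "\<phi> ` e \<noteq> \<phi> ` f" using inj_on_image_eq_iff[OF inj] that(3) by blast
    moreover have "ends G x = \<phi> ` e" if "x \<in> set (Q e)" for x using pq[OF \<open>e \<in> edges W4\<close>] that by blast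
    moreover have "ends G x = \<phi> ` f" if "x \<in> set (Q f)" for x using pq[OF \<open>f \<in> edges W4\<close>] that by blast
    ultimately show ?thesis by (metis disjoint_iff)
  qed
  moreover have "\<phi> ` {..4} \<subseteq> verts G"
  proof -
    have mgG: "mg (verts G) m" using mg_mult[OF wheel.prems(1)] wheel.prems(2) by simp
    have "{a, b, c, d, h} \<subseteq> verts G"
      using mg_edge[OF mgG wheel(2)] mg_edge[OF mgG wheel(3)] mg_edge[OF mgG wheel(4)] mg_edge[OF mgG wheel(5)] by blast
    then show ?thesis unfolding five using phi by auto
  qed
  ultimately show ?case
    unfolding immerses_def W(2,3) using inj pq by (intro exI[of _ \<phi>] exI[of _ P] exI[of _ Q]) blast
next
  case (split x y z m)
  obtain e1 where e1: "e1 \<in> edges G" "ends G e1 = {x, y}" using mult_ex[of G x y] split by auto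
  obtain e2 where e2: "e2 \<in> edges G" "ends G e2 = {y, z}" using mult_ex[of G y z] split by auto
  show ?case
    by (rule immerses_split[OF split.prems(1) split.hyps(1) e1 e2])
      (rule split.IH; use mult_split[OF split.prems(1) split.hyps(1) e1 e2] split.prems(2) in simp)
qed

lemma path_end_edge:
  assumes "is_path G vs es" "hd vs \<noteq> last vs" "v = hd vs \<or> v = last vs"
  shows "\<exists>e\<in>set es. v \<in> ends G e"
proof -
  have p: "length vs = Suc (length es)" "\<forall>i<length es. ends G (es ! i) = {vs ! i, vs ! Suc i}"
    using assms(1) unfolding is_path_def by auto
  have "vs \<noteq> []" using p(1) by auto
  then have hl: "hd vs = vs ! 0" "last vs = vs ! length es" using p(1) by (simp_all add: hd_conv_nth last_conv_nth)
  have l: "0 < length es" using assms(2) hl by (cases "length es") auto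
  have "v \<in> ends G (es ! 0)" if "v = hd vs" using that p(2) l hl by auto
  moreover have "v \<in> ends G (es ! (length es - 1))" if "v = last vs" using that p(2) l hl by auto
  ultimately show ?thesis using assms(3) l by (metis diff_less less_numeral_extra(1) nth_mem)
qed

text \<open>Each of the four paths of the spokes has an edge at \<open>\<phi> 4\<close>, and these
  are different since the paths are edge-disjoint.\<close>

lemma immerses_W4_degree:
  assumes "finite (edges G)" "immerses G W4"
  shows "\<exists>v\<in>verts G. 4 \<le> degree G v"
proof -
  obtain \<phi> P Q where i0: "inj_on \<phi> (verts W4)" "\<phi> ` verts W4 \<subseteq> verts G"
    "\<forall>e\<in>edges W4. is_path G (P e) (Q e) \<and> {hd (P e), last (P e)} = \<phi> ` ends W4 e"
    "\<forall>e\<in>edges W4. \<forall>f\<in>edges W4. e \<noteq> f \<longrightarrow> set (Q e) \<inter> set (Q f) = {}"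
    using assms(2) by (rule immersesE)
  have i: "inj_on \<phi> (verts W4)" "\<phi> ` verts W4 \<subseteq> verts G"
    "\<And>e. e \<in> edges W4 \<Longrightarrow> is_path G (P e) (Q e) \<and> {hd (P e), last (P e)} = \<phi> ` ends W4 e"
    "\<And>e f. e \<in> edges W4 \<Longrightarrow> f \<in> edges W4 \<Longrightarrow> e \<noteq> f \<Longrightarrow> set (Q e) \<inter> set (Q f) = {}"
    using i0 by blast+
  have W: "{4, k} \<in> edges W4" "ends W4 {4, k} = {4, k}" if "k < 4" for k :: nat
  proof -
    have "k = 0 \<or> k = 1 \<or> k = 2 \<or> k = 3" using that by linarith
    then show "{4, k} \<in> edges W4" unfolding W4_def by (elim disjE) simp_all
  qed (simp add: W4_def)
  have "\<exists>e\<in>set (Q {4, k}). \<phi> 4 \<in> ends G e" if k: "k < 4" for k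
  proof -
    have e: "{hd (P {4, k}), last (P {4, k})} = {\<phi> 4, \<phi> k}" using i(3)[OF W(1)[OF k]] W(2)[OF k] by simp
    have "4 \<in> verts W4" "k \<in> verts W4" using k unfolding W4_def by auto
    then have "\<phi> 4 \<noteq> \<phi> k" using inj_onD[OF i(1), of 4 k] k by auto
    then have "hd (P {4, k}) \<noteq> last (P {4, k})" "\<phi> 4 = hd (P {4, k}) \<or> \<phi> 4 = last (P {4, k})"
      using e by (auto simp: doubleton_eq_iff)
    then show ?thesis using path_end_edge i(3)[OF W(1)[OF k]] by metis
  qed
  then obtain g where g: "\<And>k. k < 4 \<Longrightarrow> g k \<in> set (Q {4, k}) \<and> \<phi> 4 \<in> ends G (g k)" by metis
  have "inj_on g {..<4}"
  proof (rule inj_onI)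
    fix k l :: nat assume kl: "k \<in> {..<4}" "l \<in> {..<4}" "g k = g l"
    show "k = l"
    proof (rule ccontr)
      assume "k \<noteq> l"
      then have "{4, k} \<noteq> {4, l}" using kl by (auto simp: doubleton_eq_iff)
      then have "set (Q {4, k}) \<inter> set (Q {4, l}) = {}" using i(4) W(1) kl by simp
      then show False using g[of k] g[of l] kl by auto
    qed
  qed
  then have "card (g ` {..<4}) = 4" by (simp add: card_image)
  moreover have "g ` {..<4} \<subseteq> {e \<in> edges G. \<phi> 4 \<in> ends G e}"
    using g i(3) W(1) unfolding is_path_def by blast
  then have "card (g ` {..<4}) \<le> degree G (\<phi> 4)" unfolding degree_def using assms(1) by (intro card_mono) auto
  moreover have "\<phi> 4 \<in> verts G" using i(2) unfolding W4_def by auto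
  ultimately show ?thesis by auto
qed

section \<open>Chains of sausages\<close>

text \<open>\<open>c\<close> gives every edge its position on the cycle; each class of two is
  matched with the two copies.\<close>

lemma doubled_cycle_bij:
  assumes "finite E" "\<And>e. e \<in> E \<Longrightarrow> c e < n" "\<And>i. i < n \<Longrightarrow> card {e \<in> E. c e = i} = 2"
  shows "\<exists>g. bij_betw g E ({..<n} \<times> (UNIV :: bool set)) \<and> (\<forall>e\<in>E. fst (g e) = c e)"
proof -
  have "\<exists>h. bij_betw h {e \<in> E. c e = i} (UNIV :: bool set)" if "i < n" for i
    by (rule finite_same_card_bij) (use assms that in \<open>auto simp: card_UNIV_bool\<close>)
  then obtain h where h: "\<And>i. i < n \<Longrightarrow> bij_betw (h i) {e \<in> E. c e = i} (UNIV :: bool set)" by metis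
  have "bij_betw (\<lambda>e. (c e, h (c e) e)) E ({..<n} \<times> (UNIV :: bool set))"
    unfolding bij_betw_def
  proof
    show "inj_on (\<lambda>e. (c e, h (c e) e)) E"
    proof (rule inj_onI)
      fix e f assume ef: "e \<in> E" "f \<in> E" "(c e, h (c e) e) = (c f, h (c f) f)"
      then have "inj_on (h (c e)) {e' \<in> E. c e' = c e}" using h[OF assms(2)[OF ef(1)]] unfolding bij_betw_def by blast
      then show "e = f" using ef unfolding inj_on_def by auto
    qed
    show "(\<lambda>e. (c e, h (c e) e)) ` E = {..<n} \<times> (UNIV :: bool set)"
    proof (intro equalityI subsetI)
      fix t assume "t \<in> {..<n} \<times> (UNIV :: bool set)"
      then obtain i b where t: "t = (i, b)" "i < n" by auto
      then have "b \<in> h i ` {e \<in> E. c e = i}" using h[OF t(2)] unfolding bij_betw_def by simp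
      then show "t \<in> (\<lambda>e. (c e, h (c e) e)) ` E" using t(1) by auto
    qed (use assms(2) in auto)
  qed
  then show ?thesis by (intro exI[of _ "\<lambda>e. (c e, h (c e) e)"]) simp
qed

text \<open>The double edges exhaust the degree of \<open>q\<close>, and no edge joins
  \<open>p\<close> to \<open>r\<close>; so two further edges at \<open>p\<close> and two at
  \<open>r\<close> lead out of \<open>X\<close>, and contracting the rest yields the doubled cycle
  of length 4.\<close>

lemma chain3_sausages:
  assumes G: "multigraph G" and "chain3 (verts G) (mult G)"
  shows "\<exists>X. chain_of_sausages G X 3"
proof -
  let ?V = "verts G" and ?m = "mult G"
  note mgG = mg_mult[OF G]
  obtain p q r where c: "{p, q, r} \<subseteq> ?V" "p \<noteq> r" "?m p q = 2" "?m q r = 2" "?m p r = 0"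
    "deg ?V ?m p = 4" "deg ?V ?m q = 4" "deg ?V ?m r = 4"
    using assms(2) unfolding chain3_def by blast
  have ne: "p \<noteq> q" "q \<noteq> r" using c(3,4) mgD(3)[OF mgG] by auto
  define X where "X = {p, q, r}"
  define E where "E = {e \<in> edges G. \<not> ends G e \<subseteq> ?V - X}"
  have fin: "finite (edges G)" using G unfolding multigraph_def by blast
  have fE: "finite E" unfolding E_def using fin by simp
  have EX: "e \<in> E \<longleftrightarrow> e \<in> edges G \<and> (p \<in> ends G e \<or> q \<in> ends G e \<or> r \<in> ends G e)" for e
  proof -
    have "ends G e \<subseteq> ?V" if "e \<in> edges G" using G that unfolding multigraph_def by blast
    then show ?thesis unfolding E_def X_def by blast
  qed
  let ?at = "\<lambda>v. {e \<in> edges G. v \<in> ends G e}" and ?bt = "\<lambda>u v. {e \<in> edges G. ends G e = {u, v}}"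
  have at: "card (?at p) = 4" "card (?at q) = 4" "card (?at r) = 4"
    using degree_deg[OF G] c unfolding degree_def by auto
  have bt: "card (?bt p q) = 2" "card (?bt q r) = 2" "?bt p r = {}"
    using c(3-5) fin unfolding mult_def by auto
  have fb: "finite (?at v)" "finite (?bt u v)" for u v using fin by auto
  have pqr: "{p, q} \<noteq> {q, r}" using ne c(2) by (simp add: doubleton_eq_iff)
  then have "?bt p q \<inter> ?bt q r = {}" by auto
  then have "card (?bt p q \<union> ?bt q r) = 4" using bt card_Un_disjoint[OF fb(2) fb(2), of p q q r] by simp
  moreover have s: "?bt p q \<union> ?bt q r \<subseteq> ?at q" by blast
  ultimately have "card (?bt p q \<union> ?bt q r) = card (?at q)" using at(2) by simp
  then have atq: "?at q = ?bt p q \<union> ?bt q r" by (rule card_subset_eq[OF fb(1) s, symmetric])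
  have noq: "ends G e = {p, q} \<or> ends G e = {q, r}" if "e \<in> edges G" "q \<in> ends G e" for e
    using atq that by blast
  have nopr: "\<not> (p \<in> ends G e \<and> r \<in> ends G e)" if e: "e \<in> edges G" for e
  proof
    assume a: "p \<in> ends G e \<and> r \<in> ends G e"
    obtain u v where "ends G e = {u, v}" using ends_ex[OF G e] by blast
    then have "ends G e = {p, r}" using a c(2) by auto
    then show False using bt(3) e by blast
  qed
  \<comment> \<open>Positions on the cycle \<open>p\<close>, \<open>q\<close>, \<open>r\<close>,
    \<open>None\<close>; the class 3 closes it from \<open>None\<close> back to
    \<open>p\<close>.\<close>
  define k :: "'b \<Rightarrow> nat" where "k e = (if ends G e = {p, q} then 0 else if ends G e = {q, r} then 1 else if r \<in> ends G e then 2 else 3)" for e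
  have k0: "{e \<in> E. k e = 0} = ?bt p q" unfolding k_def EX by auto
  have k1: "{e \<in> E. k e = 1} = ?bt q r" unfolding k_def EX using pqr by auto
  have k2: "{e \<in> E. k e = 2} = ?at r - ?bt q r"
  proof (intro equalityI subsetI)
    fix e assume "e \<in> {e \<in> E. k e = 2}"
    then have "e \<in> edges G" "r \<in> ends G e" "ends G e \<noteq> {q, r}" unfolding k_def EX by (auto split: if_splits)
    then show "e \<in> ?at r - ?bt q r" by blast
  next
    fix e assume "e \<in> ?at r - ?bt q r"
    then have e: "e \<in> edges G" "r \<in> ends G e" "ends G e \<noteq> {q, r}" by auto
    then have "p \<notin> ends G e" using nopr by blast
    then have "ends G e \<noteq> {p, q}" by blast
    then show "e \<in> {e \<in> E. k e = 2}" unfolding k_def EX using e by simp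
  qed
  have k3: "{e \<in> E. k e = 3} = ?at p - ?bt p q"
  proof (intro equalityI subsetI)
    fix e assume "e \<in> {e \<in> E. k e = 3}"
    then have e: "e \<in> edges G" "p \<in> ends G e \<or> q \<in> ends G e \<or> r \<in> ends G e" "ends G e \<noteq> {p, q}" "ends G e \<noteq> {q, r}" "r \<notin> ends G e"
      unfolding k_def EX by (auto split: if_splits)
    then show "e \<in> ?at p - ?bt p q" using noq[OF e(1)] by blast
  next
    fix e assume "e \<in> ?at p - ?bt p q"
    then have e: "e \<in> edges G" "p \<in> ends G e" "ends G e \<noteq> {p, q}" by auto
    then have "r \<notin> ends G e" using nopr by blast
    then have "ends G e \<noteq> {q, r}" by blast
    then show "e \<in> {e \<in> E. k e = 3}" unfolding k_def EX using e \<open>r \<notin> ends G e\<close> by simp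
  qed
  have cards: "card {e \<in> E. k e = i} = 2" if "i < 4" for i
  proof -
    have "?bt q r \<subseteq> ?at r" "?bt p q \<subseteq> ?at p" by auto
    then have "card (?at r - ?bt q r) = 2" "card (?at p - ?bt p q) = 2"
      using at bt card_Diff_subset[OF fb(2), of q r "?at r"] card_Diff_subset[OF fb(2), of p q "?at p"] by simp_all
    moreover have "i = 0 \<or> i = 1 \<or> i = 2 \<or> i = 3" using that by linarith
    ultimately show ?thesis using k0 k1 k2 k3 bt(1,2) by (elim disjE) (simp_all only:)
  qed
  have "k e < 4" for e unfolding k_def by simp
  then obtain g where g: "bij_betw g E ({..<4} \<times> (UNIV :: bool set))" "\<And>e. e \<in> E \<Longrightarrow> fst (g e) = k e"
    using doubled_cycle_bij[OF fE _ cards] by metis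
  define f where "f = (\<lambda>t. case t of None \<Rightarrow> 3 | Some u \<Rightarrow> if u = p then 0 else if u = q then 1 else (2::nat))"
  have fv: "f None = 3" "f (Some p) = 0" "f (Some q) = 1" "f (Some r) = 2"
    unfolding f_def using ne c(2) by auto
  let ?I = "identify G (?V - X)"
  have VX: "?V - (?V - X) = X" using c(1) unfolding X_def by blast
  have I: "verts ?I = {None, Some p, Some q, Some r}" "edges ?I = E"
    "ends ?I e = (\<lambda>v. if v \<in> ?V - X then None else Some v) ` ends G e" for e
    unfolding identify_def E_def by (simp_all add: VX) (simp add: X_def)
  let ?D = "doubled_cycle (3 + 1)"
  have D: "verts ?D = {..<4}" "edges ?D = {..<4} \<times> UNIV" "ends ?D t = {fst t, Suc (fst t) mod 4}" for t
    unfolding doubled_cycle_def by (simp_all add: case_prod_unfold)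
  have four: "{..<4} = {0, 1, 2, 3 :: nat}" by (auto simp: numeral_nat lessThan_Suc)
  have bf: "bij_betw f (verts ?I) (verts ?D)"
    unfolding bij_betw_def I D four inj_on_def using fv ne c(2) by auto
  have Xin: "p \<notin> ?V - X" "q \<notin> ?V - X" "r \<notin> ?V - X" unfolding X_def by auto
  have third: "\<exists>w. ends G e = {u, w} \<and> w \<in> ?V - X" if e: "e \<in> edges G" "u \<in> ends G e" and
    n: "\<And>w. w \<in> X \<Longrightarrow> w \<noteq> u \<Longrightarrow> w \<notin> ends G e" for e u
  proof -
    obtain a b where ab: "ends G e = {a, b}" "a \<noteq> b" "a \<in> ?V" "b \<in> ?V" using ends_ex[OF G e(1)] by blast
    show ?thesis
    proof (cases "u = a")
      case True
      then show ?thesis using ab n[of b] by auto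
    next
      case False
      then have "u = b" using e(2) ab(1) by blast
      then show ?thesis using ab n[of a] by (intro exI[of _ a]) auto
    qed
  qed
  have ge: "ends ?D (g e) = f ` ends ?I e" if e: "e \<in> E" for e
  proof -
    have eG: "e \<in> edges G" using e unfolding E_def by blast
    have De: "ends ?D (g e) = {k e, Suc (k e) mod 4}" unfolding D g(2)[OF e] ..
    consider "ends G e = {p, q}" | "ends G e = {q, r}" | "r \<in> ends G e" "ends G e \<noteq> {q, r}"
      | "p \<in> ends G e" "ends G e \<noteq> {p, q}" using e noq[OF eG] unfolding EX by blast
    then show ?thesis
    proof cases
      case 1
      then have "k e = 0" unfolding k_def by simp
      then show ?thesis unfolding De I 1 using Xin fv by auto
    next
      case 2
      then have "k e = 1" unfolding k_def using 2 pqr by simp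
      then show ?thesis unfolding De I 2 using Xin fv by auto
    next
      case 3
      have "q \<notin> ends G e" "p \<notin> ends G e" using 3 noq[OF eG] nopr[OF eG] by blast+
      then obtain w where w: "ends G e = {r, w}" "w \<in> ?V - X"
        using third[OF eG 3(1)] unfolding X_def by blast
      have "k e = 2" unfolding k_def using 3 \<open>p \<notin> ends G e\<close> by auto
      then show ?thesis unfolding De I w(1) using Xin fv w(2) by auto
    next
      case 4
      have n: "q \<notin> ends G e" "r \<notin> ends G e" using 4 noq[OF eG] nopr[OF eG] by blast+
      then obtain w where w: "ends G e = {p, w}" "w \<in> ?V - X"
        using third[OF eG 4(1)] unfolding X_def by blast
      have "k e = 3" unfolding k_def using 4 n by auto
      then show ?thesis unfolding De I w(1) using Xin fv w(2) by auto
    qed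
  qed
  have "isomorphic ?I ?D"
    unfolding isomorphic_def using bf g(1) ge I(2) D(2) by (intro exI[of _ f] exI[of _ g]) simp
  moreover have "X \<noteq> ?V"
  proof
    assume "X = ?V"
    then have "?V = {p, q, r}" unfolding X_def by simp
    then have "deg ?V ?m p = 2" unfolding deg_def using c ne mgD(3)[OF mgG] by simp
    then show False using c(6) by simp
  qed
  then have "X \<subset> ?V" using c(1) unfolding X_def by blast
  moreover have "card X = 3" unfolding X_def using ne c(2) by simp
  ultimately show ?thesis unfolding chain_of_sausages_def by (intro exI[of _ X]) simp
qed

theorem theorem1p3:
  fixes G :: "('v, 'e) mgraph"
  assumes "multigraph G"
    and "edge_connected 3 G"
    and "internally_edge_connected 4 G"
    and "sausage_reduced G"
    and "card (verts G) \<ge> 6"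
  shows "\<not> immerses G W4 \<longleftrightarrow> cubic G"
proof
  assume "cubic G"
  show "\<not> immerses G W4"
  proof
    assume "immerses G W4"
    moreover have "finite (edges G)" using assms(1) unfolding multigraph_def by blast
    ultimately obtain v where "v \<in> verts G" "4 \<le> degree G v" using immerses_W4_degree by blast
    then show False using \<open>cubic G\<close> unfolding cubic_def by auto
  qed
next
  assume no: "\<not> immerses G W4"
  have nw: "\<not> wheeled (mult G)" using wheeled_immerses[OF _ assms(1) refl] no by blast
  have nc: "\<not> chain3 (verts G) (mult G)"
    using chain3_sausages[OF assms(1)] assms(4) unfolding sausage_reduced_def by blast
  \<comment> \<open>A vertex of degree at least 4 would complete the hypotheses of
    \<open>wheeled_or_chain3\<close>, and the exception \<open>star5\<close> is ruled out by the
    number of vertices.\<close>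
  have small: "degree G v < 4" if "v \<in> verts G" for v
  proof (rule ccontr)
    assume "\<not> degree G v < 4"
    then have "conn (verts G) (mult G)" using conn_mult[OF assms(1-3) that] by simp
    then show False using wheeled_or_chain3 nw nc assms(5) by fastforce
  qed
  show "cubic G"
    unfolding cubic_def
  proof
    fix v assume v: "v \<in> verts G"
    have fin: "finite (verts G)" using assms(1) unfolding multigraph_def by blast
    have "card (verts G - {v}) = card (verts G) - 1" using v fin by simp
    then have "1 \<le> card {v} \<and> 1 \<le> card (verts G - {v})" using assms(5) by simp
    then have "3 \<le> cut_size G {v}" using assms(2) v unfolding edge_connected_def by blast
    moreover have "cut_size G {v} = degree G v"
      using cut_size_cut[OF assms(1), of "{v}"] degree_deg[OF assms(1) v] deg_cut[OF mg_mult[OF assms(1)] v] v by simp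
    ultimately show "degree G v = 3" using small[OF v] by linarith
  qed
qed

end
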